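(* For each $j$ let $\lambda_j$ be a $5$-series or $6$-series Dirichlet eigenvalue of $-\Delta$ on the Sierpiński gasket $\mathrm{SG}$ with generation of birth $j$, let $E_j$ be its eigenspace, $d_j=\dim E_j$, and $P_j$ the orthogonal projection of $L^2(\mathrm{SG},\mu)$ onto $E_j$. Let $f$ be a positive continuous function on $\mathrm{SG}$ and $[f]$ the operator of multiplication by $f$. Then $$\lim_{j\to\infty}\frac{1}{d_j}\log\det P_j[f]P_j=\int_{\mathrm{SG}}\log f(x)\,d\mu(x).$$ If in addition $f$ is Hölder continuous of order $\alpha$ in the effective resistance metric $d$ on $\mathrm{SG}$, then, as $j\to\infty$, $$\frac{1}{d_j}\log\det P_j[f]P_j-\int_{\mathrm{SG}}\log f(x)\,d\mu(x)=O(d_j^{-\beta}),\qquad \beta=\frac{\alpha\log(5/3)}{\log 3+\alpha\log(5/3)}=1-\frac{\log 3}{\alpha\log(5/3)+\log 3}.$$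
   Context: Sierpiński gasket: let $F_1(x)=\frac12x$, $F_2(x)=\frac12x+(\frac12,0)$, $F_3(x)=\frac12x+(\frac14,\frac{\sqrt3}{4})$ on $\mathbb{R}^2$; $\mathrm{SG}$ is the unique nonempty compact set with $\mathrm{SG}=\bigcup_{i=1}^3F_i(\mathrm{SG})$. For a word $\omega=(\omega_1,\dots,\omega_m)$ in $\{1,2,3\}$, $F_\omega=F_{\omega_1}\circ\cdots\circ F_{\omega_m}$, and $F_\omega(\mathrm{SG})$ is called an $m$-cell. $\mu$ is the probability measure on $\mathrm{SG}$ giving each $m$-cell measure $3^{-m}$. $V_0=\{(0,0),(1,0),(\frac12,\frac{\sqrt3}{2})\}$ is the boundary, $V_m=\bigcup_{i=1}^3F_iV_{m-1}$; for distinct $x,y\in V_m$ write $x\sim_m y$ if $x,y$ lie in a common $m$-cell. Resistance metric: the energy is $\mathcal{E}(u,u)=\lim_{m\to\infty}(5/3)^m\sum_{x\sim_m y}(u(x)-u(y))^2$ (sum over edges) for continuous $u$, and for $x\neq y$, $d(x,y)=\left(\min\{\mathcal{E}(u,u):u(x)=0,\ u(y)=1\}\right)^{-1}$, with $d(x,x)=0$. Laplacian: $\Delta_mu(x)=\sum_{y\sim_mx}u(y)-4u(x)$ for $x\in V_m\setminus V_0$, and $\Delta u=\frac32\lim_{m\to\infty}5^m\Delta_mu$ (a continuous $u$ is in the domain with $\Delta u=g$, $g$ continuous, if the convergence to $g$ is uniform on $\bigcup_mV_m\setminus V_0$). A Dirichlet eigenfunction with eigenvalue $\lambda$ is a nonzero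 $u$ in the domain of $\Delta$ with $-\Delta u=\lambda u$ and $u|_{V_0}=0$; the eigenspace is the (finite-dimensional) space of these together with $0$. Series and generation of birth (spectral decimation): consider sequences $(\gamma_k)_{k\ge j}$ with $\gamma_k=\frac12\left(5+\epsilon_k\sqrt{25-4\gamma_{k-1}}\right)$ for $k>j$, $\epsilon_k\in\{\pm1\}$, with $\epsilon_k=1$ for only finitely many $k$, and set $\lambda=\frac32\lim_{k\to\infty}5^k\gamma_k$. The $5$-series eigenvalues with generation of birth $j\ge1$ are the $\lambda$ so obtained with $\gamma_j=5$; the $6$-series eigenvalues with generation of birth $j\ge2$ are those obtained with $\gamma_j=6$ and $\epsilon_{j+1}=+1$. (These are Dirichlet eigenvalues of $-\Delta$, of multiplicity $\frac12(3^{j-1}+3)$ and $\frac12(3^j-3)$ respectively.) $\det P_j[f]P_j$ is the determinant of $P_j[f]P_j$ regarded as a linear operator on the finite-dimensional space $E_j$. *)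

theory Defs
  imports
    "HOL-Probability.Probability"
    "HOL-Library.Function_Algebras"
    "HOL-Library.Landau_Symbols"
    "Jordan_Normal_Form.Determinant"
begin

type_synonym point = "real \<times> real"

definition sg_map :: "nat \<Rightarrow> point \<Rightarrow> point" where
  "sg_map i x = (1/2) *\<^sub>R x +
     (if i = 1 then (0, 0) else if i = 2 then (1/2, 0) else (1/4, sqrt 3 / 4))"

definition SG :: "point set" where
  "SG = (THE K. compact K \<and> K \<noteq> {} \<and> K = (\<Union>i\<in>{1,2,3}. sg_map i ` K))"

definition words :: "nat \<Rightarrow> nat list set" where
  "words m = {w. length w = m \<and> set w \<subseteq> {1,2,3}}"

definition word_map :: "nat list \<Rightarrow> point \<Rightarrow> point" where
  "word_map w = foldr (\<lambda>i g. sg_map i \<circ> g) w id"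

definition cell :: "nat list \<Rightarrow> point set" where
  "cell w = word_map w ` SG"

definition sg_measure :: "point measure" where
  "sg_measure = (THE M. prob_space M \<and> space M = SG \<and>
     sets M = sets (restrict_space borel SG) \<and>
     (\<forall>m. \<forall>w\<in>words m. measure M (cell w) = (1/3) ^ m))"

fun V :: "nat \<Rightarrow> point set" where
  "V 0 = {(0, 0), (1, 0), (1/2, sqrt 3 / 2)}"
| "V (Suc m) = (\<Union>i\<in>{1,2,3}. sg_map i ` V m)"

definition adj :: "nat \<Rightarrow> point \<Rightarrow> point \<Rightarrow> bool" where
  "adj m x y \<longleftrightarrow> x \<in> V m \<and> y \<in> V m \<and> x \<noteq> y \<and> (\<exists>w\<in>words m. x \<in> cell w \<and> y \<in> cell w)"

(* Every edge occurs in the sum as two ordered pairs, hence the division by 2. *)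
definition graph_energy :: "nat \<Rightarrow> (point \<Rightarrow> real) \<Rightarrow> real" where
  "graph_energy m u = (5/3) ^ m * ((\<Sum>(x, y)\<in>{(x, y). adj m x y}. (u x - u y)\<^sup>2) / 2)"

(* For fixed u the sequence is nondecreasing, so the limit exists in [0, infinity]. *)
definition energy :: "(point \<Rightarrow> real) \<Rightarrow> ennreal" where
  "energy u = lim (\<lambda>m. ennreal (graph_energy m u))"

(* For distinct points of SG the infimum is attained, finite and positive. *)
definition resistance :: "point \<Rightarrow> point \<Rightarrow> real" where
  "resistance x y = (if x = y then 0
     else inverse (enn2real (INF u\<in>{u. continuous_on SG u \<and> u x = 0 \<and> u y = 1}. energy u)))"

definition holder_resistance :: "real \<Rightarrow> (point \<Rightarrow> real) \<Rightarrow> bool" where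
  "holder_resistance \<alpha> f \<longleftrightarrow>
     (\<exists>C. \<forall>x\<in>SG. \<forall>y\<in>SG. \<bar>f x - f y\<bar> \<le> C * resistance x y powr \<alpha>)"

definition graph_laplacian :: "nat \<Rightarrow> (point \<Rightarrow> real) \<Rightarrow> point \<Rightarrow> real" where
  "graph_laplacian m u x = (\<Sum>y\<in>{y. adj m x y}. u y) - 4 * u x"

(* At stage m the difference operator lives on V m - V 0 only, so uniform convergence on the
   increasing union of these sets is a bound over V m - V 0 for all large m. *)
definition has_laplacian :: "(point \<Rightarrow> real) \<Rightarrow> (point \<Rightarrow> real) \<Rightarrow> bool" where
  "has_laplacian u g \<longleftrightarrow> continuous_on SG u \<and> continuous_on SG g \<and>
     (\<forall>e>0. \<exists>N. \<forall>m\<ge>N. \<forall>x\<in>V m - V 0.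
        \<bar>3/2 * (5 ^ m * graph_laplacian m u x) - g x\<bar> < e)"

(* Functions on SG are represented by their extension by 0 to the plane, so that equality of
   functions on SG is equality in HOL. *)
definition dirichlet_eigenfunction :: "real \<Rightarrow> (point \<Rightarrow> real) \<Rightarrow> bool" where
  "dirichlet_eigenfunction l u \<longleftrightarrow> u \<noteq> 0 \<and> (\<forall>x. x \<notin> SG \<longrightarrow> u x = 0) \<and>
     has_laplacian u (\<lambda>x. - (l * u x)) \<and> (\<forall>x\<in>V 0. u x = 0)"

definition eigenspace :: "real \<Rightarrow> (point \<Rightarrow> real) set" where
  "eigenspace l = {u. dirichlet_eigenfunction l u} \<union> {0}"

definition decimation :: "nat \<Rightarrow> real \<Rightarrow> (nat \<Rightarrow> real) \<Rightarrow> (nat \<Rightarrow> real) \<Rightarrow> bool" where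
  "decimation j l \<gamma> \<epsilon> \<longleftrightarrow>
     (\<forall>k>j. \<epsilon> k \<in> {-1, 1} \<and> \<gamma> k = 1/2 * (5 + \<epsilon> k * sqrt (25 - 4 * \<gamma> (k - 1)))) \<and>
     finite {k. k > j \<and> \<epsilon> k = 1} \<and>
     (\<lambda>k. 3/2 * (5 ^ k * \<gamma> k)) \<longlonglongrightarrow> l"

definition five_series :: "nat \<Rightarrow> real \<Rightarrow> bool" where
  "five_series j l \<longleftrightarrow> 1 \<le> j \<and> (\<exists>\<gamma> \<epsilon>. decimation j l \<gamma> \<epsilon> \<and> \<gamma> j = 5)"

definition six_series :: "nat \<Rightarrow> real \<Rightarrow> bool" where
  "six_series j l \<longleftrightarrow> 2 \<le> j \<and> (\<exists>\<gamma> \<epsilon>. decimation j l \<gamma> \<epsilon> \<and> \<gamma> j = 6 \<and> \<epsilon> (j + 1) = 1)"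

interpretation fun_space: vector_space "\<lambda>(c::real) (u :: 'a \<Rightarrow> real) x. c * u x"
  by unfold_locales (auto simp: fun_eq_iff algebra_simps)

(* Meaningful for finite-dimensional E; the value does not depend on the chosen basis. *)
definition operator_det ::
    "(point \<Rightarrow> real) set \<Rightarrow> ((point \<Rightarrow> real) \<Rightarrow> point \<Rightarrow> real) \<Rightarrow> real" where
  "operator_det E T =
     (let bs = (SOME bs. distinct bs \<and> fun_space.independent (set bs) \<and>
                         fun_space.span (set bs) = E)
      in Determinant.det (Matrix.mat (length bs) (length bs)
           (\<lambda>(i, k). fun_space.representation (set bs) (T (bs ! k)) (bs ! i))))"

definition L2_inner :: "(point \<Rightarrow> real) \<Rightarrow> (point \<Rightarrow> real) \<Rightarrow> real" where
  "L2_inner u v = (LINT x|sg_measure. u x * v x)"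

(* To be applied to square-integrable g. The measure has full support, so the continuous
   functions in an eigenspace E are determined by their L2 classes. *)
definition ortho_proj :: "(point \<Rightarrow> real) set \<Rightarrow> (point \<Rightarrow> real) \<Rightarrow> point \<Rightarrow> real" where
  "ortho_proj E g = (THE h. h \<in> E \<and> (\<forall>v\<in>E. L2_inner (g - h) v = 0))"

definition mult_op :: "(point \<Rightarrow> real) \<Rightarrow> (point \<Rightarrow> real) \<Rightarrow> point \<Rightarrow> real" where
  "mult_op f u = (\<lambda>x. f x * u x)"

end

theory Submission
  imports Defs
begin

text \<open>The determinant of \<open>P\<^sub>j[f]P\<^sub>j\<close> is the quotient of the Gram determinants of a basis of \<open>E\<^sub>j\<close> for the
  weights \<open>f\<close> and \<open>1\<close>. Up to at most \<open>6 \<cdot> 3^N\<close> dimensions, \<open>E\<^sub>j\<close> is spanned by eigenfunctions supported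
  in single \<open>N\<close>-cells, equally many in each cell: it suffices that an eigenfunction and its normal
  derivatives vanish at the corners of the cells for the pieces to be eigenfunctions themselves. On
  these functions \<open>f\<close> is nearly constant, so comparing distances to spans in the two weighted norms,
  one basis vector after the other, gives
  \<open>\<bar>log det / d\<^sub>j - \<integral> log f\<bar> \<le> 2 \<omega> + 12 \<Lambda> 3^N / d\<^sub>j\<close>, where \<open>\<omega>\<close> is the oscillation of \<open>log f\<close> on \<open>N\<close>-cells
  and \<open>\<Lambda>\<close> bounds \<open>\<bar>log f\<bar>\<close>. Spectral decimation started from an explicit function on the level-2 graph
  gives an eigenfunction supported in each \<open>(j - 2)\<close>-cell, so \<open>d\<^sub>j \<ge> 3^(j - 2)\<close>. Since \<open>N\<close>-cells have
  resistance diameter \<open>O((3/5)^N)\<close>, the rate follows by choosing \<open>N\<close> with \<open>3^N\<close> close to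
  \<open>d\<^sub>j^(1 - \<beta>)\<close>.\<close>

section \<open>Geometry of the gasket\<close>

text \<open>Cutting an eigenfunction off outside a cell is delicate: the Laplacian is a uniform
  limit of \<open>5^m\<close> times graph differences, junctions included, and the cut leaves the
  one-sided difference of a single cell there. Existence of the normal derivative bounds this
  difference only by \<open>O((3/5)^m)\<close>. If the normal derivative is 0, the difference is a
  sum of Laplacians near the corner, which are small because the eigenfunction vanishes at the
  corner; this yields the required \<open>o(5^(-m))\<close>. So each of the three corners of a cell
  costs one value and one derivative, six conditions per cell whatever the eigenvalue. This count
  replaces a description of the eigenspaces, and spectral decimation enters only to make their
  dimension large.

  The remaining basis vectors need not be orthogonal to the localized ones for both weights, so the
  determinants do not split into blocks. A Gram determinant is, however, the product of the squared
  distances of the basis vectors from the spans of their predecessors. A distance is a minimum, so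
  one suitable competitor gives each inequality.\<close>

declare V.simps [simp del]

section \<open>Corners, barycentric coordinates and the three contractions\<close>

definition corner :: "nat \<Rightarrow> point" where
  "corner i = (if i = 1 then (0, 0) else if i = 2 then (1, 0) else (1/2, sqrt 3 / 2))"

definition bary :: "nat \<Rightarrow> point \<Rightarrow> real" where
  "bary i x = (if i = 1 then 1 - fst x - snd x / sqrt 3
     else if i = 2 then fst x - snd x / sqrt 3 else 2 * snd x / sqrt 3)"

definition sg_inv :: "nat \<Rightarrow> point \<Rightarrow> point" where
  "sg_inv i x = 2 *\<^sub>R x - corner i"

lemma sg_map_corner_eq: "sg_map i x = (1/2) *\<^sub>R (x + corner i)"
  by (auto simp: sg_map_def corner_def prod_eq_iff)

lemma sg_inv_map [simp]: "sg_inv i (sg_map i x) = x"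
  by (simp add: sg_inv_def sg_map_corner_eq)

lemma sg_map_inv [simp]: "sg_map i (sg_inv i x) = x"
  by (simp add: sg_inv_def sg_map_corner_eq)

lemma inj_sg_map: "inj (sg_map i)"
  by (metis injI sg_inv_map)

lemma sg_map_eq_iff [simp]: "sg_map i x = sg_map i y \<longleftrightarrow> x = y"
  using inj_sg_map by (auto dest: injD)

lemma sg_map_fixed [simp]: "sg_map i (corner i) = corner i"
  by (simp add: sg_map_corner_eq flip: scaleR_2)

text \<open>Both sides are the midpoint of the two corners. For \<open>i \<noteq> k\<close> this is
  the junction, the only point shared by the cells \<open>i\<close> and \<open>k\<close>.\<close>

lemma sg_map_commute: "sg_map i (corner k) = sg_map k (corner i)"
  by (simp add: sg_map_corner_eq add.commute)

lemma dist_sg_map: "dist (sg_map i x) (sg_map i y) = dist x y / 2"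
proof -
  have "dist (sg_map i x) (sg_map i y) = norm ((1/2) *\<^sub>R (x - y))"
    by (simp add: sg_map_corner_eq dist_norm algebra_simps)
  then show ?thesis by (simp add: dist_norm)
qed

lemma continuous_on_sg_map: "continuous_on S (sg_map i)"
  unfolding sg_map_corner_eq by (intro continuous_intros)

lemma continuous_on_sg_inv: "continuous_on S (sg_inv i)"
  unfolding sg_inv_def by (intro continuous_intros)

lemma V_0: "V 0 = corner ` {1,2,3}"
  by (auto simp: corner_def V.simps(1))

lemma corner_in_V0: "i \<in> {1,2,3} \<Longrightarrow> corner i \<in> V 0"
  by (simp only: V_0) blast

lemma bary_sg_map:
  "\<lbrakk>i \<in> {1,2,3}; k \<in> {1,2,3}\<rbrakk> \<Longrightarrow> bary k (sg_map i x) = (bary k x + (if k = i then 1 else 0)) / 2"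
  by (auto simp: bary_def sg_map_corner_eq corner_def field_simps)

lemma bary_corner:
  "\<lbrakk>i \<in> {1,2,3}; k \<in> {1,2,3}\<rbrakk> \<Longrightarrow> bary k (corner i) = (if k = i then 1 else 0)"
  by (auto simp: bary_def corner_def field_simps)

lemma bary_sum: "bary 1 x + bary 2 x + bary 3 x = 1"
  by (simp add: bary_def field_simps)

lemma bary_eqI: "\<lbrakk>bary 2 x = bary 2 y; bary 3 x = bary 3 y\<rbrakk> \<Longrightarrow> x = y"
  by (auto simp: bary_def prod_eq_iff)

lemma continuous_on_bary: "continuous_on S (bary i)"
  unfolding bary_def by (cases "i = 1"; cases "i = 2") (auto intro!: continuous_intros)

lemma corner_eq_iff: "\<lbrakk>i \<in> {1,2,3}; k \<in> {1,2,3}\<rbrakk> \<Longrightarrow> corner i = corner k \<longleftrightarrow> i = k"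
  using bary_corner by (metis zero_neq_one)

definition triangle :: "point set" where
  "triangle = {x. \<forall>i\<in>{1,2,3}. bary i x \<ge> 0}"

lemma compact_triangle: "compact triangle"
proof -
  have "triangle = (\<Inter>i\<in>{1,2,3}. {x. 0 \<le> bary i x})" by (auto simp: triangle_def)
  moreover have "closed {x. 0 \<le> bary i x}" for i
    by (intro closed_Collect_le continuous_intros continuous_on_bary)
  ultimately have "closed triangle" by (metis closed_INT)
  moreover have "triangle \<subseteq> cbox (-2,-2) (2,2)"
  proof
    fix x assume x: "x \<in> triangle"
    have s3: "sqrt 3 > 0" "sqrt 3 \<le> 2" by (auto simp: real_le_lsqrt)
    have h: "0 \<le> 1 - fst x - snd x / sqrt 3" "0 \<le> fst x - snd x / sqrt 3" "0 \<le> 2 * snd x / sqrt 3"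
      using x by (auto simp: triangle_def bary_def)
    then have y: "snd x / sqrt 3 \<le> 1" "0 \<le> snd x / sqrt 3" by linarith+
    then have "snd x \<le> sqrt 3" "0 \<le> snd x" using s3 by (auto simp: field_simps)
    moreover have "0 \<le> fst x" "fst x \<le> 1" using h y by auto
    ultimately have "fst x \<ge> -2" "snd x \<ge> -2" "fst x \<le> 2" "snd x \<le> 2" using s3(2) by linarith+
    then show "x \<in> cbox (-2,-2) (2,2)" by (cases x) (simp add: cbox_Pair_eq)
  qed
  ultimately show ?thesis using bounded_cbox bounded_subset compact_eq_bounded_closed by metis
qed

lemma sg_map_triangle: "i \<in> {1,2,3} \<Longrightarrow> x \<in> triangle \<Longrightarrow> sg_map i x \<in> triangle"
  unfolding triangle_def mem_Collect_eq by (intro ballI, subst bary_sg_map) auto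

lemma corner_triangle: "i \<in> {1,2,3} \<Longrightarrow> corner i \<in> triangle"
  unfolding triangle_def mem_Collect_eq by (intro ballI, subst bary_corner) auto

lemma bary_le_1: "\<lbrakk>x \<in> triangle; i \<in> {1,2,3}\<rbrakk> \<Longrightarrow> bary i x \<le> 1"
  using bary_sum[of x] by (auto simp: triangle_def)

lemma bary_eq_1:
  assumes x: "x \<in> triangle" and i: "i \<in> {1,2,3}" and b: "bary i x = 1"
  shows "x = corner i"
proof -
  have nn: "bary 1 x \<ge> 0" "bary 2 x \<ge> 0" "bary 3 x \<ge> 0" using x by (auto simp: triangle_def)
  consider "i = 1" | "i = 2" | "i = 3" using i by blast
  then have "bary 2 x = (if 2 = i then 1 else 0) \<and> bary 3 x = (if 3 = i then 1 else 0)"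
    by cases (use nn b bary_sum[of x] in auto)
  then show ?thesis using bary_corner[OF i, of 2] bary_corner[OF i, of 3] by (intro bary_eqI) auto
qed

text \<open>Coordinate \<open>k\<close> of the two images gives
  \<open>bary k x = bary k y + 1\<close>, which forces \<open>bary k x = 1\<close> and hence the
  corner \<open>k\<close>; coordinate \<open>i\<close> does the same for \<open>y\<close>.\<close>

lemma triangle_inter:
  assumes ik: "i \<in> {1,2,3}" "k \<in> {1,2,3}" "i \<noteq> k"
    and xy: "x \<in> triangle" "y \<in> triangle" "sg_map i x = sg_map k y"
  shows "x = corner k" "y = corner i"
proof -
  have e: "bary j x + (if j = i then 1 else 0) = bary j y + (if j = k then 1 else 0)" if "j \<in> {1,2,3}" for j
    using bary_sg_map[OF ik(1) that, of x] bary_sg_map[OF ik(2) that, of y] xy(3) by simp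
  have nn: "bary i x \<ge> 0" "bary k y \<ge> 0" using xy ik by (auto simp: triangle_def)
  have "bary k x = 1" using e[OF ik(2)] ik(3) nn bary_le_1[OF xy(1) ik(2)] by simp
  then show "x = corner k" using bary_eq_1 xy(1) ik by blast
  have "bary i y = 1" using e[OF ik(1)] ik(3) nn bary_le_1[OF xy(2) ik(1)] by simp
  then show "y = corner i" using bary_eq_1 xy(2) ik by blast
qed

section \<open>Existence and uniqueness of the attractor\<close>

primrec tri_approx :: "nat \<Rightarrow> point set" where
  "tri_approx 0 = triangle"
| "tri_approx (Suc n) = (\<Union>i\<in>{1,2,3}. sg_map i ` tri_approx n)"

lemma tri_approx_Suc_subset: "tri_approx (Suc n) \<subseteq> tri_approx n"
proof (induction n)
  case 0
  then show ?case using sg_map_triangle by auto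
next
  case (Suc n)
  then show ?case by (simp only: tri_approx.simps(2)) blast
qed

lemma tri_approx_antimono: "m \<le> n \<Longrightarrow> tri_approx n \<subseteq> tri_approx m"
  by (rule lift_Suc_antimono_le[of tri_approx, OF tri_approx_Suc_subset])

lemma compact_tri_approx: "compact (tri_approx n)"
proof (induction n)
  case (Suc n)
  then show ?case unfolding tri_approx.simps
    by (intro compact_UN ballI compact_continuous_image continuous_on_sg_map) simp
qed (simp add: compact_triangle)

definition sg_invariant :: "point set \<Rightarrow> bool" where
  "sg_invariant K \<longleftrightarrow> compact K \<and> K \<noteq> {} \<and> K = (\<Union>i\<in>{1,2,3}. sg_map i ` K)"

lemma sg_invariant_tri: "sg_invariant (\<Inter>n. tri_approx n)"
proof -
  let ?K = "\<Inter>n. tri_approx n"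
  have "closed ?K" using compact_tri_approx compact_imp_closed by blast
  then have "compact (?K \<inter> tri_approx 0)" by (rule closed_Int_compact[OF _ compact_tri_approx])
  moreover have "?K \<inter> tri_approx 0 = ?K" by blast
  ultimately have "compact ?K" by (simp only:)
  moreover have "corner 1 \<in> tri_approx n" for n
  proof (induction n)
    case 0
    then show ?case by (simp add: corner_triangle)
  next
    case (Suc n)
    then have "sg_map 1 (corner 1) \<in> tri_approx (Suc n)" by (simp only: tri_approx.simps(2)) blast
    then show ?case by (simp only: sg_map_fixed)
  qed
  then have "?K \<noteq> {}" by blast
  moreover have "(\<Union>i\<in>{1,2,3}. sg_map i ` ?K) \<subseteq> ?K"
  proof -
    have "sg_map i x \<in> tri_approx n" if "i \<in> {1,2,3}" "x \<in> ?K" for i x n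
    proof -
      have "sg_map i x \<in> tri_approx (Suc n)" using that by (simp only: tri_approx.simps(2)) blast
      then show ?thesis using tri_approx_Suc_subset by blast
    qed
    then show ?thesis by blast
  qed
  moreover have "?K \<subseteq> (\<Union>i\<in>{1,2,3}. sg_map i ` ?K)"
  proof
    fix x assume x: "x \<in> ?K"
    \<comment> \<open>The index must not depend on \<open>n\<close>: if every index failed at some
      level, all three would fail at the largest of these levels, because the approximations
      decrease.\<close>
    have "\<exists>i\<in>{1,2,3}. \<forall>n. x \<in> sg_map i ` tri_approx n"
    proof (rule ccontr)
      assume "\<not> ?thesis"
      then obtain N where N: "\<And>i. i \<in> {1,2,3} \<Longrightarrow> x \<notin> sg_map i ` tri_approx (N i)" by metis
      define n where "n = Max (N ` {1,2,3})"
      have "x \<in> tri_approx (Suc n)" using x by blast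
      then obtain i where i: "i \<in> {1,2,3}" "x \<in> sg_map i ` tri_approx n" 
        by (simp only: tri_approx.simps(2)) blast
      have "N i \<le> n" unfolding n_def using i(1) by (intro Max_ge) auto
      then show False using N[OF i(1)] i(2) tri_approx_antimono by blast
    qed
    then obtain i where i: "i \<in> {1,2,3}" "\<And>n. x \<in> sg_map i ` tri_approx n" by blast
    have "sg_inv i x \<in> tri_approx n" for n using i(2)[of n] by auto
    then have "x \<in> sg_map i ` ?K" by (intro image_eqI[of _ _ "sg_inv i x"]) auto
    then show "x \<in> (\<Union>i\<in>{1,2,3}. sg_map i ` ?K)" using i(1) by blast
  qed
  ultimately show ?thesis unfolding sg_invariant_def by blast
qed

text \<open>A point of \<open>K\<close> is the image of a point of \<open>K\<close> under
  \<open>n\<close> maps, and the same maps bring a point of \<open>L\<close> within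
  \<open>D / 2 ^ n\<close> of it; closedness of \<open>L\<close> finishes. Used in both directions,
  this makes the attractor unique.\<close>

lemma sg_invariant_subset:
  assumes K: "sg_invariant K" and L: "sg_invariant L"
  shows "K \<subseteq> L"
proof -
  note KL = K[unfolded sg_invariant_def] L[unfolded sg_invariant_def]
  have cL: "closed L" "L \<noteq> {}"
    by (rule compact_imp_closed[OF KL(2)[THEN conjunct1]], rule KL(2)[THEN conjunct2, THEN conjunct1])
  have bK: "bounded K" "bounded L"
    by (rule compact_imp_bounded[OF KL(1)[THEN conjunct1]], rule compact_imp_bounded[OF KL(2)[THEN conjunct1]])
  obtain D where D: "\<And>x y. x \<in> K \<union> L \<Longrightarrow> y \<in> K \<union> L \<Longrightarrow> dist x y \<le> D"
    using iffD1[OF bounded_two_points, of "K \<union> L"] iffD2[OF bounded_Un conjI[OF bK]] by blast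
  have near: "\<exists>y\<in>L. dist x y \<le> D / 2 ^ n" if "x \<in> K" for x n
    using that
  proof (induction n arbitrary: x)
    case 0
    then show ?case using D cL(2) by auto
  next
    case (Suc n)
    obtain i z where i: "i \<in> {1,2,3}" "z \<in> K" "x = sg_map i z" 
      using subsetD[OF equalityD1[OF K[unfolded sg_invariant_def, THEN conjunct2, THEN conjunct2]] Suc.prems]
      by blast
    obtain y where y: "y \<in> L" "dist z y \<le> D / 2 ^ n" using Suc.IH[OF i(2)] by blast
    have "sg_map i y \<in> L"
      by (rule subsetD[OF equalityD2[OF L[unfolded sg_invariant_def, THEN conjunct2, THEN conjunct2]]])
        (use i(1) y(1) in blast)
    moreover have "dist x (sg_map i y) \<le> D / 2 ^ Suc n"
      using y(2) by (simp add: i(3) dist_sg_map)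
    ultimately show ?case by blast
  qed
  show ?thesis
  proof
    fix x assume x: "x \<in> K"
    have "\<exists>y\<in>L. dist y x < e" if "e > 0" for e
    proof -
      have "(\<lambda>n. D * (1/2) ^ n) \<longlonglongrightarrow> D * 0" by (intro tendsto_intros) auto
      then have "eventually (\<lambda>n. D * (1/2) ^ n < e) sequentially"
        using that by (intro order_tendstoD(2)) auto
      then obtain n where "D * (1/2)^n < e" unfolding eventually_sequentially by blast
      then show ?thesis using near[OF x, of n] by (force simp: power_one_over dist_commute)
    qed
    then show "x \<in> L" using cL(1) closed_approachable by blast
  qed
qed

lemma sg_invariant_SG: "sg_invariant SG"
proof -
  have "\<exists>!K. sg_invariant K"
    using sg_invariant_tri sg_invariant_subset by (metis subset_antisym)
  then have "sg_invariant (THE K. sg_invariant K)" by (rule theI')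
  then show ?thesis unfolding SG_def sg_invariant_def .
qed

lemma compact_SG: "compact SG" and SG_nonempty: "SG \<noteq> {}"
  and SG_union: "SG = (\<Union>i\<in>{1,2,3}. sg_map i ` SG)"
proof -
  note * = sg_invariant_SG[unfolded sg_invariant_def]
  show "compact SG" by (rule *[THEN conjunct1])
  show "SG \<noteq> {}" by (rule *[THEN conjunct2, THEN conjunct1])
  show "SG = (\<Union>i\<in>{1,2,3}. sg_map i ` SG)" by (rule *[THEN conjunct2, THEN conjunct2])
qed

lemma SG_subset_triangle: "SG \<subseteq> triangle"
proof -
  have "SG \<subseteq> tri_approx 0" using sg_invariant_subset[OF sg_invariant_SG sg_invariant_tri] by blast
  then show ?thesis by simp
qed

lemma sg_map_SG: "i \<in> {1,2,3} \<Longrightarrow> x \<in> SG \<Longrightarrow> sg_map i x \<in> SG"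
  by (rule subsetD[OF equalityD2[OF SG_union]]) blast

lemma SG_cases:
  assumes "x \<in> SG" obtains i y where "i \<in> {1,2,3}" "y \<in> SG" "x = sg_map i y"
  using subsetD[OF equalityD1[OF SG_union] assms] by blast

text \<open>The iterates of any point of SG under \<open>sg_map i\<close> converge to the fixed
  point of this map.\<close>

lemma corner_SG: assumes i: "i \<in> {1,2,3}" shows "corner i \<in> SG"
proof -
  obtain z where z: "z \<in> SG" using SG_nonempty by blast
  define y where "y n = (sg_map i ^^ n) z" for n
  have y: "y n \<in> SG" for n by (induction n) (auto simp: y_def z intro!: sg_map_SG[OF i])
  have d: "dist (y n) (corner i) = dist z (corner i) * (1/2) ^ n" for n
  proof (induction n)
    case (Suc n)
    have "dist (y (Suc n)) (corner i) = dist (sg_map i (y n)) (sg_map i (corner i))" by (simp add: y_def)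
    then show ?case using Suc by (simp only: dist_sg_map) simp
  qed (simp add: y_def)
  have "(\<lambda>n. dist z (corner i) * (1/2) ^ n) \<longlonglongrightarrow> dist z (corner i) * 0" by (intro tendsto_intros) auto
  then have "y \<longlonglongrightarrow> corner i" by (simp only: tendsto_dist_iff[of y] d) simp
  then show ?thesis using closed_sequentially[OF compact_imp_closed[OF compact_SG]] y by blast
qed

lemma SG_inter:
  assumes "i \<in> {1,2,3}" "k \<in> {1,2,3}" "i \<noteq> k" "x \<in> SG" "y \<in> SG" "sg_map i x = sg_map k y"
  shows "x = corner k" "y = corner i"
  using triangle_inter[OF assms(1-3) _ _ assms(6)] assms(4,5) SG_subset_triangle by blast+

lemma sg_map_eq_corner:
  assumes "i \<in> {1,2,3}" "k \<in> {1,2,3}" "x \<in> SG" "sg_map i x = corner k"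
  shows "i = k" "x = corner k"
proof -
  show "i = k"
  proof (rule ccontr)
    assume "i \<noteq> k"
    have "sg_map i x = sg_map k (corner k)" using assms(4) by (simp only: sg_map_fixed)
    then have "corner k = corner i"
      by (rule SG_inter(2)[OF assms(1,2) \<open>i \<noteq> k\<close> assms(3) corner_SG[OF assms(2)]])
    then show False using corner_eq_iff[OF assms(2,1)] \<open>i \<noteq> k\<close> by (simp only:)
  qed
  then have "sg_map i x = sg_map i (corner i)" using assms(4) by (simp only: sg_map_fixed)
  then show "x = corner k" unfolding sg_map_eq_iff using \<open>i = k\<close> by (simp only:)
qed

section \<open>Words, cells and their diameters\<close>

lemma word_map_Nil [simp]: "word_map [] = id" by (simp add: word_map_def)
lemma word_map_Cons [simp]: "word_map (i # w) = sg_map i \<circ> word_map w" by (simp add: word_map_def)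
lemma word_map_append: "word_map (v @ w) = word_map v \<circ> word_map w"
  by (induction v) (auto simp: comp_assoc)

lemma words_0 [simp]: "words 0 = {[]}" by (auto simp: words_def)
lemma words_Suc: "words (Suc m) = (\<Union>i\<in>{1,2,3}. (#) i ` words m)"
proof -
  have "w \<in> words (Suc m) \<longleftrightarrow> (\<exists>i\<in>{1,2,3}. \<exists>v\<in>words m. w = i # v)" for w
    by (cases w) (auto simp: words_def)
  then show ?thesis by auto
qed
lemma finite_words: "finite (words m)" by (induction m) (simp_all add: words_Suc)
lemma card_words: "card (words m) = 3 ^ m"
proof (induction m)
  case (Suc m)
  have "card (words (Suc m)) = (\<Sum>i\<in>{1,2,3::nat}. card ((#) i ` words m))"
    unfolding words_Suc by (rule card_UN_disjoint) (auto simp: finite_words)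
  then show ?case using Suc by (simp add: card_image)
qed simp
lemma words_appendI: "v \<in> words m \<Longrightarrow> w \<in> words n \<Longrightarrow> v @ w \<in> words (m + n)"
  by (auto simp: words_def)
lemma words_length: "w \<in> words m \<Longrightarrow> length w = m" by (simp add: words_def)

lemma cell_Nil [simp]: "cell [] = SG" by (simp add: cell_def)
lemma cell_Cons: "cell (i # w) = sg_map i ` cell w" by (simp add: cell_def image_comp)

lemma cell_subset_SG: "w \<in> words m \<Longrightarrow> cell w \<subseteq> SG"
proof (induction m arbitrary: w)
  case (Suc m)
  then obtain i v where w: "i \<in> {1,2,3}" "v \<in> words m" "w = i # v" by (auto simp: words_Suc)
  show ?case using Suc.IH[OF w(2)] sg_map_SG[OF w(1)] unfolding w(3) cell_Cons by blast
qed simp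

lemma word_map_SG: "w \<in> words m \<Longrightarrow> x \<in> SG \<Longrightarrow> word_map w x \<in> SG"
  using cell_subset_SG unfolding cell_def by blast

lemma inj_word_map: "inj (word_map w)"
  by (induction w) (auto intro: inj_compose inj_sg_map simp del: o_apply)

lemma continuous_on_word_map: "continuous_on S (word_map w)"
proof (induction w)
  case (Cons i w)
  then show ?case unfolding word_map_Cons
    by (intro continuous_on_compose continuous_on_sg_map) auto
qed (simp add: id_def)

lemma compact_cell: "compact (cell w)"
  unfolding cell_def by (intro compact_continuous_image continuous_on_word_map compact_SG)

lemma dist_word_map: "dist (word_map w x) (word_map w y) = dist x y / 2 ^ length w"
  by (induction w) (auto simp: dist_sg_map)

lemma SG_cells: "SG = (\<Union>w\<in>words m. cell w)"
proof (induction m)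
  case (Suc m)
  have "SG = (\<Union>i\<in>{1,2,3}. sg_map i ` (\<Union>w\<in>words m. cell w))"
    unfolding Suc[symmetric] by (rule SG_union)
  also have "\<dots> = (\<Union>w\<in>words (Suc m). cell w)" by (simp add: words_Suc cell_Cons image_UN)
  finally show ?case .
qed simp

lemma cell_diam: "\<exists>D>0. \<forall>w. \<forall>x\<in>cell w. \<forall>y\<in>cell w. dist x y \<le> D / 2 ^ length w"
proof -
  obtain D where D: "\<And>x y. x \<in> SG \<Longrightarrow> y \<in> SG \<Longrightarrow> dist x y \<le> D"
    using iffD1[OF bounded_two_points compact_imp_bounded[OF compact_SG]] by blast
  show ?thesis
  proof (intro exI[of _ "max D 1"] conjI allI ballI)
    fix w x y assume "x \<in> cell w" "y \<in> cell w"
    then obtain a b where "a \<in> SG" "b \<in> SG" "x = word_map w a" "y = word_map w b" by (auto simp: cell_def)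
    then show "dist x y \<le> max D 1 / 2 ^ length w" 
      using D[of a b] by (auto simp: dist_word_map intro!: divide_right_mono)
  qed simp
qed

section \<open>Vertex sets and their density\<close>

lemma V_subset_SG: "V m \<subseteq> SG"
proof (induction m)
  case 0
  then show ?case using corner_SG unfolding V_0 by blast
next
  case (Suc m)
  show ?case
  proof
    fix x assume "x \<in> V (Suc m)"
    then obtain i y where "i \<in> {1,2,3}" "y \<in> V m" "x = sg_map i y" unfolding V.simps by blast
    then show "x \<in> SG" using sg_map_SG Suc by (simp only:) blast
  qed
qed

lemma V_mono_Suc: "V m \<subseteq> V (Suc m)"
proof (induction m)
  case 0
  have "sg_map i (corner i) \<in> V (Suc 0)" if "i \<in> {1,2,3}" for i
    using that corner_in_V0 unfolding V.simps(2) by blast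
  then have "corner i \<in> V (Suc 0)" if "i \<in> {1,2,3}" for i
    using that by (simp only: sg_map_fixed)
  then show ?case unfolding V_0 by blast
next
  case (Suc m)
  then show ?case unfolding V.simps(2)[of "Suc m"] V.simps(2)[of m] by (intro UN_mono image_mono order_refl)
qed

lemma V_mono: "m \<le> n \<Longrightarrow> V m \<subseteq> V n"
  by (rule lift_Suc_mono_le[of V, OF V_mono_Suc])

lemma finite_V: "finite (V m)" by (induction m) (auto simp: V.simps)

lemma V_words: "V m = (\<Union>w\<in>words m. word_map w ` V 0)"
proof (induction m)
  case (Suc m)
  have "V (Suc m) = (\<Union>i\<in>{1,2,3}. sg_map i ` (\<Union>w\<in>words m. word_map w ` V 0))"
    unfolding V.simps(2) Suc[symmetric] ..
  also have "\<dots> = (\<Union>w\<in>words (Suc m). word_map w ` V 0)"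
    by (simp add: words_Suc image_UN image_comp)
  finally show ?case .
qed simp

text \<open>If the vertex was produced by another cell \<open>k\<close>, it is a junction; its
  preimage \<open>x\<close> is then a corner and lies in every \<open>V m\<close>.\<close>

lemma V_Suc_inter:
  assumes i: "i \<in> {1,2,3}" and x: "x \<in> SG" and v: "sg_map i x \<in> V (Suc m)"
  shows "x \<in> V m"
proof -
  obtain k y where k: "k \<in> {1,2,3}" "y \<in> V m" "sg_map i x = sg_map k y" using v unfolding V.simps(2) by blast
  show ?thesis
  proof (cases "i = k")
    case True
    then show ?thesis using k by simp
  next
    case False
    have y: "y \<in> SG" by (rule subsetD[OF V_subset_SG k(2)])
    have xk: "x = corner k"
      by (rule SG_inter(1)[OF i k(1) False x y k(3)])
    have "V 0 \<subseteq> V m"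
      by (rule V_mono) simp
    moreover have "corner k \<in> V 0"
      by (rule corner_in_V0[OF k(1)])
    ultimately have "corner k \<in> V m"
      by (rule subsetD)
    then show ?thesis
      by (simp only: xk)
  qed
qed

text \<open>The point \<open>y m\<close> is the image of a corner under \<open>w\<close> followed by
  a word of length \<open>m - n\<close> whose cell contains the preimage of \<open>x\<close>, so it
  shares an \<open>m\<close>-cell with \<open>x\<close>.\<close>

lemma V_approx:
  assumes "w \<in> words n" "x \<in> cell w"
  obtains y where "\<And>m. m \<ge> n \<Longrightarrow> y m \<in> V m \<inter> cell w" "y \<longlonglongrightarrow> x"
proof -
  obtain D where "D > 0" and D: "\<And>w x y. x \<in> cell w \<Longrightarrow> y \<in> cell w \<Longrightarrow> dist x y \<le> D / 2 ^ length w"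
    using cell_diam by blast
  obtain z where z: "z \<in> SG" "x = word_map w z" using assms by (auto simp: cell_def)
  have "\<exists>v\<in>words k. z \<in> cell v" for k
    using subsetD[OF equalityD1[OF SG_cells[of k]] z(1)] by blast
  then obtain v where v: "\<And>k. v k \<in> words k" "\<And>k. z \<in> cell (v k)" by metis
  define y where "y m = word_map (w @ v (m - n)) (corner 1)" for m
  have ww: "w @ v (m - n) \<in> words m" if "m \<ge> n" for m
    using words_appendI[OF assms(1) v(1)[of "m - n"]] that by simp
  have 1: "y m \<in> V m \<inter> cell w" if "m \<ge> n" for m
  proof
    have c1: "corner 1 \<in> V 0" by (rule corner_in_V0) simp
    show "y m \<in> V m" unfolding V_words[of m] y_def by (rule UN_I[OF ww[OF that] imageI[OF c1]])
    have "word_map (v (m - n)) (corner 1) \<in> SG" by (rule word_map_SG[OF v(1) corner_SG]) simp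
    then show "y m \<in> cell w" unfolding y_def cell_def word_map_append o_apply by (rule imageI)
  qed
  have 2: "dist (y m) x \<le> D * (1/2) ^ m" if "m \<ge> n" for m
  proof -
    have "y m \<in> cell (w @ v (m - n))" unfolding y_def cell_def by (rule imageI[OF corner_SG]) simp
    moreover have "x \<in> cell (w @ v (m - n))" 
      using v(2)[of "m - n"] unfolding cell_def z word_map_append by auto
    ultimately have "dist (y m) x \<le> D / 2 ^ length (w @ v (m - n))" by (rule D)
    then show ?thesis using words_length[OF ww[OF that]] by (simp add: power_one_over)
  qed
  have "(\<lambda>n. D * (1/2) ^ n) \<longlonglongrightarrow> D * 0" by (intro tendsto_intros) auto
  then have "(\<lambda>m. D * (1/2) ^ m) \<longlonglongrightarrow> 0" by simp
  then have "(\<lambda>m. dist (y m) x) \<longlonglongrightarrow> 0"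
    by (rule Lim_null_comparison[rotated]) (use 2 in \<open>auto simp: eventually_sequentially\<close>)
  then have "y \<longlonglongrightarrow> x" using tendsto_dist_iff by blast
  then show ?thesis using that 1 by blast
qed

lemma V_dense_bound:
  assumes c: "continuous_on SG g" and w: "w \<in> words n" "x \<in> cell w"
    and b: "\<And>m y. m \<ge> n \<Longrightarrow> y \<in> V m \<Longrightarrow> y \<in> cell w \<Longrightarrow> g y \<le> (B::real)"
  shows "g x \<le> B"
proof -
  obtain y where y: "\<And>m. m \<ge> n \<Longrightarrow> y m \<in> V m \<inter> cell w" "y \<longlonglongrightarrow> x" using V_approx[OF w] by blast
  have "x \<in> SG" by (rule subsetD[OF cell_subset_SG[OF w(1)] w(2)])
  moreover have "\<forall>\<^sub>F m in sequentially. y m \<in> SG"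
    by (rule eventually_sequentiallyI[of n]) (use y(1) cell_subset_SG[OF w(1)] in blast)
  ultimately have "(\<lambda>m. g (y m)) \<longlonglongrightarrow> g x"
    using c y(2) continuous_on_tendsto_compose by blast
  then show ?thesis
    by (rule LIMSEQ_le_const2) (use b y(1) in blast)
qed

section \<open>Graph Laplacians\<close>

definition nbr_sum :: "nat \<Rightarrow> (point \<Rightarrow> real) \<Rightarrow> point \<Rightarrow> real" where
  "nbr_sum m u x = (\<Sum>y\<in>{y. adj m x y}. u y)"

text \<open>A corner has two neighbours in \<open>V m\<close>, so this is a one-sided graph
  Laplacian. For \<open>u\<close> in the domain of the Laplacian, \<open>(5/3) ^ m\<close> times it
  converges to minus the outward normal derivative.\<close>

definition corner_diff :: "nat \<Rightarrow> (point \<Rightarrow> real) \<Rightarrow> nat \<Rightarrow> real" where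
  "corner_diff m u i = nbr_sum m u (corner i) - 2 * u (corner i)"

lemma graph_laplacian_nbr_sum: "graph_laplacian m u x = nbr_sum m u x - 4 * u x"
  by (simp add: graph_laplacian_def nbr_sum_def)

lemma adj_V: "adj m x y \<Longrightarrow> x \<in> V m" "adj m x y \<Longrightarrow> y \<in> V m"
  by (simp_all add: adj_def)

lemma finite_adj: "finite {y. adj m x y}"
  by (rule finite_subset[OF _ finite_V[of m]]) (auto dest: adj_V)

lemma nbr_sum_cong: "(\<And>y. y \<in> V m \<Longrightarrow> u y = v y) \<Longrightarrow> nbr_sum m u x = nbr_sum m v x"
  unfolding nbr_sum_def by (rule sum.cong) (auto dest: adj_V)

lemma graph_laplacian_cong:
  "\<lbrakk>\<And>y. y \<in> V m \<Longrightarrow> u y = v y; x \<in> V m\<rbrakk> \<Longrightarrow> graph_laplacian m u x = graph_laplacian m v x"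
  unfolding graph_laplacian_nbr_sum using nbr_sum_cong[of m u v x] by simp

lemma corner_in_V: "i \<in> {1,2,3} \<Longrightarrow> corner i \<in> V m"
  using V_mono[OF le0[of m]] corner_in_V0[of i] by (rule subsetD)

lemma corner_diff_cong:
  "\<lbrakk>\<And>y. y \<in> V m \<Longrightarrow> u y = v y; i \<in> {1,2,3}\<rbrakk> \<Longrightarrow> corner_diff m u i = corner_diff m v i"
  unfolding corner_diff_def using nbr_sum_cong[of m u v "corner i"] corner_in_V[of i m] by simp

lemma third_index:
  assumes "i \<in> {1,2,3::nat}"
  obtains a b where "{i, a, b} = {1,2,3}" "i \<noteq> a" "i \<noteq> b" "a \<noteq> b"
proof -
  consider "i = 1" | "i = 2" | "i = 3" using assms by blast
  then show thesis
  proof cases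
    case 1 then show thesis by (intro that[of 2 3]) auto
  next
    case 2 then show thesis by (intro that[of 1 3]) auto
  next
    case 3 then show thesis by (intro that[of 1 2]) auto
  qed
qed

lemma third_index_of:
  assumes "i \<in> {1,2,3::nat}" "a \<in> {1,2,3}" "i \<noteq> a"
  obtains b where "{i, a, b} = {1,2,3}" "i \<noteq> b" "a \<noteq> b"
proof -
  obtain p q where pq: "{i, p, q} = {1,2,3}" "i \<noteq> p" "i \<noteq> q" "p \<noteq> q" 
    using third_index[OF assms(1)] by metis
  have "a \<in> {i, p, q}" using assms(2) unfolding pq(1) .
  then consider "a = p" | "a = q" using assms(3) by blast
  then show thesis
  proof cases
    case 1 then show thesis using pq that[of q] by simp
  next
    case 2 then show thesis using pq that[of p] by (simp add: insert_commute)
  qed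
qed

lemma index_sets:
  assumes "{i, a, b} = {1,2,3::nat}" "i \<noteq> a" "i \<noteq> b" "a \<noteq> b"
  shows "i \<in> {1,2,3}" "a \<in> {1,2,3}" "b \<in> {1,2,3}"
  unfolding assms(1)[symmetric] by simp_all

lemma adj_0_iff: "adj 0 x y \<longleftrightarrow> x \<in> V 0 \<and> y \<in> V 0 \<and> x \<noteq> y"
  using V_subset_SG[of 0] by (auto simp: adj_def)

lemma nbr_sum_0:
  assumes "{i, a, b} = {1,2,3::nat}" "i \<noteq> a" "i \<noteq> b" "a \<noteq> b"
  shows "nbr_sum 0 u (corner i) = u (corner a) + u (corner b)"
proof -
  note I = index_sets[OF assms]
  have V0: "V 0 = {corner i, corner a, corner b}" unfolding V_0 assms(1)[symmetric] by simp
  have ne: "corner i \<noteq> corner a" "corner i \<noteq> corner b" "corner a \<noteq> corner b"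
    using assms corner_eq_iff[OF I(1,2)] corner_eq_iff[OF I(1,3)] corner_eq_iff[OF I(2,3)] by simp_all
  have "{y. adj 0 (corner i) y} = {corner a, corner b}"
    unfolding adj_0_iff V0 using ne by auto
  then show ?thesis unfolding nbr_sum_def using ne by simp
qed

lemma adj_Suc_iff:
  "adj (Suc m) x z \<longleftrightarrow> (\<exists>i\<in>{1,2,3}. \<exists>y y'. x = sg_map i y \<and> z = sg_map i y' \<and> adj m y y')"
proof
  assume a: "adj (Suc m) x z"
  then obtain w where w: "w \<in> words (Suc m)" "x \<in> cell w" "z \<in> cell w" unfolding adj_def by blast
  then obtain i v where v: "i \<in> {1,2,3}" "v \<in> words m" "w = i # v" unfolding words_Suc by blast
  obtain y y' where y: "y \<in> cell v" "y' \<in> cell v" "x = sg_map i y" "z = sg_map i y'"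
    using w(2,3) unfolding v(3) cell_Cons by blast
  have s: "y \<in> SG" "y' \<in> SG" using y(1,2) subsetD[OF cell_subset_SG[OF v(2)]] by simp_all
  have V: "sg_map i y \<in> V (Suc m)" "sg_map i y' \<in> V (Suc m)" "sg_map i y \<noteq> sg_map i y'"
    using a unfolding adj_def y(3,4) by simp_all
  have "y \<in> V m" "y' \<in> V m" "y \<noteq> y'"
    using V_Suc_inter[OF v(1) s(1) V(1)] V_Suc_inter[OF v(1) s(2) V(2)] V(3) by auto
  then have "adj m y y'" unfolding adj_def using y(1,2) v(2) by blast
  then show "\<exists>i\<in>{1,2,3}. \<exists>y y'. x = sg_map i y \<and> z = sg_map i y' \<and> adj m y y'"
    using v(1) y(3,4) by blast
next
  assume "\<exists>i\<in>{1,2,3}. \<exists>y y'. x = sg_map i y \<and> z = sg_map i y' \<and> adj m y y'"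
  then obtain i y y' where i: "i \<in> {1,2,3}" and y: "x = sg_map i y" "z = sg_map i y'" and a: "adj m y y'"
    by blast
  obtain w where w: "w \<in> words m" "y \<in> cell w" "y' \<in> cell w" using a unfolding adj_def by blast
  have "i # w \<in> words (Suc m)" using i w(1) unfolding words_Suc by blast
  moreover have "x \<in> cell (i # w)" "z \<in> cell (i # w)" unfolding cell_Cons y using w(2,3) by blast+
  moreover have "x \<in> V (Suc m)" "z \<in> V (Suc m)" unfolding V.simps(2) y using i adj_V[OF a] by blast+
  moreover have "x \<noteq> z" using a unfolding y by (simp add: adj_def)
  ultimately show "adj (Suc m) x z" unfolding adj_def by blast
qed

text \<open>A corner other than \<open>corner i\<close> is excluded because its image is a junction,
  which has neighbours in a second cell.\<close>

lemma nbrs_map: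
  assumes i: "i \<in> {1,2,3}" and y: "y \<in> SG" "y \<notin> V 0 \<or> y = corner i"
  shows "{z. adj (Suc m) (sg_map i y) z} = sg_map i ` {z. adj m y z}"
proof -
  have "adj (Suc m) (sg_map i y) z \<longleftrightarrow> (\<exists>y'. z = sg_map i y' \<and> adj m y y')" for z
  proof
    assume "adj (Suc m) (sg_map i y) z"
    then obtain k p p' where k: "k \<in> {1,2,3}" "sg_map i y = sg_map k p" "z = sg_map k p'" "adj m p p'"
      unfolding adj_Suc_iff by blast
    have p: "p \<in> SG" using adj_V(1)[OF k(4)] by (rule subsetD[OF V_subset_SG])
    have "i = k"
    proof (rule ccontr)
      assume n: "i \<noteq> k"
      have "y = corner k" by (rule SG_inter(1)[OF i k(1) n y(1) p k(2)])
      then show False using y(2) corner_in_V0[OF k(1)] corner_eq_iff[OF k(1) i] n by simp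
    qed
    then have "p = y" using k(2) by simp
    then show "\<exists>y'. z = sg_map i y' \<and> adj m y y'" using k(3,4) \<open>i = k\<close> by blast
  next
    assume "\<exists>y'. z = sg_map i y' \<and> adj m y y'"
    then show "adj (Suc m) (sg_map i y) z" unfolding adj_Suc_iff using i by blast
  qed
  then show ?thesis by auto
qed

lemma nbr_sum_map:
  assumes i: "i \<in> {1,2,3}" and y: "y \<in> SG" "y \<notin> V 0 \<or> y = corner i"
  shows "nbr_sum (Suc m) u (sg_map i y) = nbr_sum m (u \<circ> sg_map i) y"
  unfolding nbr_sum_def nbrs_map[OF assms]
  by (subst sum.reindex) (auto intro: inj_on_subset[OF inj_sg_map])

lemma nbrs_junction:
  assumes i: "i \<in> {1,2,3}" and k: "k \<in> {1,2,3}" and n: "i \<noteq> k"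
  shows "{z. adj (Suc m) (sg_map i (corner k)) z}
    = sg_map i ` {z. adj m (corner k) z} \<union> sg_map k ` {z. adj m (corner i) z}"
proof -
  have "adj (Suc m) (sg_map i (corner k)) z \<longleftrightarrow>
    (\<exists>y'. z = sg_map i y' \<and> adj m (corner k) y') \<or> (\<exists>y'. z = sg_map k y' \<and> adj m (corner i) y')" for z
  proof
    assume "adj (Suc m) (sg_map i (corner k)) z"
    then obtain l p p' where l: "l \<in> {1,2,3}" "sg_map i (corner k) = sg_map l p" "z = sg_map l p'" "adj m p p'"
      unfolding adj_Suc_iff by blast
    have p: "p \<in> SG" using adj_V(1)[OF l(4)] by (rule subsetD[OF V_subset_SG])
    show "(\<exists>y'. z = sg_map i y' \<and> adj m (corner k) y') \<or> (\<exists>y'. z = sg_map k y' \<and> adj m (corner i) y')"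
    proof (cases "i = l")
      case True
      then have "p = corner k" using l(2) by simp
      then show ?thesis using l(3,4) True by blast
    next
      case False
      have "corner k = corner l" by (rule SG_inter(1)[OF i l(1) False corner_SG[OF k] p l(2)])
      then have kl: "k = l" using corner_eq_iff[OF k l(1)] by simp
      have "p = corner i" by (rule SG_inter(2)[OF i l(1) False corner_SG[OF k] p l(2)])
      then show ?thesis using l(3,4) kl by blast
    qed
  next
    assume "(\<exists>y'. z = sg_map i y' \<and> adj m (corner k) y') \<or> (\<exists>y'. z = sg_map k y' \<and> adj m (corner i) y')"
    then show "adj (Suc m) (sg_map i (corner k)) z"
    proof
      assume "\<exists>y'. z = sg_map i y' \<and> adj m (corner k) y'"
      then show ?thesis unfolding adj_Suc_iff using i by blast
    next
      assume "\<exists>y'. z = sg_map k y' \<and> adj m (corner i) y'"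
      then show ?thesis unfolding adj_Suc_iff sg_map_commute[of i k] using k by blast
    qed
  qed
  then show ?thesis by auto
qed

lemma nbr_sum_junction:
  assumes i: "i \<in> {1,2,3}" and k: "k \<in> {1,2,3}" and n: "i \<noteq> k"
  shows "nbr_sum (Suc m) u (sg_map i (corner k))
    = nbr_sum m (u \<circ> sg_map i) (corner k) + nbr_sum m (u \<circ> sg_map k) (corner i)"
proof -
  \<comment> \<open>The two cells share only the junction itself, which is not its own
    neighbour.\<close>
  have "sg_map i ` {z. adj m (corner k) z} \<inter> sg_map k ` {z. adj m (corner i) z} = {}"
  proof (rule ccontr)
    assume "\<not> ?thesis"
    then obtain y y' where a: "adj m (corner k) y" "adj m (corner i) y'" "sg_map i y = sg_map k y'" by blast
    have s: "y \<in> SG" "y' \<in> SG" using adj_V(2)[OF a(1)] adj_V(2)[OF a(2)] by (auto intro: subsetD[OF V_subset_SG])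
    have "y = corner k" by (rule SG_inter(1)[OF i k n s a(3)])
    then show False using a(1) by (simp add: adj_def)
  qed
  then have "nbr_sum (Suc m) u (sg_map i (corner k)) =
    sum u (sg_map i ` {z. adj m (corner k) z}) + sum u (sg_map k ` {z. adj m (corner i) z})"
    unfolding nbr_sum_def nbrs_junction[OF assms]
    by (intro sum.union_disjoint finite_imageI finite_adj)
  also have "sum u (sg_map i ` {z. adj m (corner k) z}) = nbr_sum m (u \<circ> sg_map i) (corner k)"
    unfolding nbr_sum_def by (subst sum.reindex) (auto intro: inj_on_subset[OF inj_sg_map])
  also have "sum u (sg_map k ` {z. adj m (corner i) z}) = nbr_sum m (u \<circ> sg_map k) (corner i)"
    unfolding nbr_sum_def by (subst sum.reindex) (auto intro: inj_on_subset[OF inj_sg_map])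
  finally show ?thesis .
qed

lemma nbr_sum_corner_Suc:
  assumes i: "i \<in> {1,2,3}"
  shows "nbr_sum (Suc m) u (corner i) = nbr_sum m (u \<circ> sg_map i) (corner i)"
  using nbr_sum_map[OF i corner_SG[OF i], of m u] by (simp only: sg_map_fixed simp_thms)

lemma corner_diff_Suc:
  assumes i: "i \<in> {1,2,3}"
  shows "corner_diff (Suc m) u i = corner_diff m (u \<circ> sg_map i) i"
  unfolding corner_diff_def nbr_sum_corner_Suc[OF i] by simp

lemma interior_map:
  assumes i: "i \<in> {1,2,3}" and y: "y \<in> V m - V 0"
  shows "sg_map i y \<in> V (Suc m) - V 0"
proof
  show "sg_map i y \<in> V (Suc m)" unfolding V.simps(2) using i y by blast
  have s: "y \<in> SG" using y by (auto intro: subsetD[OF V_subset_SG])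
  show "sg_map i y \<notin> V 0"
  proof
    assume "sg_map i y \<in> V 0"
    then obtain k where k: "k \<in> {1,2,3}" "sg_map i y = corner k" unfolding V_0 by blast
    have "y = corner k" by (rule sg_map_eq_corner(2)[OF i k(1) s k(2)])
    then show False using y corner_in_V0[OF k(1)] by simp
  qed
qed

lemma junction_interior:
  assumes i: "i \<in> {1,2,3}" and k: "k \<in> {1,2,3}" and n: "i \<noteq> k"
  shows "sg_map i (corner k) \<in> V (Suc m) - V 0"
proof
  show "sg_map i (corner k) \<in> V (Suc m)" unfolding V.simps(2) using i corner_in_V[OF k, of m] by blast
  show "sg_map i (corner k) \<notin> V 0"
  proof
    assume "sg_map i (corner k) \<in> V 0"
    then obtain l where l: "l \<in> {1,2,3}" "sg_map i (corner k) = corner l" unfolding V_0 by blast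
    have "i = l" by (rule sg_map_eq_corner(1)[OF i l(1) corner_SG[OF k] l(2)])
    moreover have "corner k = corner l" by (rule sg_map_eq_corner(2)[OF i l(1) corner_SG[OF k] l(2)])
    ultimately show False using n corner_eq_iff[OF k l(1)] by simp
  qed
qed

text \<open>The case distinction behind all inductions on the level: inside a cell the level drops
  by one, at a junction two one-sided sums remain.\<close>

lemma interior_cases:
  assumes x: "x \<in> V (Suc m) - V 0"
  obtains (map) i y where "i \<in> {1,2,3}" "y \<in> V m - V 0" "x = sg_map i y"
  | (junction) i k where "i \<in> {1,2,3}" "k \<in> {1,2,3}" "i \<noteq> k" "x = sg_map i (corner k)"
proof -
  obtain i y where i: "i \<in> {1,2,3}" "y \<in> V m" "x = sg_map i y" using x unfolding V.simps(2) by blast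
  show thesis
  proof (cases "y \<in> V 0")
    case True
    then obtain k where k: "k \<in> {1,2,3}" "y = corner k" unfolding V_0 by blast
    have "i \<noteq> k"
    proof
      assume "i = k"
      then have "x = corner k" using i(3) k(2) by simp
      then show False using x corner_in_V0[OF k(1)] by simp
    qed
    then show thesis using junction[OF i(1) k(1)] i(3) k(2) by simp
  next
    case False
    then show thesis using map[OF i(1) _ i(3)] i(2) by simp
  qed
qed

lemma laplacian_map:
  assumes i: "i \<in> {1,2,3}" and y: "y \<in> V m - V 0"
  shows "graph_laplacian (Suc m) u (sg_map i y) = graph_laplacian m (u \<circ> sg_map i) y"
proof -
  have "y \<in> SG" using y by (auto intro: subsetD[OF V_subset_SG])
  then show ?thesis unfolding graph_laplacian_nbr_sum using nbr_sum_map[OF i, of y m u] y by simp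
qed

text \<open>Each of the two cells contributes two of the four neighbours. This is the discrete form
  of the condition that the normal derivatives of two pieces cancel at a junction.\<close>

lemma laplacian_junction:
  assumes "i \<in> {1,2,3}" "k \<in> {1,2,3}" "i \<noteq> k"
  shows "graph_laplacian (Suc m) u (sg_map i (corner k))
    = corner_diff m (u \<circ> sg_map i) k + corner_diff m (u \<circ> sg_map k) i"
  unfolding graph_laplacian_nbr_sum nbr_sum_junction[OF assms] corner_diff_def
  using sg_map_commute[of i k] by simp

section \<open>Comparison of consecutive levels\<close>

lemma laplacian_1:
  assumes s: "{i, a, b} = {1,2,3::nat}" "i \<noteq> a" "i \<noteq> b" "a \<noteq> b"
  shows "graph_laplacian (Suc 0) u (sg_map i (corner a)) = u (corner i) + u (corner a)
    + u (sg_map i (corner b)) + u (sg_map a (corner b)) - 4 * u (sg_map i (corner a))"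
proof -
  note I = index_sets[OF s]
  have s1: "{a, i, b} = {1,2,3}" "{i, a, b} = {1,2,3}" using s(1) by auto
  show ?thesis
    unfolding laplacian_junction[OF I(1,2) s(2)] corner_diff_def
      nbr_sum_0[OF s1(1) s(2)[symmetric] s(4,3)] nbr_sum_0[OF s]
    using sg_map_commute[of i a] by simp
qed

text \<open>The one-sided difference at a corner renormalises by \<open>3/5\<close> up to values of the
  Laplacian at the three new vertices of the smallest cell at that corner.\<close>

lemma corner_diff_step:
  assumes i: "i \<in> {1,2,3}"
  shows "\<exists>x y z. {x, y, z} \<subseteq> (V (Suc m) - V 0) \<inter> cell (replicate m i) \<and>
    corner_diff m u i = 5/3 * corner_diff (Suc m) u i
      + 2/3 * (graph_laplacian (Suc m) u x + graph_laplacian (Suc m) u y + graph_laplacian (Suc m) u z / 2)"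
proof (induction m arbitrary: u)
  case 0
  obtain a b where s: "{i, a, b} = {1,2,3}" "i \<noteq> a" "i \<noteq> b" "a \<noteq> b" using third_index[OF i] by metis
  have s2: "{i, b, a} = {1,2,3}" "{a, b, i} = {1,2,3}" using s(1) by auto
  note I = index_sets[OF s]
  have in_SG: "x \<in> SG" if "x \<in> V (Suc 0) - V 0" for x using that by (auto intro: subsetD[OF V_subset_SG])
  note J = junction_interior[OF I(1,2) s(2), of 0] junction_interior[OF I(1,3) s(3), of 0] 
    junction_interior[OF I(2,3) s(4), of 0]
  show ?case
  proof (intro exI conjI)
    show "{sg_map i (corner a), sg_map i (corner b), sg_map a (corner b)} \<subseteq> (V (Suc 0) - V 0) \<inter> cell (replicate 0 i)"
      using J in_SG by auto
    show "corner_diff 0 u i = 5/3 * corner_diff (Suc 0) u i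
      + 2/3 * (graph_laplacian (Suc 0) u (sg_map i (corner a)) + graph_laplacian (Suc 0) u (sg_map i (corner b))
      + graph_laplacian (Suc 0) u (sg_map a (corner b)) / 2)"
      unfolding laplacian_1[OF s] laplacian_1[OF s2(1) s(3,2) s(4)[symmetric]]
        laplacian_1[OF s2(2) s(4) s(2)[symmetric] s(3)[symmetric]]
        corner_diff_def nbr_sum_corner_Suc[OF i] nbr_sum_0[OF s] sg_map_commute[of b i] sg_map_commute[of b a]
        sg_map_commute[of a i] o_apply sg_map_fixed
      by (simp add: field_simps)
  qed
next
  case (Suc m)
  obtain x y z where xyz: "{x, y, z} \<subseteq> (V (Suc m) - V 0) \<inter> cell (replicate m i)"
    and e: "corner_diff m (u \<circ> sg_map i) i = 5/3 * corner_diff (Suc m) (u \<circ> sg_map i) i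
      + 2/3 * (graph_laplacian (Suc m) (u \<circ> sg_map i) x + graph_laplacian (Suc m) (u \<circ> sg_map i) y
        + graph_laplacian (Suc m) (u \<circ> sg_map i) z / 2)"
    using Suc.IH by blast
  have x: "x \<in> V (Suc m) - V 0" "y \<in> V (Suc m) - V 0" "z \<in> V (Suc m) - V 0"
    and c: "x \<in> cell (replicate m i)" "y \<in> cell (replicate m i)" "z \<in> cell (replicate m i)" using xyz by auto
  show ?case
  proof (intro exI conjI)
    have "{sg_map i x, sg_map i y, sg_map i z} \<subseteq> sg_map i ` cell (replicate m i)" using c by blast
    then show "{sg_map i x, sg_map i y, sg_map i z} \<subseteq> (V (Suc (Suc m)) - V 0) \<inter> cell (replicate (Suc m) i)"
      using interior_map[OF i x(1)] interior_map[OF i x(2)] interior_map[OF i x(3)]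
      by (simp add: cell_Cons)
    show "corner_diff (Suc m) u i = 5/3 * corner_diff (Suc (Suc m)) u i
      + 2/3 * (graph_laplacian (Suc (Suc m)) u (sg_map i x) + graph_laplacian (Suc (Suc m)) u (sg_map i y)
        + graph_laplacian (Suc (Suc m)) u (sg_map i z) / 2)"
      unfolding laplacian_map[OF i x(1)] laplacian_map[OF i x(2)] laplacian_map[OF i x(3)]
        corner_diff_Suc[OF i, of m u] corner_diff_Suc[OF i, of "Suc m" u] by (rule e)
  qed
qed

text \<open>The weights in \<open>corner_diff_step\<close> add up to
  \<open>2/3 * (1 + 1 + 1/2) = 5/3\<close>.\<close>

lemma corner_diff_step_bound:
  assumes i: "i \<in> {1,2,3}"
    and c: "\<And>x. x \<in> V (Suc m) - V 0 \<Longrightarrow> x \<in> cell (replicate m i) \<Longrightarrow> \<bar>graph_laplacian (Suc m) u x\<bar> \<le> c"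
  shows "\<bar>corner_diff m u i - 5/3 * corner_diff (Suc m) u i\<bar> \<le> 5/3 * c"
proof -
  obtain x y z where xyz: "{x, y, z} \<subseteq> (V (Suc m) - V 0) \<inter> cell (replicate m i)"
    and e: "corner_diff m u i = 5/3 * corner_diff (Suc m) u i
      + 2/3 * (graph_laplacian (Suc m) u x + graph_laplacian (Suc m) u y + graph_laplacian (Suc m) u z / 2)"
    using corner_diff_step[OF i] by blast
  have "\<bar>graph_laplacian (Suc m) u x\<bar> \<le> c" "\<bar>graph_laplacian (Suc m) u y\<bar> \<le> c" "\<bar>graph_laplacian (Suc m) u z\<bar> \<le> c"
    using c xyz by auto
  then show ?thesis unfolding e abs_le_iff by (simp add: field_simps)
qed

text \<open>At a junction each of the two one-sided differences is renormalised with an error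
  \<open>5/3 * c\<close>, and their renormalised sum is at most \<open>5/3 * c\<close> itself; this
  makes the factor 5. The lemma carries bounds from fine levels, where the definition of the
  Laplacian gives them, to coarse ones.\<close>

lemma laplacian_mono:
  assumes "x \<in> V n - V 0" "\<And>y. y \<in> V (Suc n) - V 0 \<Longrightarrow> \<bar>graph_laplacian (Suc n) u y\<bar> \<le> c"
  shows "\<bar>graph_laplacian n u x\<bar> \<le> 5 * c"
  using assms
proof (induction n arbitrary: x u)
  case (Suc n)
  show ?case using Suc.prems(1)
  proof (cases rule: interior_cases)
    case (map i y)
    have "\<bar>graph_laplacian (Suc n) (u \<circ> sg_map i) z\<bar> \<le> c" if z: "z \<in> V (Suc n) - V 0" for z
      using Suc.prems(2)[OF interior_map[OF map(1) z]] unfolding laplacian_map[OF map(1) z] .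
    then show ?thesis unfolding map(3) laplacian_map[OF map(1,2)] by (rule Suc.IH[OF map(2)])
  next
    case (junction i k)
    have "\<bar>graph_laplacian (Suc n) (u \<circ> sg_map l) z\<bar> \<le> c"
      if l: "l \<in> {1,2,3}" and z: "z \<in> V (Suc n) - V 0" for l z
      using Suc.prems(2)[OF interior_map[OF l z]] unfolding laplacian_map[OF l z] .
    then have b: "\<bar>corner_diff n (u \<circ> sg_map l) p - 5/3 * corner_diff (Suc n) (u \<circ> sg_map l) p\<bar> \<le> 5/3 * c"
      if l: "l \<in> {1,2,3}" and p: "p \<in> {1,2,3}" for l p
      by (intro corner_diff_step_bound[OF p]) (use l in auto)
    have "\<bar>graph_laplacian (Suc (Suc n)) u x\<bar> \<le> c"
      unfolding junction(4) by (rule Suc.prems(2)[OF junction_interior[OF junction(1-3)]])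
    then have c: "\<bar>corner_diff (Suc n) (u \<circ> sg_map i) k + corner_diff (Suc n) (u \<circ> sg_map k) i\<bar> \<le> c"
      unfolding junction(4) laplacian_junction[OF junction(1-3)] .
    show ?thesis unfolding junction(4) laplacian_junction[OF junction(1-3)]
      using b[OF junction(1,2)] b[OF junction(2,1)] c by argo
  qed
qed simp

text \<open>Solving the three midpoint equations of a cell gives each new value as an average of the
  corner values with weights 2/5, 2/5, 1/5, minus the graph Laplacians with weights 3/10, 1/10,
  1/10. The latter add up to 1/2.\<close>

lemma V_step_bound:
  assumes "x \<in> V (Suc n)" "\<And>y. y \<in> V n \<Longrightarrow> \<bar>u y\<bar> \<le> B"
    "\<And>y. y \<in> V (Suc n) - V 0 \<Longrightarrow> \<bar>graph_laplacian (Suc n) u y\<bar> \<le> c"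
  shows "\<bar>u x\<bar> \<le> B + c / 2"
  using assms
proof (induction n arbitrary: x u)
  case 0
  have c0: "c \<ge> 0"
    using 0(3)[OF junction_interior[of 1 2 0]] by simp
  show ?case
  proof (cases "x \<in> V 0")
    case True
    then show ?thesis using 0(2)[of x] c0 by simp
  next
    case False
    then have "x \<in> V (Suc 0) - V 0" using 0(1) by simp
    then show ?thesis
    proof (cases rule: interior_cases)
      case (map i y)
      then show ?thesis by simp
    next
      case (junction i a)
      obtain b where s: "{i, a, b} = {1,2,3}" "i \<noteq> b" "a \<noteq> b" 
        using third_index_of[OF junction(1-3)] by metis
      note s0 = s(1) junction(3) s(2,3)
      have s2: "{i, b, a} = {1,2,3}" "{a, b, i} = {1,2,3}" using s(1) by auto
      note I = index_sets[OF s0]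
      note L = laplacian_1[OF s0, of u] laplacian_1[OF s2(1) s(2) junction(3) s(3)[symmetric], of u]
        laplacian_1[OF s2(2) s(3) junction(3)[symmetric] s(2)[symmetric], of u]
      note J = junction_interior[OF I(1,2) junction(3), of 0] junction_interior[OF I(1,3) s(2), of 0] 
        junction_interior[OF I(2,3) s(3), of 0]
      have "\<bar>u (corner i)\<bar> \<le> B" "\<bar>u (corner a)\<bar> \<le> B" "\<bar>u (corner b)\<bar> \<le> B"
        using 0(2) corner_in_V0 I by blast+
      moreover have "\<bar>graph_laplacian (Suc 0) u (sg_map i (corner a))\<bar> \<le> c"
        "\<bar>graph_laplacian (Suc 0) u (sg_map i (corner b))\<bar> \<le> c"
        "\<bar>graph_laplacian (Suc 0) u (sg_map a (corner b))\<bar> \<le> c"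
        using 0(3)[OF J(1)] 0(3)[OF J(2)] 0(3)[OF J(3)] by simp_all
      ultimately show ?thesis unfolding junction(4) L sg_map_commute[of b i] sg_map_commute[of b a] sg_map_commute[of a i]
        by argo
    qed
  qed
next
  case (Suc n)
  obtain i y where i: "i \<in> {1,2,3}" "y \<in> V (Suc n)" "x = sg_map i y" 
    using Suc.prems(1) unfolding V.simps(2)[of "Suc n"] by blast
  have "\<bar>graph_laplacian (Suc n) (u \<circ> sg_map i) z\<bar> \<le> c" if z: "z \<in> V (Suc n) - V 0" for z
    using Suc.prems(3)[OF interior_map[OF i(1) z]] unfolding laplacian_map[OF i(1) z] .
  moreover have "\<bar>(u \<circ> sg_map i) z\<bar> \<le> B" if z: "z \<in> V n" for z
  proof -
    have "sg_map i z \<in> V (Suc n)" unfolding V.simps(2) using i(1) z by blast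
    then show ?thesis using Suc.prems(2) by simp
  qed
  ultimately have "\<bar>(u \<circ> sg_map i) y\<bar> \<le> B + c / 2" by (intro Suc.IH[OF i(2)])
  then show ?case unfolding i(3) by simp
qed

section \<open>Eigenfunctions and localization\<close>

lemma sum_fun_apply: "(\<Sum>i\<in>A. f i) x = (\<Sum>i\<in>A. f i x :: 'b :: comm_monoid_add)"
  by (induction A rule: infinite_finite_induct) auto

section \<open>The Laplacian as a limit, and its eigenspaces\<close>

lemma has_laplacian_alt:
  "has_laplacian u g \<longleftrightarrow> continuous_on SG u \<and> continuous_on SG g \<and>
    (\<forall>e>0. \<forall>\<^sub>F m in sequentially. \<forall>x\<in>V m - V 0. \<bar>3/2 * (5 ^ m * graph_laplacian m u x) - g x\<bar> < e)"
  by (simp add: has_laplacian_def eventually_sequentially)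

lemma has_laplacianD:
  assumes "has_laplacian u g"
  shows "continuous_on SG u" "continuous_on SG g"
    "e > 0 \<Longrightarrow> \<forall>\<^sub>F m in sequentially. \<forall>x\<in>V m - V 0. \<bar>3/2 * (5 ^ m * graph_laplacian m u x) - g x\<bar> < e"
  using assms by (auto simp only: has_laplacian_alt)

lemma has_laplacian_cong:
  assumes h: "has_laplacian u g" and u: "\<And>x. x \<in> SG \<Longrightarrow> u x = u' x" and g: "\<And>x. x \<in> SG \<Longrightarrow> g x = g' x"
  shows "has_laplacian u' g'"
proof -
  have V: "x \<in> SG" if "x \<in> V m" for x m using that by (rule subsetD[OF V_subset_SG])
  have L: "graph_laplacian m u x = graph_laplacian m u' x" if "x \<in> V m" for x m
    by (rule graph_laplacian_cong) (use u V that in auto)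
  have "continuous_on SG u'" "continuous_on SG g'"
    using has_laplacianD(1,2)[OF h] u g by (auto cong: continuous_on_cong)
  moreover have "\<forall>\<^sub>F m in sequentially. \<forall>x\<in>V m - V 0. \<bar>3/2 * (5 ^ m * graph_laplacian m u' x) - g' x\<bar> < e"
    if "e > 0" for e
    using has_laplacianD(3)[OF h that]
  proof eventually_elim
    case (elim m)
    show ?case
    proof
      fix x assume x: "x \<in> V m - V 0"
      then have "x \<in> V m" by simp
      then show "\<bar>3/2 * (5 ^ m * graph_laplacian m u' x) - g' x\<bar> < e"
        using bspec[OF elim x] unfolding L[OF \<open>x \<in> V m\<close>] g[OF V[OF \<open>x \<in> V m\<close>]] by simp
    qed
  qed
  ultimately show ?thesis by (simp add: has_laplacian_alt)
qed

lemma graph_laplacian_add: "graph_laplacian m (u + v) x = graph_laplacian m u x + graph_laplacian m v x"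
  by (simp add: graph_laplacian_def sum.distrib)

lemma graph_laplacian_scale: "graph_laplacian m (\<lambda>x. c * u x) x = c * graph_laplacian m u x"
  by (simp add: graph_laplacian_def right_diff_distrib flip: sum_distrib_left)

lemma graph_laplacian_zero: "graph_laplacian m 0 x = 0"
  by (simp add: graph_laplacian_def)

lemma corner_diff_add: "corner_diff m (u + v) i = corner_diff m u i + corner_diff m v i"
  by (simp add: corner_diff_def nbr_sum_def sum.distrib)

lemma corner_diff_scale: "corner_diff m (\<lambda>x. c * u x) i = c * corner_diff m u i"
  by (simp add: corner_diff_def nbr_sum_def right_diff_distrib flip: sum_distrib_left)

lemma corner_diff_zero: "corner_diff m 0 i = 0"
  by (simp add: corner_diff_def nbr_sum_def)

lemma has_laplacian_zero: "has_laplacian 0 (\<lambda>x. 0)"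
  by (simp add: has_laplacian_alt graph_laplacian_zero zero_fun_def[symmetric])

lemma has_laplacian_add:
  assumes "has_laplacian u g" "has_laplacian v h"
  shows "has_laplacian (u + v) (\<lambda>x. g x + h x)"
  unfolding has_laplacian_alt
proof (intro conjI allI impI)
  show "continuous_on SG (u + v)" "continuous_on SG (\<lambda>x. g x + h x)"
    using has_laplacianD(1,2)[OF assms(1)] has_laplacianD(1,2)[OF assms(2)]
    by (auto simp: plus_fun_def intro!: continuous_intros)
  fix e :: real assume "e > 0"
  then have "e / 2 > 0" by simp
  show "\<forall>\<^sub>F m in sequentially. \<forall>x\<in>V m - V 0. \<bar>3/2 * (5 ^ m * graph_laplacian m (u + v) x) - (g x + h x)\<bar> < e"
    using has_laplacianD(3)[OF assms(1) \<open>e / 2 > 0\<close>] has_laplacianD(3)[OF assms(2) \<open>e / 2 > 0\<close>]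
  proof eventually_elim
    case (elim m)
    show ?case
    proof
      fix x assume "x \<in> V m - V 0"
      then have "\<bar>3/2 * (5 ^ m * graph_laplacian m u x) - g x\<bar> < e / 2"
        "\<bar>3/2 * (5 ^ m * graph_laplacian m v x) - h x\<bar> < e / 2" using elim by blast+
      then show "\<bar>3/2 * (5 ^ m * graph_laplacian m (u + v) x) - (g x + h x)\<bar> < e"
        unfolding graph_laplacian_add distrib_left by linarith
    qed
  qed
qed

lemma has_laplacian_scale:
  assumes "has_laplacian u g"
  shows "has_laplacian (\<lambda>x. c * u x) (\<lambda>x. c * g x)"
  unfolding has_laplacian_alt
proof (intro conjI allI impI)
  show "continuous_on SG (\<lambda>x. c * u x)" "continuous_on SG (\<lambda>x. c * g x)"
    using has_laplacianD(1,2)[OF assms(1)] by (auto intro!: continuous_intros)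
  fix e :: real assume e: "e > 0"
  then have e': "e / (\<bar>c\<bar> + 1) > 0" by simp
  show "\<forall>\<^sub>F m in sequentially. \<forall>x\<in>V m - V 0. \<bar>3/2 * (5 ^ m * graph_laplacian m (\<lambda>x. c * u x) x) - c * g x\<bar> < e"
    using has_laplacianD(3)[OF assms(1) e']
  proof eventually_elim
    case (elim m)
    show ?case
    proof
      fix x assume "x \<in> V m - V 0"
      then have b: "\<bar>3/2 * (5 ^ m * graph_laplacian m u x) - g x\<bar> < e / (\<bar>c\<bar> + 1)" using elim by blast
      have "\<bar>3/2 * (5 ^ m * graph_laplacian m (\<lambda>x. c * u x) x) - c * g x\<bar>
        = \<bar>c\<bar> * \<bar>3/2 * (5 ^ m * graph_laplacian m u x) - g x\<bar>"
        unfolding graph_laplacian_scale abs_mult[symmetric] by (simp add: algebra_simps)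
      also have "\<dots> \<le> \<bar>c\<bar> * (e / (\<bar>c\<bar> + 1))" using b by (intro mult_left_mono) auto
      also have "\<dots> < e" using e by (simp add: field_simps)
      finally show "\<bar>3/2 * (5 ^ m * graph_laplacian m (\<lambda>x. c * u x) x) - c * g x\<bar> < e" .
    qed
  qed
qed

lemma laplacian_mono_iter:
  assumes "x \<in> V n - V 0" "\<And>y. y \<in> V (n + d) - V 0 \<Longrightarrow> \<bar>graph_laplacian (n + d) u y\<bar> \<le> c"
  shows "\<bar>graph_laplacian n u x\<bar> \<le> 5 ^ d * c"
  using assms
proof (induction d arbitrary: c)
  case (Suc d)
  have "\<bar>graph_laplacian (n + d) u y\<bar> \<le> 5 * c" if "y \<in> V (n + d) - V 0" for y
    using laplacian_mono[OF that] Suc.prems(2) by simp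
  from Suc.IH[OF Suc.prems(1) this] show ?case by (simp add: mult_ac)
qed simp

text \<open>The definition controls only large levels and only up to an error. The factor
  \<open>5 ^ N\<close> lost on the way down from level \<open>n + N\<close> is cancelled by the
  normalisation, so a bound without error holds on every level.\<close>

lemma has_laplacian_bound:
  assumes h: "has_laplacian u g" and M: "\<And>y. y \<in> SG \<Longrightarrow> \<bar>g y\<bar> \<le> M" and x: "x \<in> V n - V 0"
  shows "\<bar>graph_laplacian n u x\<bar> \<le> 2/3 * M / 5 ^ n"
proof (rule field_le_epsilon)
  fix e :: real assume e: "e > 0"
  \<comment> \<open>Chosen so that the error arriving at level \<open>n\<close> is exactly
    \<open>e\<close>.\<close>
  define e' where "e' = 3/2 * e * 5 ^ n"
  have "e' > 0" using e by (simp add: e'_def)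
  from has_laplacianD(3)[OF h this] obtain N where
    N: "\<And>m y. m \<ge> N \<Longrightarrow> y \<in> V m - V 0 \<Longrightarrow> \<bar>3/2 * (5 ^ m * graph_laplacian m u y) - g y\<bar> < e'"
    unfolding eventually_sequentially by blast
  have "\<bar>graph_laplacian (n + N) u y\<bar> \<le> 2/3 * (M + e') / 5 ^ (n + N)" if y: "y \<in> V (n + N) - V 0" for y
  proof -
    have "y \<in> SG" using y by (auto intro: subsetD[OF V_subset_SG])
    then have "\<bar>3/2 * (5 ^ (n + N) * graph_laplacian (n + N) u y)\<bar> \<le> M + e'"
      using N[OF _ y] M[of y] by simp
    then have "3/2 * 5 ^ (n + N) * \<bar>graph_laplacian (n + N) u y\<bar> \<le> M + e'"
      by (simp add: abs_mult mult.assoc)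
    then show ?thesis by (simp add: field_simps)
  qed
  from laplacian_mono_iter[OF x this]
  have "\<bar>graph_laplacian n u x\<bar> \<le> 5 ^ N * (2/3 * (M + e') / 5 ^ (n + N))" .
  also have "\<dots> = 2/3 * M / 5 ^ n + e" by (simp add: e'_def power_add field_simps)
  finally show "\<bar>graph_laplacian n u x\<bar> \<le> 2/3 * M / 5 ^ n + e" .
qed

lemma bounded_on_SG:
  assumes "continuous_on SG (g :: point \<Rightarrow> real)"
  obtains x where "x \<in> SG" "\<And>y. y \<in> SG \<Longrightarrow> \<bar>g y\<bar> \<le> \<bar>g x\<bar>"
proof -
  have "continuous_on SG (\<lambda>x. \<bar>g x\<bar>)" using assms by (intro continuous_intros)
  from continuous_attains_sup[OF compact_SG SG_nonempty this] show thesis using that by blast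
qed

lemma eigenspace_iff:
  "u \<in> eigenspace l \<longleftrightarrow> (\<forall>x. x \<notin> SG \<longrightarrow> u x = 0) \<and> has_laplacian u (\<lambda>x. - (l * u x)) \<and> (\<forall>x\<in>V 0. u x = 0)"
  using has_laplacian_zero
  by (auto simp: eigenspace_def dirichlet_eigenfunction_def)

lemma eigenspace_outside: "\<lbrakk>u \<in> eigenspace l; x \<notin> SG\<rbrakk> \<Longrightarrow> u x = 0"
  unfolding eigenspace_iff by blast

lemma subspace_eigenspace: "fun_space.subspace (eigenspace l)"
proof (rule fun_space.subspaceI)
  show "0 \<in> eigenspace l" by (simp add: eigenspace_def)
next
  fix u v assume u: "u \<in> eigenspace l" and v: "v \<in> eigenspace l"
  have "has_laplacian (u + v) (\<lambda>x. - (l * u x) + - (l * v x))"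
    using u v by (intro has_laplacian_add) (auto simp: eigenspace_iff)
  then have "has_laplacian (u + v) (\<lambda>x. - (l * (u + v) x))"
    by (rule has_laplacian_cong) (auto simp: algebra_simps)
  then show "u + v \<in> eigenspace l" using u v by (auto simp: eigenspace_iff)
next
  fix c u assume u: "u \<in> eigenspace l"
  have "has_laplacian (\<lambda>x. c * u x) (\<lambda>x. c * - (l * u x))"
    using u by (intro has_laplacian_scale) (auto simp: eigenspace_iff)
  then have "has_laplacian (\<lambda>x. c * u x) (\<lambda>x. - (l * (c * u x)))"
    by (rule has_laplacian_cong) (auto simp: algebra_simps)
  then show "(\<lambda>x. c * u x) \<in> eigenspace l" using u by (auto simp: eigenspace_iff)
qed

text \<open>The recursion over levels bounds an eigenfunction that vanishes on a fine enough vertex set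
  by a fraction of its own maximum.\<close>

lemma eigenfunction_eq_0:
  assumes u: "u \<in> eigenspace l" and z: "\<And>x. x \<in> V m \<Longrightarrow> u x = 0" and l: "\<bar>l\<bar> \<le> 5 ^ m"
  shows "u = 0"
proof -
  have h: "has_laplacian u (\<lambda>x. - (l * u x))" using u by (simp add: eigenspace_iff)
  obtain p where p: "p \<in> SG" and M: "\<And>y. y \<in> SG \<Longrightarrow> \<bar>u y\<bar> \<le> \<bar>u p\<bar>"
    using bounded_on_SG[OF has_laplacianD(1)[OF h]] by blast
  define M where "M = \<bar>u p\<bar>"
  have lap: "\<bar>graph_laplacian n u x\<bar> \<le> 2/3 * (\<bar>l\<bar> * M) / 5 ^ n" if "x \<in> V n - V 0" for n x
    by (rule has_laplacian_bound[OF h _ that]) (auto simp: abs_mult M_def M intro!: mult_left_mono)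
  \<comment> \<open>Passing to level \<open>k + 1\<close> adds half of the Laplacian bound, that is
    \<open>\<bar>l\<bar> * M / 3 / 5 ^ (k + 1)\<close>. The geometric series starting after level
    \<open>m\<close> sums to \<open>\<bar>l\<bar> * M / 12 / 5 ^ m\<close>.\<close>
  have B: "\<bar>u x\<bar> \<le> \<bar>l\<bar> * M / 12 * (1 / 5 ^ m - 1 / 5 ^ (m + d))" if "x \<in> V (m + d)" for x d
    using that
  proof (induction d arbitrary: x)
    case 0
    then show ?case using z by simp
  next
    case (Suc d)
    have "\<bar>u x\<bar> \<le> \<bar>l\<bar> * M / 12 * (1 / 5 ^ m - 1 / 5 ^ (m + d)) + 2/3 * (\<bar>l\<bar> * M) / 5 ^ Suc (m + d) / 2"
      by (rule V_step_bound[of x "m + d"]) (use Suc.prems in simp, rule Suc.IH, assumption, rule lap)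
    also have "\<dots> = \<bar>l\<bar> * M / 12 * (1 / 5 ^ m - 1 / 5 ^ (m + Suc d))"
      by (simp add: field_simps)
    finally show ?case .
  qed
  \<comment> \<open>The maximum \<open>M\<close> is attained at \<open>p\<close>, so this forces
    \<open>M = 0\<close>.\<close>
  have "\<bar>u p\<bar> \<le> M / 12"
  proof (rule V_dense_bound[where w = "[]" and n = 0 and g = "\<lambda>x. \<bar>u x\<bar>"])
    show "continuous_on SG (\<lambda>x. \<bar>u x\<bar>)" using has_laplacianD(1)[OF h] by (intro continuous_intros)
    fix k y assume "y \<in> V k"
    then have "y \<in> V (m + k)" using V_mono[of k "m + k"] by auto
    then have "\<bar>u y\<bar> \<le> \<bar>l\<bar> * M / 12 * (1 / 5 ^ m - 1 / 5 ^ (m + k))" by (rule B)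
    also have "\<dots> \<le> \<bar>l\<bar> * M / 12 * (1 / 5 ^ m)"
      by (intro mult_left_mono) (auto simp: M_def)
    also have "\<dots> = (\<bar>l\<bar> / 5 ^ m) * M / 12" by simp
    also have "\<dots> \<le> 1 * M / 12" using l by (intro divide_right_mono mult_right_mono) (auto simp: M_def)
    finally show "\<bar>u y\<bar> \<le> M / 12" by simp
  qed (use p in auto)
  then have "M = 0" by (simp add: M_def)
  moreover have "u x = 0" if "x \<notin> SG" for x by (rule eigenspace_outside[OF u that])
  ultimately have "u x = 0" for x using M[of x] by (cases "x \<in> SG") (simp_all add: M_def)
  then show ?thesis by auto
qed

text \<open>Normal derivatives exist: consecutive terms differ by the scale \<open>(5/3) ^ m\<close>
  times a Laplacian of size \<open>5 ^ (-m)\<close>, which leaves a summable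
  \<open>(1/3) ^ m\<close>.\<close>

lemma corner_diff_convergent:
  assumes h: "has_laplacian u g" and i: "i \<in> {1,2,3}"
  shows "convergent (\<lambda>m. (5/3) ^ m * corner_diff m u i)"
proof -
  let ?X = "\<lambda>m. (5/3) ^ m * corner_diff m u i"
  obtain p where M: "\<And>y. y \<in> SG \<Longrightarrow> \<bar>g y\<bar> \<le> \<bar>g p\<bar>" using bounded_on_SG[OF has_laplacianD(2)[OF h]] by blast
  have b: "norm (?X (Suc m) - ?X m) \<le> 2/9 * \<bar>g p\<bar> * (1/3) ^ m" for m
  proof -
    have "\<bar>corner_diff m u i - 5/3 * corner_diff (Suc m) u i\<bar> \<le> 5/3 * (2/3 * \<bar>g p\<bar> / 5 ^ Suc m)"
      by (rule corner_diff_step_bound[OF i]) (rule has_laplacian_bound[OF h M])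
    then have "(5/3) ^ m * \<bar>corner_diff m u i - 5/3 * corner_diff (Suc m) u i\<bar> \<le> (5/3) ^ m * (5/3 * (2/3 * \<bar>g p\<bar> / 5 ^ Suc m))"
      by (intro mult_left_mono) auto
    moreover have "\<bar>?X (Suc m) - ?X m\<bar> = (5/3) ^ m * \<bar>corner_diff m u i - 5/3 * corner_diff (Suc m) u i\<bar>"
    proof -
      have "?X (Suc m) - ?X m = - ((5/3) ^ m * (corner_diff m u i - 5/3 * corner_diff (Suc m) u i))"
        by (simp add: algebra_simps)
      then show ?thesis by (simp only: abs_minus abs_mult) simp
    qed
    moreover have "(5/3) ^ m * (5/3 * (2/3 * \<bar>g p\<bar> / 5 ^ Suc m)) = 2/9 * \<bar>g p\<bar> * (1/3) ^ m"
      by (simp add: power_divide field_simps)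
    ultimately show ?thesis by (simp only: real_norm_def)
  qed
  have "summable (\<lambda>m. 2/9 * \<bar>g p\<bar> * (1/3) ^ m)" by (intro summable_mult summable_geometric) simp
  then have "summable (\<lambda>m. ?X (Suc m) - ?X m)" by (rule summable_comparison_test'[where N = 0]) (rule b)
  then have "convergent (\<lambda>n. \<Sum>m<n. ?X (Suc m) - ?X m)" by (simp only: summable_iff_convergent)
  then have "convergent (\<lambda>n. ?X n - ?X 0)" using sum_lessThan_telescope[of ?X] by (simp only:)
  then have "convergent (\<lambda>n. (?X n - ?X 0) + ?X 0)" by (intro convergent_add convergent_const)
  then show ?thesis by (simp only: diff_add_cancel)
qed

text \<open>The term is minus the sum of its later increments; \<open>3/2\<close> is the sum of all
  powers of \<open>1/3\<close>.\<close>

lemma geometric_tail: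
  fixes X :: "nat \<Rightarrow> real"
  assumes X: "X \<longlonglongrightarrow> 0" and d: "\<And>k. k \<ge> m \<Longrightarrow> \<bar>X (Suc k) - X k\<bar> \<le> c * (1/3) ^ k"
  shows "\<bar>X m\<bar> \<le> 3/2 * c * (1/3) ^ m"
proof -
  have c: "c \<ge> 0"
  proof -
    have "0 \<le> c * (1/3) ^ m" using d[of m] by (meson abs_ge_zero order_refl order_trans)
    moreover have "c * (1/3) ^ m < 0" if "c < 0" using that by (intro mult_neg_pos) auto
    ultimately show ?thesis by (meson not_le)
  qed
  have b: "\<bar>X (m + j) - X m\<bar> \<le> 3/2 * c * ((1/3) ^ m - (1/3) ^ (m + j))" for j
  proof (induction j)
    case (Suc j)
    have "\<bar>X (m + Suc j) - X m\<bar> \<le> 3/2 * c * ((1/3) ^ m - (1/3) ^ (m + j)) + c * (1/3) ^ (m + j)"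
      using Suc d[of "m + j"] abs_triangle_ineq[of "X (m + Suc j) - X (m + j)" "X (m + j) - X m"] by simp
    also have "\<dots> = 3/2 * c * ((1/3) ^ m - (1/3) ^ (m + Suc j))" by (simp add: algebra_simps)
    finally show ?case .
  qed simp
  have "\<bar>X (m + j) - X m\<bar> \<le> 3/2 * c * (1/3) ^ m" for j
  proof -
    have "3/2 * c * ((1/3) ^ m - (1/3) ^ (m + j)) \<le> 3/2 * c * (1/3) ^ m" using c by (intro mult_left_mono) auto
    then show ?thesis using b[of j] by linarith
  qed
  moreover have "(\<lambda>j. X (m + j)) \<longlonglongrightarrow> 0" using LIMSEQ_ignore_initial_segment[OF X, of m] by (simp add: add.commute)
  then have "(\<lambda>j. \<bar>X (m + j) - X m\<bar>) \<longlonglongrightarrow> \<bar>0 - X m\<bar>" by (intro tendsto_intros)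
  ultimately have "\<bar>0 - X m\<bar> \<le> 3/2 * c * (1/3) ^ m" by (intro LIMSEQ_le_const2) auto
  then show ?thesis by simp
qed

lemma continuous_near_corner:
  assumes g: "continuous_on SG (g :: point \<Rightarrow> real)" and i: "i \<in> {1,2,3}" and e: "e > 0"
  shows "\<forall>\<^sub>F k in sequentially. \<forall>x\<in>cell (replicate k i). \<bar>g x - g (corner i)\<bar> < e"
proof -
  obtain d where d: "d > 0" "\<And>x. x \<in> SG \<Longrightarrow> dist x (corner i) < d \<Longrightarrow> dist (g x) (g (corner i)) < e"
    using g e corner_SG[OF i] unfolding continuous_on_iff by metis
  obtain D where D: "\<And>w x y. x \<in> cell w \<Longrightarrow> y \<in> cell w \<Longrightarrow> dist x y \<le> D / 2 ^ length w"
    using cell_diam by blast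
  have "(\<lambda>k. D * (1/2) ^ k) \<longlonglongrightarrow> D * 0" by (intro tendsto_intros) auto
  then have "\<forall>\<^sub>F k in sequentially. D * (1/2) ^ k < d" using d(1) by (intro order_tendstoD(2)) auto
  then show ?thesis
  proof eventually_elim
    case (elim k)
    have w: "replicate k i \<in> words k" using i by (auto simp: words_def)
    have "corner i \<in> cell (replicate k i)"
    proof (induction k)
      case 0
      show ?case using corner_SG[OF i] by simp
    next
      case (Suc k)
      then have "sg_map i (corner i) \<in> cell (replicate (Suc k) i)"
        unfolding replicate_Suc cell_Cons by (rule imageI)
      then show ?case by (simp only: sg_map_fixed)
    qed
    show ?case
    proof
      fix x assume x: "x \<in> cell (replicate k i)"
      have "dist x (corner i) \<le> D / 2 ^ k" using D[OF x \<open>corner i \<in> cell (replicate k i)\<close>] by simp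
      then have "dist x (corner i) < d" using elim by (simp add: power_one_over)
      then show "\<bar>g x - g (corner i)\<bar> < e"
        using d(2)[of x] subsetD[OF cell_subset_SG[OF w] x] by (simp add: dist_real_def)
    qed
  qed
qed

text \<open>When the normal derivative vanishes, the scaled difference is a tail of its increments.
  These are bounded by graph Laplacians near the corner, which are \<open>o(5^(-k))\<close> because
  \<open>g\<close> vanishes at the corner. The tail is therefore \<open>o(3^(-m))\<close>, and
  \<open>3 ^ m * (5/3) ^ m = 5 ^ m\<close>.\<close>

lemma corner_diff_decay:
  assumes h: "has_laplacian u g" and i: "i \<in> {1,2,3}" and g0: "g (corner i) = 0"
    and l: "(\<lambda>m. (5/3) ^ m * corner_diff m u i) \<longlonglongrightarrow> 0"
  shows "(\<lambda>m. 5 ^ m * corner_diff m u i) \<longlonglongrightarrow> 0"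
proof (rule LIMSEQ_I)
  fix e :: real assume e: "e > 0"
  let ?X = "\<lambda>m. (5/3) ^ m * corner_diff m u i"
  from eventually_conj[OF continuous_near_corner[OF has_laplacianD(2)[OF h] i e] has_laplacianD(3)[OF h e]]
  obtain N where N1: "\<And>k x. k \<ge> N \<Longrightarrow> x \<in> cell (replicate k i) \<Longrightarrow> \<bar>g x\<bar> < e"
    and N2: "\<And>m x. m \<ge> N \<Longrightarrow> x \<in> V m - V 0 \<Longrightarrow> \<bar>3/2 * (5 ^ m * graph_laplacian m u x) - g x\<bar> < e"
    unfolding eventually_sequentially g0 by (metis diff_zero)
  have step: "\<bar>?X (Suc k) - ?X k\<bar> \<le> 4/9 * e * (1/3) ^ k" if k: "k \<ge> N" for k
  proof -
    have "\<bar>graph_laplacian (Suc k) u x\<bar> \<le> 4/3 * e / 5 ^ Suc k"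
      if x: "x \<in> V (Suc k) - V 0" "x \<in> cell (replicate k i)" for x
    proof -
      have "\<bar>3/2 * (5 ^ Suc k * graph_laplacian (Suc k) u x)\<bar> \<le> 2 * e"
        using N1[OF k x(2)] N2[OF _ x(1)] k by linarith
      then have "3/2 * 5 ^ Suc k * \<bar>graph_laplacian (Suc k) u x\<bar> \<le> 2 * e" by (simp add: abs_mult mult.assoc)
      then show ?thesis by (simp add: field_simps)
    qed
    then have "\<bar>corner_diff k u i - 5/3 * corner_diff (Suc k) u i\<bar> \<le> 5/3 * (4/3 * e / 5 ^ Suc k)"
      by (intro corner_diff_step_bound[OF i])
    then have "(5/3) ^ k * \<bar>corner_diff k u i - 5/3 * corner_diff (Suc k) u i\<bar> \<le> (5/3) ^ k * (5/3 * (4/3 * e / 5 ^ Suc k))"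
      by (intro mult_left_mono) auto
    moreover have "\<bar>?X (Suc k) - ?X k\<bar> = (5/3) ^ k * \<bar>corner_diff k u i - 5/3 * corner_diff (Suc k) u i\<bar>"
    proof -
      have "?X (Suc k) - ?X k = - ((5/3) ^ k * (corner_diff k u i - 5/3 * corner_diff (Suc k) u i))"
        by (simp add: algebra_simps)
      then show ?thesis by (simp only: abs_minus abs_mult) simp
    qed
    moreover have "(5/3) ^ k * (5/3 * (4/3 * e / 5 ^ Suc k)) = 4/9 * e * (1/3) ^ k"
      by (simp add: power_divide field_simps)
    ultimately show ?thesis by (simp only:)
  qed
  show "\<exists>no. \<forall>n\<ge>no. norm (5 ^ n * corner_diff n u i - 0) < e"
  proof (intro exI allI impI)
    fix n assume n: "n \<ge> N"
    have "\<bar>?X n\<bar> \<le> 3/2 * (4/9 * e) * (1/3) ^ n"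
      by (rule geometric_tail[OF l]) (use step n in auto)
    then have "3 ^ n * \<bar>?X n\<bar> \<le> 3 ^ n * (3/2 * (4/9 * e) * (1/3) ^ n)" by (intro mult_left_mono) auto
    also have "\<dots> = 2/3 * e" by (simp add: power_one_over)
    also have "3 ^ n * \<bar>?X n\<bar> = \<bar>5 ^ n * corner_diff n u i\<bar>" by (simp add: abs_mult power_divide)
    finally show "norm (5 ^ n * corner_diff n u i - 0) < e" using e by simp
  qed
qed

text \<open>Composition with a contraction lowers the level by one, which costs one factor 5 of the
  normalisation.\<close>

lemma has_laplacian_map:
  assumes h: "has_laplacian u g" and i: "i \<in> {1,2,3}"
  shows "has_laplacian (u \<circ> sg_map i) (\<lambda>x. g (sg_map i x) / 5)"
  unfolding has_laplacian_alt
proof (intro conjI allI impI)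
  have s: "sg_map i ` SG \<subseteq> SG" using sg_map_SG[OF i] by blast
  show "continuous_on SG (u \<circ> sg_map i)"
    by (intro continuous_on_compose continuous_on_sg_map continuous_on_subset[OF has_laplacianD(1)[OF h] s])
  have "continuous_on SG (g \<circ> sg_map i)"
    by (intro continuous_on_compose continuous_on_sg_map continuous_on_subset[OF has_laplacianD(2)[OF h] s])
  then show "continuous_on SG (\<lambda>x. g (sg_map i x) / 5)" by (auto simp: o_def intro!: continuous_intros)
  fix e :: real assume "e > 0"
  then have "5 * e > 0" by simp
  from has_laplacianD(3)[OF h this] obtain N where
    N: "\<And>m x. m \<ge> N \<Longrightarrow> x \<in> V m - V 0 \<Longrightarrow> \<bar>3/2 * (5 ^ m * graph_laplacian m u x) - g x\<bar> < 5 * e"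
    unfolding eventually_sequentially by blast
  show "\<forall>\<^sub>F m in sequentially. \<forall>x\<in>V m - V 0. \<bar>3/2 * (5 ^ m * graph_laplacian m (u \<circ> sg_map i) x) - g (sg_map i x) / 5\<bar> < e"
  proof (rule eventually_sequentiallyI[of N], rule ballI)
    fix m x assume m: "m \<ge> N" and x: "x \<in> V m - V 0"
    have "\<bar>3/2 * (5 ^ Suc m * graph_laplacian (Suc m) u (sg_map i x)) - g (sg_map i x)\<bar> < 5 * e"
      using N[OF _ interior_map[OF i x]] m by simp
    then show "\<bar>3/2 * (5 ^ m * graph_laplacian m (u \<circ> sg_map i) x) - g (sg_map i x) / 5\<bar> < e"
      unfolding laplacian_map[OF i x] by (simp only: power_Suc)
  qed
qed

lemma has_laplacian_word_map:
  assumes "has_laplacian u g" "w \<in> words n"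
  shows "has_laplacian (u \<circ> word_map w) (\<lambda>x. g (word_map w x) / 5 ^ n)"
  using assms
proof (induction n arbitrary: u g w)
  case 0
  then show ?case by simp
next
  case (Suc n)
  obtain i v where w: "i \<in> {1,2,3}" "v \<in> words n" "w = i # v" using Suc.prems(2) unfolding words_Suc by blast
  show ?case
    using Suc.IH[OF has_laplacian_map[OF Suc.prems(1) w(1)] w(2)] by (simp add: w(3) comp_assoc)
qed

text \<open>The decay of \<open>corner_diff\<close> expresses that the normal derivatives vanish; it is what makes the
  extension by zero from a cell to the gasket an eigenfunction again.\<close>

definition loc_space :: "real \<Rightarrow> (point \<Rightarrow> real) set" where
  "loc_space l = {v \<in> eigenspace l. \<forall>i\<in>{1,2,3}. (\<lambda>m. 5 ^ m * corner_diff m v i) \<longlonglongrightarrow> 0}"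

lemma loc_space_eigenspace: "v \<in> loc_space l \<Longrightarrow> v \<in> eigenspace l"
  by (simp only: loc_space_def mem_Collect_eq)

lemma loc_space_corner: "v \<in> loc_space l \<Longrightarrow> i \<in> {1,2,3} \<Longrightarrow> v (corner i) = 0"
  using corner_in_V0[of i] by (simp only: loc_space_def mem_Collect_eq eigenspace_iff)

lemma subspace_loc_space: "fun_space.subspace (loc_space l)"
proof (rule fun_space.subspaceI)
  note E = subspace_eigenspace[of l]
  show "0 \<in> loc_space l"
    using fun_space.subspace_0[OF E] by (simp add: loc_space_def corner_diff_zero)
  fix u v assume u: "u \<in> loc_space l" and v: "v \<in> loc_space l"
  have "(\<lambda>m. 5 ^ m * corner_diff m (u + v) i) \<longlonglongrightarrow> 0 + 0" if "i \<in> {1,2,3}" for i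
    unfolding corner_diff_add distrib_left using u v that by (intro tendsto_add) (auto simp: loc_space_def)
  then show "u + v \<in> loc_space l"
    using fun_space.subspace_add[OF E] u v by (simp add: loc_space_def)
next
  note E = subspace_eigenspace[of l]
  fix c u assume u: "u \<in> loc_space l"
  have "(\<lambda>m. 5 ^ m * corner_diff m (\<lambda>x. c * u x) i) \<longlonglongrightarrow> 0" if i: "i \<in> {1,2,3}" for i
  proof -
    have "(\<lambda>m. 5 ^ m * corner_diff m u i) \<longlonglongrightarrow> 0" using u i unfolding loc_space_def by blast
    then have "(\<lambda>m. c * (5 ^ m * corner_diff m u i)) \<longlonglongrightarrow> c * 0" by (rule tendsto_mult_left)
    then show ?thesis unfolding corner_diff_scale mult_zero_right by (simp only: mult.left_commute[of _ c])
  qed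
  then show "(\<lambda>x. c * u x) \<in> loc_space l"
    using fun_space.subspace_scale[OF E] u by (simp add: loc_space_def)
qed

section \<open>Gluing three functions, and placing a function in one cell\<close>

definition glue :: "(nat \<Rightarrow> point \<Rightarrow> real) \<Rightarrow> point \<Rightarrow> real" where
  "glue v x = (if x \<in> sg_map 1 ` SG then v 1 (sg_inv 1 x) else if x \<in> sg_map 2 ` SG then v 2 (sg_inv 2 x)
     else if x \<in> sg_map 3 ` SG then v 3 (sg_inv 3 x) else 0)"

text \<open>At a junction \<open>glue\<close> uses the first cell in its case distinction; under
  this condition the other cell gives the same value.\<close>

definition compatible :: "(nat \<Rightarrow> point \<Rightarrow> real) \<Rightarrow> bool" where
  "compatible v \<longleftrightarrow> (\<forall>i\<in>{1,2,3}. \<forall>k\<in>{1,2,3}. v i (corner k) = v k (corner i))"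

lemma glue_outside: "x \<notin> SG \<Longrightarrow> glue v x = 0"
  unfolding glue_def using sg_map_SG[of 1] sg_map_SG[of 2] sg_map_SG[of 3] by auto

lemma glue_map:
  assumes c: "compatible v" and i: "i \<in> {1,2,3}" and y: "y \<in> SG"
  shows "glue v (sg_map i y) = v i y"
proof -
  have k: "v k (sg_inv k (sg_map i y)) = v i y" if kk: "k \<in> {1,2,3}" and m: "sg_map i y \<in> sg_map k ` SG" for k
  proof (cases "i = k")
    case False
    obtain z where z: "z \<in> SG" "sg_map i y = sg_map k z" using m by blast
    have "y = corner k" by (rule SG_inter(1)[OF i kk False y z])
    moreover have "z = corner i" by (rule SG_inter(2)[OF i kk False y z])
    ultimately show ?thesis using c i kk z(2) unfolding compatible_def by (metis sg_inv_map)
  qed simp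
  have m: "sg_map i y \<in> sg_map i ` SG" using y by (rule imageI)
  consider "i = 1" | "i = 2" | "i = 3" using i by blast
  then show ?thesis unfolding glue_def using k[of 1] k[of 2] k[of 3] m by cases auto
qed

lemma glue_compose:
  assumes "compatible v" "i \<in> {1,2,3}" "y \<in> SG"
  shows "(glue v \<circ> sg_map i) y = v i y"
  using glue_map[OF assms] by simp

lemma continuous_on_glue:
  assumes c: "compatible v" and v: "\<And>i. i \<in> {1,2,3} \<Longrightarrow> continuous_on SG (v i)"
  shows "continuous_on SG (glue v)"
proof -
  have "continuous_on (sg_map i ` SG) (glue v)" if i: "i \<in> {1,2,3}" for i
  proof -
    have "continuous_on (sg_map i ` SG) (v i \<circ> sg_inv i)"
      by (intro continuous_on_compose continuous_on_sg_inv) (simp add: image_image v[OF i])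
    then show ?thesis
      by (rule continuous_on_cong[THEN iffD1, rotated -1]) (use glue_map[OF c i] in auto)
  qed
  moreover have "closed (sg_map i ` SG)" for i
    by (intro compact_imp_closed compact_continuous_image continuous_on_sg_map compact_SG)
  ultimately have "continuous_on (\<Union>i\<in>{1,2,3}. sg_map i ` SG) (glue v)"
    by (intro continuous_on_closed_Union) auto
  then show ?thesis unfolding SG_union[symmetric] .
qed

text \<open>Inside the cells the equations of the pieces carry over, with the eigenvalue multiplied
  by 5. At a junction the value is 0 and the graph Laplacian is a sum of two one-sided differences
  of size \<open>o(5^(-m))\<close>, so the limit is 0 there as well.\<close>

lemma glue_loc_space:
  assumes v: "\<And>i. i \<in> {1,2,3} \<Longrightarrow> v i \<in> loc_space (l / 5)"
  shows "glue v \<in> loc_space l"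
proof -
  have c: "compatible v"
    unfolding compatible_def using loc_space_corner[OF v] by simp
  note gm = glue_compose[OF c]
  have E: "v i \<in> eigenspace (l / 5)" if "i \<in> {1,2,3}" for i by (rule loc_space_eigenspace[OF v[OF that]])
  have h: "has_laplacian (v i) (\<lambda>x. - (l / 5 * v i x))" if "i \<in> {1,2,3}" for i
    using E[OF that] by (simp only: eigenspace_iff)
  have VSG: "y \<in> SG" if "y \<in> V m" for m y using that by (rule subsetD[OF V_subset_SG])
  have L: "graph_laplacian m (glue v \<circ> sg_map i) y = graph_laplacian m (v i) y"
    if "i \<in> {1,2,3}" "y \<in> V m" for i m y
    by (rule graph_laplacian_cong[OF _ that(2)]) (use gm[OF that(1)] VSG in auto)
  have C: "corner_diff m (glue v \<circ> sg_map i) k = corner_diff m (v i) k"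
    if "i \<in> {1,2,3}" "k \<in> {1,2,3}" for i k m
    by (rule corner_diff_cong[OF _ that(2)]) (use gm[OF that(1)] VSG in auto)
  have cont: "continuous_on SG (glue v)"
    by (rule continuous_on_glue[OF c]) (rule has_laplacianD(1)[OF h])
  have cd: "(\<lambda>m. 5 ^ m * corner_diff m (v i) k) \<longlonglongrightarrow> 0" if "i \<in> {1,2,3}" "k \<in> {1,2,3}" for i k
    using v[OF that(1)] that(2) by (simp only: loc_space_def mem_Collect_eq)
  have "has_laplacian (glue v) (\<lambda>x. - (l * glue v x))"
    unfolding has_laplacian_alt
  proof (intro conjI allI impI cont)
    show "continuous_on SG (\<lambda>x. - (l * glue v x))" using cont by (intro continuous_intros)
    fix e :: real assume e: "e > 0"
    have "\<forall>\<^sub>F m in sequentially. \<forall>i\<in>{1,2,3::nat}.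
      \<forall>x\<in>V m - V 0. \<bar>3/2 * (5 ^ m * graph_laplacian m (v i) x) - - (l / 5 * v i x)\<bar> < e / 5"
    proof (intro eventually_ball_finite ballI)
      fix i :: nat assume i: "i \<in> {1,2,3}"
      show "\<forall>\<^sub>F m in sequentially. \<forall>x\<in>V m - V 0.
        \<bar>3/2 * (5 ^ m * graph_laplacian m (v i) x) - - (l / 5 * v i x)\<bar> < e / 5"
        by (rule has_laplacianD(3)[OF h[OF i]]) (use e in simp)
    qed simp
    \<comment> \<open>At a junction two such differences occur one level higher:
      \<open>3/2 * 5 * 2 / 16 = 15/16 < 1\<close>.\<close>
    moreover have "\<forall>\<^sub>F m in sequentially. \<forall>i\<in>{1,2,3::nat}. \<forall>k\<in>{1,2,3::nat}. \<bar>5 ^ m * corner_diff m (v i) k\<bar> < e / 16"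
    proof (intro eventually_ball_finite ballI)
      fix i k :: nat assume ik: "i \<in> {1,2,3}" "k \<in> {1,2,3}"
      have "(\<lambda>m. \<bar>5 ^ m * corner_diff m (v i) k\<bar>) \<longlonglongrightarrow> 0" using tendsto_rabs[OF cd[OF ik]] by simp
      then show "\<forall>\<^sub>F m in sequentially. \<bar>5 ^ m * corner_diff m (v i) k\<bar> < e / 16"
        using e by (intro order_tendstoD(2)) auto
    qed auto
    ultimately have "\<forall>\<^sub>F m in sequentially. \<forall>x\<in>V (Suc m) - V 0.
      \<bar>3/2 * (5 ^ Suc m * graph_laplacian (Suc m) (glue v) x) - - (l * glue v x)\<bar> < e"
    proof eventually_elim
      case (elim m)
      show ?case
      proof
        fix x assume "x \<in> V (Suc m) - V 0"
        then show "\<bar>3/2 * (5 ^ Suc m * graph_laplacian (Suc m) (glue v) x) - - (l * glue v x)\<bar> < e"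
        proof (cases rule: interior_cases)
          case (map i y)
          have y: "y \<in> V m" using map(2) by simp
          have "\<bar>3/2 * (5 ^ m * graph_laplacian m (v i) y) - - (l / 5 * v i y)\<bar> < e / 5"
            using elim(1) map(1,2) by blast
          then show ?thesis
            unfolding map(3) laplacian_map[OF map(1,2)] L[OF map(1) y] glue_map[OF c map(1) VSG[OF y]]
            by (simp only: power_Suc)
        next
          case (junction i k)
          have "\<bar>5 ^ m * corner_diff m (v i) k\<bar> < e / 16" "\<bar>5 ^ m * corner_diff m (v k) i\<bar> < e / 16"
            using elim(2) junction(1,2) by blast+
          moreover have "glue v x = 0"
            unfolding junction(4) glue_map[OF c junction(1) corner_SG[OF junction(2)]]
            by (rule loc_space_corner[OF v[OF junction(1)] junction(2)])
          ultimately show ?thesis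
            using e unfolding junction(4) laplacian_junction[OF junction(1-3)] C[OF junction(1,2)] C[OF junction(2,1)]
            by (simp only: power_Suc distrib_left)
        qed
      qed
    qed
    then show "\<forall>\<^sub>F m in sequentially. \<forall>x\<in>V m - V 0.
      \<bar>3/2 * (5 ^ m * graph_laplacian m (glue v) x) - - (l * glue v x)\<bar> < e"
      by (rule eventually_sequentially_Suc[THEN iffD1])
  qed
  moreover have "glue v (corner i) = 0" if i: "i \<in> {1,2,3}" for i
    using glue_map[OF c i corner_SG[OF i]] loc_space_corner[OF v[OF i] i] by (simp only: sg_map_fixed)
  then have "\<forall>x\<in>V 0. glue v x = 0" unfolding V_0 by blast
  moreover have "(\<lambda>m. 5 ^ m * corner_diff m (glue v) i) \<longlonglongrightarrow> 0" if i: "i \<in> {1,2,3}" for i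
  proof -
    have "(\<lambda>m. 5 * (5 ^ m * corner_diff m (v i) i)) \<longlonglongrightarrow> 5 * 0" by (rule tendsto_mult_left[OF cd[OF i i]])
    then have "(\<lambda>m. 5 ^ Suc m * corner_diff (Suc m) (glue v) i) \<longlonglongrightarrow> 0"
      unfolding corner_diff_Suc[OF i] C[OF i i] by (simp add: mult.assoc)
    then show ?thesis by (rule LIMSEQ_imp_Suc)
  qed
  ultimately show ?thesis unfolding loc_space_def eigenspace_iff using glue_outside by blast
qed

primrec loc :: "nat list \<Rightarrow> (point \<Rightarrow> real) \<Rightarrow> point \<Rightarrow> real" where
  "loc [] v = v"
| "loc (i # w) v = glue (\<lambda>k. if k = i then loc w v else 0)"

lemma loc_loc_space:
  "\<lbrakk>v \<in> loc_space (l / 5 ^ n); w \<in> words n\<rbrakk> \<Longrightarrow> loc w v \<in> loc_space l"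
proof (induction n arbitrary: l w)
  case (Suc n)
  obtain i w' where w: "i \<in> {1,2,3}" "w' \<in> words n" "w = i # w'" using Suc.prems(2) unfolding words_Suc by blast
  have "v \<in> loc_space (l / 5 / 5 ^ n)" using Suc.prems(1) by simp
  then have "loc w' v \<in> loc_space (l / 5)" by (rule Suc.IH[OF _ w(2)])
  then show ?case unfolding w(3) loc.simps
    by (intro glue_loc_space) (auto intro: fun_space.subspace_0[OF subspace_loc_space])
qed simp

text \<open>Vanishing at the corners goes through the same induction, because it makes the next
  gluing compatible.\<close>

lemma loc_corner_apply:
  assumes "\<forall>i\<in>{1,2,3}. v (corner i) = 0" "w \<in> words n"
  shows "(\<forall>i\<in>{1,2,3}. loc w v (corner i) = 0) \<and>
    (\<forall>w'\<in>words n. \<forall>y\<in>SG. loc w v (word_map w' y) = (if w = w' then v y else 0))"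
  using assms(2)
proof (induction n arbitrary: w)
  case 0
  then show ?case using assms(1) by simp
next
  case (Suc n)
  obtain i p where w: "i \<in> {1,2,3}" "p \<in> words n" "w = i # p" using Suc.prems unfolding words_Suc by blast
  let ?v = "\<lambda>k. if k = i then loc p v else 0"
  note IH = Suc.IH[OF w(2)]
  have c: "compatible ?v" unfolding compatible_def using IH by auto
  have g: "loc w v (sg_map k y) = ?v k y" if "k \<in> {1,2,3}" "y \<in> SG" for k y
    unfolding w(3) loc.simps by (rule glue_map[OF c that])
  have 1: "loc w v (corner k) = 0" if k: "k \<in> {1,2,3}" for k
  proof -
    have "loc w v (corner k) = ?v k (corner k)" using g[OF k corner_SG[OF k]] by (simp only: sg_map_fixed)
    then show ?thesis using IH k by auto
  qed
  have 2: "loc w v (word_map w' y) = (if w = w' then v y else 0)" if w': "w' \<in> words (Suc n)" and y: "y \<in> SG" for w' y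
  proof -
    obtain k q where q: "k \<in> {1,2,3}" "q \<in> words n" "w' = k # q" using w' unfolding words_Suc by blast
    have "loc w v (word_map w' y) = ?v k (word_map q y)"
      using g[OF q(1) word_map_SG[OF q(2) y]] by (simp add: q(3))
    then show ?thesis using IH q(2) y unfolding q(3) w(3) by auto
  qed
  show ?case using 1 2 by blast
qed

lemma loc_apply:
  assumes "v \<in> loc_space l" "w \<in> words n" "w' \<in> words n" "y \<in> SG"
  shows "loc w v (word_map w' y) = (if w = w' then v y else 0)"
proof -
  have "\<forall>i\<in>{1,2,3}. v (corner i) = 0" using loc_space_corner[OF assms(1)] by blast
  from loc_corner_apply[OF this assms(2)] assms(3,4) show ?thesis by blast
qed

text \<open>A point outside SG may be mapped by \<open>word_map w\<close> into another cell, so the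
  composition has to be cut back to SG.\<close>

definition zero_ext :: "(point \<Rightarrow> real) \<Rightarrow> point \<Rightarrow> real" where
  "zero_ext u x = (if x \<in> SG then u x else 0)"

text \<open>By the eigenvalue equation, vanishing of the function at the corners is vanishing of its
  Laplacian there, as \<open>corner_diff_decay\<close> requires.\<close>

lemma eigenfunction_localize:
  assumes u: "u \<in> eigenspace l" and w: "w \<in> words n"
    and 0: "\<And>i. i \<in> {1,2,3} \<Longrightarrow> u (word_map w (corner i)) = 0"
    and d: "\<And>i. i \<in> {1,2,3} \<Longrightarrow> (\<lambda>m. (5/3) ^ m * corner_diff m (u \<circ> word_map w) i) \<longlonglongrightarrow> 0"
  shows "zero_ext (u \<circ> word_map w) \<in> loc_space (l / 5 ^ n)"
proof -
  let ?v = "u \<circ> word_map w"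
  have "has_laplacian u (\<lambda>x. - (l * u x))" using u by (simp only: eigenspace_iff)
  from has_laplacian_word_map[OF this w]
  have h: "has_laplacian ?v (\<lambda>x. - (l / 5 ^ n * ?v x))"
    by (rule has_laplacian_cong) auto
  have h': "has_laplacian (zero_ext ?v) (\<lambda>x. - (l / 5 ^ n * zero_ext ?v x))"
    by (rule has_laplacian_cong[OF h]) (auto simp: zero_ext_def)
  have C: "corner_diff m (zero_ext ?v) i = corner_diff m ?v i" if "i \<in> {1,2,3}" for m i
    by (rule corner_diff_cong[OF _ that]) (use V_subset_SG in \<open>auto simp: zero_ext_def\<close>)
  have "(\<lambda>m. 5 ^ m * corner_diff m ?v i) \<longlonglongrightarrow> 0" if i: "i \<in> {1,2,3}" for i
    by (rule corner_diff_decay[OF h i _ d[OF i]]) (simp add: 0[OF i])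
  then have "\<forall>i\<in>{1,2,3}. (\<lambda>m. 5 ^ m * corner_diff m (zero_ext ?v) i) \<longlonglongrightarrow> 0" using C by simp
  moreover have "\<forall>x\<in>V 0. zero_ext ?v x = 0" unfolding V_0 using 0 by (auto simp: zero_ext_def)
  ultimately show ?thesis unfolding loc_space_def eigenspace_iff using h' by (auto simp: zero_ext_def)
qed

lemma sum_loc_eq:
  assumes "\<And>w. w \<in> words n \<Longrightarrow> zero_ext (u \<circ> word_map w) \<in> loc_space (l / 5 ^ n)"
    and out: "\<And>x. x \<notin> SG \<Longrightarrow> u x = 0"
  shows "u = (\<Sum>w\<in>words n. loc w (zero_ext (u \<circ> word_map w)))"
proof
  fix x
  let ?v = "\<lambda>w. zero_ext (u \<circ> word_map w)"
  show "u x = (\<Sum>w\<in>words n. loc w (?v w)) x"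
  proof (cases "x \<in> SG")
    case True
    then obtain q where q: "q \<in> words n" "x \<in> cell q" using subsetD[OF equalityD1[OF SG_cells[of n]] True] by blast
    then obtain y where y: "y \<in> SG" "x = word_map q y" unfolding cell_def by blast
    have "(\<Sum>w\<in>words n. loc w (?v w)) x = (\<Sum>w\<in>words n. if w = q then ?v q y else 0)"
      unfolding sum_fun_apply y(2)
      by (intro sum.cong refl) (simp add: loc_apply[OF assms(1) _ q(1) y(1)])
    also have "\<dots> = ?v q y" using q(1) finite_words by simp
    also have "\<dots> = u x" using y by (simp add: zero_ext_def)
    finally show ?thesis by simp
  next
    case False
    have "loc w (?v w) x = 0" if "w \<in> words n" for w
      by (rule eigenspace_outside[OF loc_space_eigenspace[OF loc_loc_space[OF assms(1)[OF that] that]] False])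
    then show ?thesis using out[OF False] by (simp add: sum_fun_apply)
  qed
qed

section \<open>The self-similar measure\<close>

lemma word_map_eq_corner:
  assumes "w \<in> words n" "k \<in> {1,2,3}" "y \<in> SG" "word_map w y = corner k"
  shows "y = corner k" "w = replicate n k"
proof -
  have "y = corner k \<and> w = replicate n k" using assms(1,4)
  proof (induction n arbitrary: w)
    case (Suc n)
    then obtain i p where w: "i \<in> {1,2,3}" "p \<in> words n" "w = i # p" unfolding words_Suc by blast
    have e: "sg_map i (word_map p y) = corner k" using Suc.prems(2) w(3) by simp
    have i: "i = k" by (rule sg_map_eq_corner(1)[OF w(1) assms(2) word_map_SG[OF w(2) assms(3)] e])
    have "word_map p y = corner k" by (rule sg_map_eq_corner(2)[OF w(1) assms(2) word_map_SG[OF w(2) assms(3)] e])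
    from Suc.IH[OF w(2) this] show ?case using i w(3) by simp
  qed simp
  then show "y = corner k" "w = replicate n k" by blast+
qed

text \<open>At the first letter where the words differ the common point is a junction of two
  different cells, so the rest of the word maps \<open>y\<close> to a corner; only corners are
  mapped to corners.\<close>

lemma cell_overlap:
  assumes "w \<in> words n" "w' \<in> words n" "w \<noteq> w'" "y \<in> SG" "z \<in> SG" "word_map w y = word_map w' z"
  shows "\<exists>k\<in>{1,2,3}. y = corner k"
  using assms(1-3,6)
proof (induction n arbitrary: w w')
  case (Suc n)
  obtain i p where w: "i \<in> {1,2,3}" "p \<in> words n" "w = i # p" using Suc.prems(1) unfolding words_Suc by blast
  obtain i' p' where w': "i' \<in> {1,2,3}" "p' \<in> words n" "w' = i' # p'" using Suc.prems(2) unfolding words_Suc by blast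
  have e: "sg_map i (word_map p y) = sg_map i' (word_map p' z)" using Suc.prems(4) w(3) w'(3) by simp
  show ?case
  proof (cases "i = i'")
    case True
    have "p \<noteq> p'" using Suc.prems(3) w(3) w'(3) True by simp
    moreover have "word_map p y = word_map p' z" using e True by simp
    ultimately show ?thesis by (rule Suc.IH[OF w(2) w'(2)])
  next
    case False
    have "word_map p y = corner i'"
      by (rule SG_inter(1)[OF w(1) w'(1) False word_map_SG[OF w(2) assms(4)] word_map_SG[OF w'(2) assms(5)] e])
    from word_map_eq_corner(1)[OF w(2) w'(1) assms(4) this] show ?thesis using w'(1) by blast
  qed
qed simp

section \<open>Existence of the measure: the image of independent uniform digits\<close>

abbreviation digit_measure :: "nat measure" where
  "digit_measure \<equiv> uniform_count_measure {1,2,3}"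

definition digits :: "(nat \<Rightarrow> nat) measure" where
  "digits = PiM UNIV (\<lambda>_. digit_measure)"

text \<open>The infinite composition of the maps \<open>sg_map (\<omega> k)\<close>; it becomes a
  series because each map is \<open>x \<mapsto> (x + corner i) / 2\<close>.\<close>

definition address :: "(nat \<Rightarrow> nat) \<Rightarrow> point" where
  "address \<omega> = (\<Sum>k. (1/2) ^ Suc k *\<^sub>R corner (\<omega> k))"

lemma prob_space_digit: "prob_space digit_measure"
  by (rule prob_space_uniform_count_measure) auto

lemma product_prob_space_digits: "product_prob_space (\<lambda>_::nat. digit_measure)"
  by (intro product_prob_spaceI prob_space_digit)

lemma prob_space_digits: "prob_space digits"
  unfolding digits_def by (intro prob_space_PiM prob_space_digit)

lemma space_digits: "space digits = {\<omega>. \<forall>k. \<omega> k \<in> {1,2,3}}"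
  unfolding digits_def by (auto simp: space_PiM space_uniform_count_measure PiE_def Pi_def)

lemma cylinder:
  assumes v: "\<And>i. v i \<in> {1,2,3}" and J: "finite J"
  shows "{\<omega>\<in>space digits. \<forall>i\<in>J. \<omega> i = v i} \<in> sets digits"
    and "measure digits {\<omega>\<in>space digits. \<forall>i\<in>J. \<omega> i = v i} = (1/3) ^ card J"
proof -
  interpret P: product_prob_space "\<lambda>_::nat. digit_measure" UNIV by (rule product_prob_space_digits)
  have s: "{v i} \<in> sets digit_measure" for i using v[of i] by (simp add: sets_uniform_count_measure)
  have set_eq: "{\<omega>\<in>space digits. \<forall>i\<in>J. \<omega> i = v i} = {\<omega>\<in>space digits. \<forall>i\<in>J. \<omega> i \<in> {v i}}" by simp
  show "{\<omega>\<in>space digits. \<forall>i\<in>J. \<omega> i = v i} \<in> sets digits"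
    unfolding set_eq digits_def by (intro sets.sets_Collect_finite_All sets_Collect_single' J) (use s in \<open>auto simp: sets_uniform_count_measure\<close>)
  have "emeasure digits {\<omega>\<in>space digits. \<forall>i\<in>J. \<omega> i \<in> {v i}} = (\<Prod>i\<in>J. emeasure digit_measure {v i})"
  proof (cases "J = {}")
    case True
    then show ?thesis using prob_space.emeasure_space_1[OF prob_space_digits] by simp
  next
    case False
    then show ?thesis unfolding digits_def by (intro P.emeasure_PiM_Collect J) (use s in auto)
  qed
  also have "\<dots> = (\<Prod>i\<in>J. ennreal (1/3))"
  proof (rule prod.cong[OF refl])
    fix i
    have "emeasure digit_measure {v i} = ennreal (real (card {v i}) / real (card {1,2,3::nat}))"
      by (rule emeasure_uniform_count_measure) (use v[of i] in auto)
    then show "emeasure digit_measure {v i} = ennreal (1/3)" by simp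
  qed
  also have "\<dots> = ennreal ((1/3) ^ card J)" by (simp only: prod_constant ennreal_power)
  finally show "measure digits {\<omega>\<in>space digits. \<forall>i\<in>J. \<omega> i = v i} = (1/3) ^ card J"
    unfolding set_eq measure_def by simp
qed

lemma norm_corner: "norm (corner i) \<le> 2"
  by (auto simp: corner_def norm_Pair power_divide)

lemma summable_address: "summable (\<lambda>k. (1/2) ^ Suc k *\<^sub>R corner (\<omega> k))"
proof (rule summable_comparison_test'[where N = 0])
  show "summable (\<lambda>k. (1/2 :: real) ^ k)" by (rule summable_geometric) simp
  fix k
  have "norm ((1/2) ^ Suc k *\<^sub>R corner (\<omega> k)) = (1/2) ^ Suc k * norm (corner (\<omega> k))" by simp
  also have "\<dots> \<le> (1/2) ^ Suc k * 2" by (intro mult_left_mono norm_corner) simp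
  finally show "norm ((1/2) ^ Suc k *\<^sub>R corner (\<omega> k)) \<le> (1/2) ^ k" by simp
qed

lemma address_Suc: "address \<omega> = sg_map (\<omega> 0) (address (\<lambda>k. \<omega> (Suc k)))"
proof -
  have "address \<omega> = (\<Sum>k. (1/2) ^ Suc (Suc k) *\<^sub>R corner (\<omega> (Suc k))) + (1/2) ^ Suc 0 *\<^sub>R corner (\<omega> 0)"
    using suminf_split_head[OF summable_address[of \<omega>]] by (simp add: address_def)
  also have "(\<Sum>k. (1/2) ^ Suc (Suc k) *\<^sub>R corner (\<omega> (Suc k))) = (1/2) *\<^sub>R address (\<lambda>k. \<omega> (Suc k))"
    using suminf_scaleR_right[OF summable_address[of "\<lambda>k. \<omega> (Suc k)"], of "1/2"] by (simp add: address_def)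
  finally show ?thesis by (simp add: sg_map_corner_eq algebra_simps)
qed

text \<open>Since \<open>corner 1\<close> is the origin, its images under words are the partial sums
  of \<open>address\<close>; this places all addresses in SG.\<close>

lemma word_map_corner_sum: "word_map w (corner 1) = (\<Sum>k<length w. (1/2) ^ Suc k *\<^sub>R corner (w ! k))"
proof (induction w)
  case (Cons i w)
  have c: "corner 1 = 0" by (simp add: corner_def zero_prod_def)
  have "word_map (i # w) (corner 1) = (1/2) *\<^sub>R (\<Sum>k<length w. (1/2) ^ Suc k *\<^sub>R corner (w ! k)) + (1/2) *\<^sub>R corner i"
    using Cons by (simp add: sg_map_corner_eq scaleR_right_distrib)
  also have "\<dots> = (\<Sum>k<length (i # w). (1/2) ^ Suc k *\<^sub>R corner ((i # w) ! k))"
    by (simp add: sum.lessThan_Suc_shift scaleR_sum_right del: sum.lessThan_Suc)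
  finally show ?case .
qed (simp add: corner_def zero_prod_def)

lemma address_SG:
  assumes w: "\<And>k. \<omega> k \<in> {1,2,3}"
  shows "address \<omega> \<in> SG"
proof -
  have lim: "(\<lambda>n. \<Sum>k<n. (1/2) ^ Suc k *\<^sub>R corner (\<omega> k)) \<longlonglongrightarrow> address \<omega>"
    unfolding address_def by (rule summable_LIMSEQ[OF summable_address])
  have "(\<Sum>k<n. (1/2) ^ Suc k *\<^sub>R corner (\<omega> k)) \<in> SG" for n
  proof -
    have "map \<omega> [0..<n] \<in> words n" using w by (auto simp: words_def)
    moreover have "corner 1 \<in> SG" by (rule corner_SG) simp
    ultimately have "word_map (map \<omega> [0..<n]) (corner 1) \<in> SG" by (rule word_map_SG)
    then show ?thesis unfolding word_map_corner_sum by simp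
  qed
  then show ?thesis by (rule closed_sequentially[OF compact_imp_closed[OF compact_SG] _ lim])
qed

lemma address_word: "address \<omega> = word_map (map \<omega> [0..<n]) (address (\<lambda>k. \<omega> (n + k)))"
proof (induction n arbitrary: \<omega>)
  case (Suc n)
  have "address \<omega> = sg_map (\<omega> 0) (address (\<lambda>k. \<omega> (Suc k)))" by (rule address_Suc)
  also have "address (\<lambda>k. \<omega> (Suc k)) = word_map (map (\<lambda>k. \<omega> (Suc k)) [0..<n]) (address (\<lambda>k. \<omega> (Suc (n + k))))"
    by (rule Suc)
  also have "sg_map (\<omega> 0) \<dots> = word_map (map \<omega> [0..<Suc n]) (address (\<lambda>k. \<omega> (Suc n + k)))"
    by (simp add: upt_conv_Cons map_Suc_upt[symmetric] o_def del: upt_Suc)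
  finally show ?case .
qed simp

lemma address_eq_corner:
  assumes w: "\<And>j. \<omega> j \<in> {1,2,3}" and k: "k \<in> {1,2,3}" and a: "address \<omega> = corner k"
  shows "\<omega> j = k"
proof -
  have "map \<omega> [0..<Suc j] = replicate (Suc j) k"
  proof (rule word_map_eq_corner(2)[OF _ k])
    show "map \<omega> [0..<Suc j] \<in> words (Suc j)" using w by (auto simp: words_def)
    show "address (\<lambda>i. \<omega> (Suc j + i)) \<in> SG" using w by (intro address_SG)
    show "word_map (map \<omega> [0..<Suc j]) (address (\<lambda>i. \<omega> (Suc j + i))) = corner k"
      unfolding address_word[symmetric] by (rule a)
  qed
  then have "map \<omega> [0..<Suc j] ! j = replicate (Suc j) k ! j" by simp
  then show ?thesis by (simp del: upt_Suc replicate_Suc)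
qed

lemma measurable_address: "address \<in> measurable digits (restrict_space borel SG)"
proof (rule measurable_restrict_space2)
  show "address \<in> space digits \<rightarrow> SG" using address_SG by (auto simp: space_digits)
  have "(\<lambda>\<omega>. corner (\<omega> k)) \<in> borel_measurable digits" for k
  proof -
    have "corner \<in> borel_measurable digit_measure"
      by (auto simp: measurable_def sets_uniform_count_measure space_uniform_count_measure)
    moreover have "(\<lambda>\<omega>. \<omega> k) \<in> measurable digits digit_measure"
      unfolding digits_def by (rule measurable_component_singleton) simp
    ultimately show ?thesis using measurable_compose[of "\<lambda>\<omega>. \<omega> k" digits digit_measure corner borel] by blast
  qed
  then have "(\<lambda>\<omega>. \<Sum>k. (1/2) ^ Suc k *\<^sub>R corner (\<omega> k)) \<in> borel_measurable digits"
    by (intro borel_measurable_suminf borel_measurable_scaleR) auto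
  then show "address \<in> borel_measurable digits" unfolding address_def[abs_def] .
qed

text \<open>Two different digit sequences with the same address are eventually constant, so this
  null set absorbs all overlaps of cells.\<close>

lemma tail_const_null:
  assumes k: "k \<in> {1,2,3}"
  shows "{\<omega>\<in>space digits. \<forall>j\<ge>n. \<omega> j = k} \<in> null_sets digits"
proof -
  interpret D: prob_space digits by (rule prob_space_digits)
  let ?C = "\<lambda>m. {\<omega>\<in>space digits. \<forall>j\<in>{n..<n+m}. \<omega> j = k}"
  note c = cylinder[of "\<lambda>_. k", OF k]
  have e: "{\<omega>\<in>space digits. \<forall>j\<ge>n. \<omega> j = k} = (\<Inter>m. ?C m)"
  proof (intro equalityI subsetI)
    fix \<omega> assume w: "\<omega> \<in> (\<Inter>m. ?C m)"
    have "\<omega> j = k" if "j \<ge> n" for j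
    proof -
      have "\<omega> \<in> ?C (Suc (j - n))" using w by blast
      then show ?thesis using that by auto
    qed
    then show "\<omega> \<in> {\<omega>\<in>space digits. \<forall>j\<ge>n. \<omega> j = k}" using w by auto
  qed auto
  have C: "?C m \<in> sets digits" "measure digits (?C m) = (1/3) ^ m" for m
    using c[of "{n..<n+m}"] by simp_all
  have S: "{\<omega>\<in>space digits. \<forall>j\<ge>n. \<omega> j = k} \<in> sets digits" unfolding e using C(1) by auto
  have le: "measure digits {\<omega>\<in>space digits. \<forall>j\<ge>n. \<omega> j = k} \<le> (1/3) ^ m" for m
    unfolding C(2)[of m, symmetric] by (rule D.finite_measure_mono[OF _ C(1)]) auto
  have "(\<lambda>m. (1/3 :: real) ^ m) \<longlonglongrightarrow> 0" by (intro LIMSEQ_power_zero) simp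
  then have "measure digits {\<omega>\<in>space digits. \<forall>j\<ge>n. \<omega> j = k} \<le> 0"
    by (rule LIMSEQ_le_const) (intro exI allI impI le)
  then have "measure digits {\<omega>\<in>space digits. \<forall>j\<ge>n. \<omega> j = k} = 0" by (intro antisym measure_nonneg)
  then have "emeasure digits {\<omega>\<in>space digits. \<forall>j\<ge>n. \<omega> j = k} = 0"
    by (simp only: D.emeasure_eq_measure ennreal_0)
  then show ?thesis using S by (rule null_setsI)
qed

definition sg_prob :: "point measure \<Rightarrow> bool" where
  "sg_prob M \<longleftrightarrow> prob_space M \<and> space M = SG \<and> sets M = sets (restrict_space borel SG) \<and>
     (\<forall>m. \<forall>w\<in>words m. measure M (cell w) = (1/3) ^ m)"

lemma closed_SG_sets: "closed A \<Longrightarrow> A \<subseteq> SG \<Longrightarrow> A \<in> sets (restrict_space borel SG)"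
  using compact_SG by (auto simp: sets_restrict_space_iff compact_imp_closed)

lemma cell_sets: "w \<in> words m \<Longrightarrow> cell w \<in> sets (restrict_space borel SG)"
  by (rule closed_SG_sets[OF compact_imp_closed[OF compact_cell] cell_subset_SG])

text \<open>The preimage of a cell is the cylinder of its word up to eventually constant sequences:
  another prefix can reach the cell only through a corner, and the address of a corner is
  constant.\<close>

lemma sg_prob_distr: "sg_prob (distr digits (restrict_space borel SG) address)"
  unfolding sg_prob_def
proof (intro conjI allI ballI)
  interpret D: prob_space digits by (rule prob_space_digits)
  show "prob_space (distr digits (restrict_space borel SG) address)"
    by (rule D.prob_space_distr[OF measurable_address])
  show "space (distr digits (restrict_space borel SG) address) = SG" by (simp add: space_restrict_space)
  show "sets (distr digits (restrict_space borel SG) address) = sets (restrict_space borel SG)" by simp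
  fix m w assume w: "w \<in> words m"
  let ?A = "address -` cell w \<inter> space digits"
  \<comment> \<open>The lemma \<open>cylinder\<close> expects a digit at every index, so the word is
    continued by 1.\<close>
  let ?C = "{\<omega>\<in>space digits. \<forall>i\<in>{..<m}. \<omega> i = (if i < m then w ! i else 1)}"
  have wi: "(if i < m then w ! i else 1) \<in> {1,2,3}" for i
  proof (cases "i < m")
    case True
    then have "w ! i \<in> set w" using words_length[OF w] by simp
    then have "w ! i \<in> {1,2,3}" using w unfolding words_def by blast
    then show ?thesis using True by simp
  qed simp
  note c = cylinder[OF wi finite_lessThan[of m]]
  have A: "?A \<in> sets digits" by (rule measurable_sets[OF measurable_address cell_sets[OF w]])
  let ?N = "\<Union>n. \<Union>k\<in>{1,2,3}. {\<omega>\<in>space digits. \<forall>j\<ge>n. \<omega> j = k}"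
  have N: "?N \<in> null_sets digits"
    by (intro null_sets_UN null_sets_UN' tail_const_null) auto
  have CA: "?C \<subseteq> ?A"
  proof
    fix \<omega> assume o: "\<omega> \<in> ?C"
    then have d: "\<And>k. \<omega> k \<in> {1,2,3}" by (auto simp: space_digits)
    have "map \<omega> [0..<m] = w" using o words_length[OF w] by (intro nth_equalityI) auto
    then have "address \<omega> = word_map w (address (\<lambda>k. \<omega> (m + k)))" using address_word[of \<omega> m] by simp
    moreover have "address (\<lambda>k. \<omega> (m + k)) \<in> SG" using d by (intro address_SG)
    ultimately show "\<omega> \<in> ?A" using o by (auto simp: cell_def)
  qed
  have AC: "?A \<subseteq> ?C \<union> ?N"
  proof
    fix \<omega> assume o: "\<omega> \<in> ?A"
    then have d: "\<And>k. \<omega> k \<in> {1,2,3}" by (auto simp: space_digits)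
    let ?w = "map \<omega> [0..<m]"
    show "\<omega> \<in> ?C \<union> ?N"
    proof (cases "?w = w")
      case True
      have "\<omega> i = w ! i" if "i < m" for i using arg_cong[OF True, of "\<lambda>x. x ! i"] that by simp
      then show ?thesis using o by auto
    next
      case False
      have ww: "?w \<in> words m" using d by (auto simp: words_def)
      obtain z where z: "z \<in> SG" "address \<omega> = word_map w z" using o by (auto simp: cell_def)
      have s: "address (\<lambda>k. \<omega> (m + k)) \<in> SG" using d by (intro address_SG)
      have "word_map ?w (address (\<lambda>k. \<omega> (m + k))) = word_map w z"
        using address_word[of \<omega> m] z(2) by simp
      from cell_overlap[OF ww w False s z(1) this]
      obtain k where k: "k \<in> {1,2,3}" "address (\<lambda>k. \<omega> (m + k)) = corner k" by blast
      have "\<omega> j = k" if "j \<ge> m" for j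
        using address_eq_corner[OF d k, of "j - m"] that by simp
      then have "\<omega> \<in> {\<omega>\<in>space digits. \<forall>j\<ge>m. \<omega> j = k}" using o by auto
      then show ?thesis using k(1) by blast
    qed
  qed
  have "measure digits ?A = measure digits ?C"
  proof (rule antisym)
    have "measure digits ?A \<le> measure digits (?C \<union> ?N)"
      by (rule D.finite_measure_mono[OF AC sets.Un[OF c(1) null_setsD2[OF N]]])
    also have "\<dots> = measure digits ?C" by (rule measure_Un_null_set[OF c(1) N])
    finally show "measure digits ?A \<le> measure digits ?C" .
    show "measure digits ?C \<le> measure digits ?A" by (rule D.finite_measure_mono[OF CA A])
  qed
  also have "\<dots> = (1/3) ^ m" using c(2) by (simp only: card_lessThan)
  finally show "measure (distr digits (restrict_space borel SG) address) (cell w) = (1/3) ^ m"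
    by (simp only: measure_distr[OF measurable_address cell_sets[OF w]])
qed

section \<open>Uniqueness of the measure\<close>

lemma sg_prob_point:
  assumes M: "sg_prob M" and x: "x \<in> SG"
  shows "{x} \<in> sets M" "measure M {x} = 0"
proof -
  interpret prob_space M using M by (simp add: sg_prob_def)
  show s: "{x} \<in> sets M" using M x closed_SG_sets[of "{x}"] by (simp add: sg_prob_def)
  have "measure M {x} \<le> (1/3) ^ m" for m
  proof -
    obtain w where w: "w \<in> words m" "x \<in> cell w" using subsetD[OF equalityD1[OF SG_cells[of m]] x] by blast
    have "measure M {x} \<le> measure M (cell w)"
      by (rule finite_measure_mono) (use w M cell_sets in \<open>auto simp: sg_prob_def\<close>)
    then show ?thesis using M w(1) by (simp add: sg_prob_def)
  qed
  moreover have "(\<lambda>m. (1/3 :: real) ^ m) \<longlonglongrightarrow> 0" by (intro LIMSEQ_power_zero) simp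
  ultimately have "measure M {x} \<le> 0" by (intro LIMSEQ_le_const[of _ 0]) blast+
  then show "measure M {x} = 0" by (intro antisym measure_nonneg)
qed

text \<open>Cells alone are not closed under intersection, since two of them may meet in a single
  point. With the points and the empty set they form a pi-system.\<close>

definition cells_points :: "point set set" where
  "cells_points = {{}} \<union> (\<lambda>x. {x}) ` SG \<union> (\<Union>m. cell ` words m)"

text \<open>Strip common first letters. If one word is used up, the cells are nested; if the letters
  differ, the cells meet at most in the junction.\<close>

lemma cell_Int_cell:
  "\<lbrakk>w \<in> words m; w' \<in> words n\<rbrakk> \<Longrightarrow> cell w \<inter> cell w' \<in> cells_points"
proof (induction m arbitrary: n w w')
  case 0
  have "cell w \<inter> cell w' = cell w'" using 0 cell_subset_SG[OF 0(2)] by auto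
  then show ?case using 0(2) unfolding cells_points_def by blast
next
  case (Suc m)
  obtain i p where w: "i \<in> {1,2,3}" "p \<in> words m" "w = i # p" using Suc.prems(1) unfolding words_Suc by blast
  show ?case
  proof (cases n)
    case 0
    have "cell w \<inter> cell w' = cell w" using Suc.prems(2) 0 cell_subset_SG[OF Suc.prems(1)] by auto
    then show ?thesis using Suc.prems(1) unfolding cells_points_def by blast
  next
    case (Suc n')
    obtain i' p' where w': "i' \<in> {1,2,3}" "p' \<in> words n'" "w' = i' # p'"
      using Suc.prems(2) unfolding Suc words_Suc by blast
    show ?thesis
    proof (cases "i = i'")
      case True
      have e: "cell w \<inter> cell w' = sg_map i ` (cell p \<inter> cell p')"
        unfolding w(3) w'(3) cell_Cons True by (rule image_Int[OF inj_sg_map, symmetric])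
      have im: "sg_map i ` A \<in> cells_points" if A: "A \<in> cells_points" for A
      proof -
        consider "A = {}" | x where "x \<in> SG" "A = {x}" | k v where "v \<in> words k" "A = cell v"
          using A unfolding cells_points_def by blast
        then show ?thesis
        proof cases
          case 1 then show ?thesis unfolding cells_points_def by simp
        next
          case 2
          have "sg_map i x \<in> SG" by (rule sg_map_SG[OF w(1) 2(1)])
          then show ?thesis unfolding cells_points_def 2(2) by simp
        next
          case 3
          have "i # v \<in> words (Suc k)" using w(1) 3(1) unfolding words_Suc by blast
          then show ?thesis unfolding cells_points_def 3(2) cell_Cons[symmetric] by blast
        qed
      qed
      show ?thesis unfolding e by (rule im[OF Suc.IH[OF w(2) w'(2)]])
    next
      case False
      have sub: "x = sg_map i (corner i')" if x: "x \<in> cell w \<inter> cell w'" for x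
      proof -
        obtain y z where yz: "y \<in> cell p" "z \<in> cell p'" "x = sg_map i y" "x = sg_map i' z"
          using x unfolding w(3) w'(3) cell_Cons by blast
        have s: "y \<in> SG" "z \<in> SG" using yz(1,2) cell_subset_SG[OF w(2)] cell_subset_SG[OF w'(2)] by auto
        have "sg_map i y = sg_map i' z" using yz(3,4) by simp
        from SG_inter(1)[OF w(1) w'(1) False s this] show ?thesis using yz(3) by simp
      qed
      show ?thesis
      proof (cases "cell w \<inter> cell w' = {}")
        case True
        then show ?thesis unfolding cells_points_def by simp
      next
        case False
        then have "cell w \<inter> cell w' = {sg_map i (corner i')}" using sub by blast
        moreover have "sg_map i (corner i') \<in> SG" by (rule sg_map_SG[OF w(1) corner_SG[OF w'(1)]])
        ultimately show ?thesis unfolding cells_points_def by simp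
      qed
    qed
  qed
qed

lemma cells_points_cases:
  assumes "A \<in> cells_points"
  obtains "A = {}" | x where "x \<in> SG" "A = {x}" | k v where "v \<in> words k" "A = cell v"
  using assms unfolding cells_points_def by blast

lemma Int_stable_cells_points: "Int_stable cells_points"
proof (rule Int_stableI)
  have pt: "{x} \<inter> B \<in> cells_points" if "x \<in> SG" for x B
    using that unfolding cells_points_def by (cases "x \<in> B") auto
  fix A B assume A: "A \<in> cells_points" and B: "B \<in> cells_points"
  show "A \<inter> B \<in> cells_points" using A
  proof (cases rule: cells_points_cases)
    case 1 then show ?thesis unfolding cells_points_def by simp
  next
    case 2 then show ?thesis using pt by simp
  next
    case A: 3
    show ?thesis using B
    proof (cases rule: cells_points_cases)
      case 1 then show ?thesis unfolding cells_points_def by simp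
    next
      case 2 then show ?thesis using pt[of _ A] by (simp add: Int_commute)
    next
      case 3 then show ?thesis using A cell_Int_cell by simp
    qed
  qed
qed

lemma cells_points_SG: "cells_points \<subseteq> Pow SG"
  unfolding cells_points_def using cell_subset_SG by blast

text \<open>A relatively open set is the union of the cells it contains, because cells shrink, and
  there are only countably many cells.\<close>

lemma sigma_sets_cells_points: "sigma_sets SG cells_points = sets (restrict_space borel SG)"
proof
  have "cells_points \<subseteq> sets (restrict_space borel SG)"
    unfolding cells_points_def using cell_sets closed_SG_sets by auto
  then have "sigma_sets (space (restrict_space borel SG)) cells_points \<subseteq> sets (restrict_space borel SG)"
    by (rule sets.sigma_sets_subset)
  then show "sigma_sets SG cells_points \<subseteq> sets (restrict_space borel SG)" by (simp add: space_restrict_space)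
next
  have op: "SG \<inter> U \<in> sigma_sets SG cells_points" if U: "open U" for U
  proof -
    obtain D where D: "D > 0" "\<And>w x y. x \<in> cell w \<Longrightarrow> y \<in> cell w \<Longrightarrow> dist x y \<le> D / 2 ^ length w"
      using cell_diam by blast
    define W where "W = {w. (\<exists>m. w \<in> words m) \<and> cell w \<subseteq> U}"
    have "SG \<inter> U = (\<Union>w\<in>W. cell w)"
    proof
      show "SG \<inter> U \<subseteq> (\<Union>w\<in>W. cell w)"
      proof
        fix x assume x: "x \<in> SG \<inter> U"
        then obtain e where e: "e > 0" "ball x e \<subseteq> U" using U open_contains_ball by blast
        have "(\<lambda>m. D * (1/2) ^ m) \<longlonglongrightarrow> D * 0" by (intro tendsto_intros) auto
        then have "\<forall>\<^sub>F m in sequentially. D * (1/2) ^ m < e" using e(1) by (intro order_tendstoD(2)) auto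
        then obtain m where m: "D * (1/2) ^ m < e" unfolding eventually_sequentially by blast
        have "x \<in> SG" using x by simp
        then obtain w where w: "w \<in> words m" "x \<in> cell w" using subsetD[OF equalityD1[OF SG_cells[of m]]] by blast
        have "cell w \<subseteq> U"
        proof
          fix y assume "y \<in> cell w"
          then have "dist x y \<le> D / 2 ^ m" using D(2)[OF w(2)] words_length[OF w(1)] by simp
          then have "dist x y < e" using m by (simp add: power_one_over)
          then show "y \<in> U" using e(2) by auto
        qed
        then show "x \<in> (\<Union>w\<in>W. cell w)" using w unfolding W_def by blast
      qed
      show "(\<Union>w\<in>W. cell w) \<subseteq> SG \<inter> U" unfolding W_def using cell_subset_SG by blast
    qed
    also have "\<dots> \<in> sigma_sets SG cells_points"
    proof (rule sigma_algebra.countable_UN''[OF sigma_algebra_sigma_sets[OF cells_points_SG]])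
      have "W \<subseteq> (\<Union>m. words m)" unfolding W_def by blast
      then show "countable W" by (rule countable_subset) (auto intro: countable_finite finite_words)
      fix w assume "w \<in> W"
      then have "cell w \<in> cells_points" unfolding W_def cells_points_def by blast
      then show "cell w \<in> sigma_sets SG cells_points" by (rule sigma_sets.Basic)
    qed
    finally show ?thesis .
  qed
  have "sets (restrict_space borel SG) = (\<inter>) SG ` sigma_sets UNIV {S. open S}"
    by (simp add: sets_restrict_space borel_def)
  also have "\<dots> = sigma_sets SG ((\<inter>) SG ` {S. open S})"
  proof (rule sigma_sets_Int)
    have "SG \<in> sets borel" using compact_SG by (simp add: compact_imp_closed)
    then show "SG \<in> sigma_sets UNIV {S. open S}" by (simp add: borel_def)
  qed simp
  also have "\<dots> \<subseteq> sigma_sets SG cells_points"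
    by (rule sigma_algebra.sigma_sets_subset[OF sigma_algebra_sigma_sets[OF cells_points_SG]]) (use op in auto)
  finally show "sets (restrict_space borel SG) \<subseteq> sigma_sets SG cells_points" .
qed

text \<open>Points are null for both measures, since they lie in cells of arbitrarily small measure.
  So the measures agree on the whole pi-system.\<close>

lemma sg_prob_unique:
  assumes M: "sg_prob M" and N: "sg_prob N"
  shows "M = N"
proof (rule measure_eqI_generator_eq[OF Int_stable_cells_points cells_points_SG, where A = "\<lambda>_. SG"])
  interpret M: prob_space M using M by (simp add: sg_prob_def)
  interpret N: prob_space N using N by (simp add: sg_prob_def)
  show "sets M = sigma_sets SG cells_points" "sets N = sigma_sets SG cells_points"
    using M N by (simp_all add: sg_prob_def sigma_sets_cells_points)
  fix X assume "X \<in> cells_points"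
  then show "emeasure M X = emeasure N X"
  proof (cases rule: cells_points_cases)
    case 2
    then show ?thesis using sg_prob_point(2)[OF M] sg_prob_point(2)[OF N]
      by (simp add: M.emeasure_eq_measure N.emeasure_eq_measure)
  next
    case (3 k v)
    then show ?thesis using M N by (simp add: M.emeasure_eq_measure N.emeasure_eq_measure sg_prob_def)
  qed simp
next
  have "SG = cell []" by simp
  moreover have "[] \<in> words 0" by simp
  ultimately have "SG \<in> cells_points" unfolding cells_points_def by blast
  then show "range (\<lambda>_. SG) \<subseteq> cells_points" by blast
  interpret M: prob_space M using M by (simp add: sg_prob_def)
  show "emeasure M SG \<noteq> \<infinity>" by simp
qed simp

lemma sg_prob_sg_measure: "sg_prob sg_measure"
proof -
  have "\<exists>!M. sg_prob M" using sg_prob_distr sg_prob_unique by blast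
  then have "sg_prob (THE M. sg_prob M)" by (rule theI')
  then show ?thesis unfolding sg_measure_def sg_prob_def .
qed

lemma prob_space_sg: "prob_space sg_measure" and space_sg: "space sg_measure = SG"
  and sets_sg: "sets sg_measure = sets (restrict_space borel SG)"
  and measure_cell: "w \<in> words m \<Longrightarrow> measure sg_measure (cell w) = (1/3) ^ m"
  using sg_prob_sg_measure by (simp_all add: sg_prob_def)

section \<open>Integrals of continuous functions\<close>

lemma measurable_sg_continuous:
  "continuous_on SG (f :: point \<Rightarrow> real) \<Longrightarrow> f \<in> borel_measurable sg_measure"
  using borel_measurable_continuous_on_restrict[of SG f] measurable_cong_sets[OF sets_sg refl] by blast

lemma integrable_sg_continuous:
  assumes f: "continuous_on SG (f :: point \<Rightarrow> real)"
  shows "integrable sg_measure f"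
proof -
  interpret prob_space sg_measure by (rule prob_space_sg)
  have "bounded (f ` SG)" by (rule compact_imp_bounded[OF compact_continuous_image[OF f compact_SG]])
  then obtain B where "\<forall>y\<in>f ` SG. norm y \<le> B" unfolding bounded_iff by blast
  then have "AE x in sg_measure. norm (f x) \<le> B" by (intro AE_I2) (simp add: space_sg)
  then show ?thesis by (rule integrable_const_bound) (rule measurable_sg_continuous[OF f])
qed

lemma AE_sg_finite:
  assumes "finite A" shows "AE x in sg_measure. x \<notin> A"
proof -
  interpret prob_space sg_measure by (rule prob_space_sg)
  have "AE x in sg_measure. x \<noteq> a" for a
  proof (cases "a \<in> SG")
    case True
    show ?thesis
    proof (rule AE_I[of _ _ "{a}"])
      show "emeasure sg_measure {a} = 0"
        using sg_prob_point(2)[OF sg_prob_sg_measure True] by (simp add: emeasure_eq_measure)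
      show "{a} \<in> sets sg_measure" by (rule sg_prob_point(1)[OF sg_prob_sg_measure True])
    qed auto
  next
    case False
    then show ?thesis by (intro AE_I2) (auto simp: space_sg)
  qed
  then have "AE x in sg_measure. \<forall>a\<in>A. x \<noteq> a" by (intro AE_finite_allI[OF assms])
  then show ?thesis by (rule AE_mp) (intro AE_I2, blast)
qed

text \<open>A point in two cells of level \<open>m\<close> is one of the finitely many vertices in
  \<open>V m\<close>.\<close>

lemma AE_unique_cell:
  "AE x in sg_measure. \<exists>!w. w \<in> words m \<and> x \<in> cell w"
  using AE_sg_finite[OF finite_V[of m]]
proof (rule AE_mp, intro AE_I2 impI)
  fix x assume "x \<in> space sg_measure" and nV: "x \<notin> V m"
  then have "x \<in> SG" by (simp add: space_sg)
  then obtain w where w: "w \<in> words m" "x \<in> cell w" using subsetD[OF equalityD1[OF SG_cells[of m]]] by blast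
  show "\<exists>!w. w \<in> words m \<and> x \<in> cell w"
  proof (rule ex1I[of _ w])
    show "w \<in> words m \<and> x \<in> cell w" using w by blast
    fix v assume v: "v \<in> words m \<and> x \<in> cell v"
    show "v = w"
    proof (rule ccontr)
      assume "v \<noteq> w"
      then have ne: "w \<noteq> v" by simp
      obtain y z where yz: "y \<in> SG" "z \<in> SG" "x = word_map w y" "x = word_map v z"
        using w v unfolding cell_def by blast
      have e: "word_map w y = word_map v z" using yz by simp
      obtain k where k: "k \<in> {1,2,3}" "y = corner k"
        using cell_overlap[OF w(1) conjunct1[OF v] ne yz(1,2) e] by blast
      have "word_map w (corner k) \<in> V m"
        unfolding V_words[of m] by (rule UN_I[OF w(1) imageI[OF corner_in_V0[OF k(1)]]])
      then show False using nV yz(3) k(2) by simp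
    qed
  qed
qed

text \<open>The step function with value \<open>a w\<close> on the cell \<open>w\<close> is within
  \<open>e\<close> of \<open>h\<close> almost everywhere, and its integral is the plain average
  because all cells have the same measure.\<close>

lemma integral_cells_approx:
  assumes h: "continuous_on SG (h :: point \<Rightarrow> real)"
    and a: "\<And>w x. w \<in> words m \<Longrightarrow> x \<in> cell w \<Longrightarrow> \<bar>h x - a w\<bar> \<le> e"
  shows "\<bar>(LINT x|sg_measure. h x) - (\<Sum>w\<in>words m. a w) / 3 ^ m\<bar> \<le> e"
proof -
  interpret prob_space sg_measure by (rule prob_space_sg)
  let ?s = "\<lambda>x. \<Sum>w\<in>words m. a w * indicator (cell w) x"
  have cs: "cell w \<in> sets sg_measure" if "w \<in> words m" for w using cell_sets[OF that] by (simp add: sets_sg)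
  have ii: "integrable sg_measure (\<lambda>x. a w * indicator (cell w) x)" if "w \<in> words m" for w
    by (intro integrable_mult_right integrable_real_indicator cs that) (simp add: emeasure_eq_measure)
  have si: "integrable sg_measure ?s" using ii by (intro Bochner_Integration.integrable_sum)
  have "(LINT x|sg_measure. ?s x) = (\<Sum>w\<in>words m. LINT x|sg_measure. a w * indicator (cell w) x)"
    using ii by (rule Bochner_Integration.integral_sum)
  also have "\<dots> = (\<Sum>w\<in>words m. a w * (1/3) ^ m)"
    by (intro sum.cong refl) (simp add: cs measure_cell sets.Int_space_eq2[OF cs])
  also have "\<dots> = (\<Sum>w\<in>words m. a w) / 3 ^ m" by (simp add: sum_divide_distrib power_one_over)
  finally have I: "(LINT x|sg_measure. ?s x) = (\<Sum>w\<in>words m. a w) / 3 ^ m" .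
  have "AE x in sg_measure. \<bar>h x - ?s x\<bar> \<le> e"
    using AE_unique_cell[of m]
  proof (rule AE_mp, intro AE_I2 impI)
    fix x assume "\<exists>!w. w \<in> words m \<and> x \<in> cell w"
    then obtain w where w: "w \<in> words m" "x \<in> cell w" "\<And>v. v \<in> words m \<Longrightarrow> x \<in> cell v \<Longrightarrow> v = w" by blast
    have "?s x = (\<Sum>v\<in>words m. if v = w then a w else 0)"
    proof (rule sum.cong[OF refl])
      fix v assume v: "v \<in> words m"
      show "a v * indicator (cell v) x = (if v = w then a w else 0)"
      proof (cases "x \<in> cell v")
        case True
        then have "v = w" by (rule w(3)[OF v])
        then show ?thesis using w(2) by simp
      next
        case False
        then show ?thesis using w(2) by auto
      qed
    qed
    also have "\<dots> = a w" using w(1) finite_words by simp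
    finally show "\<bar>h x - ?s x\<bar> \<le> e" using a[OF w(1,2)] by simp
  qed
  then have "(LINT x|sg_measure. \<bar>h x - ?s x\<bar>) \<le> (LINT x|sg_measure. e)"
    by (intro integral_mono_AE integrable_abs Bochner_Integration.integrable_diff integrable_sg_continuous[OF h] si) auto
  then have "(LINT x|sg_measure. \<bar>h x - ?s x\<bar>) \<le> e" by (simp add: prob_space)
  moreover have "\<bar>LINT x|sg_measure. h x - ?s x\<bar> \<le> (LINT x|sg_measure. \<bar>h x - ?s x\<bar>)"
    by (rule integral_abs_bound)
  moreover have "(LINT x|sg_measure. h x - ?s x) = (LINT x|sg_measure. h x) - (LINT x|sg_measure. ?s x)"
    by (rule Bochner_Integration.integral_diff[OF integrable_sg_continuous[OF h] si])
  ultimately show ?thesis unfolding I by linarith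
qed

text \<open>The measure has full support: a small cell around \<open>x\<close> on which
  \<open>h\<close> exceeds \<open>h x / 2\<close> has positive measure. Definiteness of the weighted
  forms rests on this.\<close>

lemma integral_sg_pos:
  assumes h: "continuous_on SG (h :: point \<Rightarrow> real)" and nn: "\<And>y. y \<in> SG \<Longrightarrow> h y \<ge> 0"
    and x: "x \<in> SG" "h x > 0"
  shows "(LINT y|sg_measure. h y) > 0"
proof -
  interpret prob_space sg_measure by (rule prob_space_sg)
  obtain d where d: "d > 0" "\<And>y. y \<in> SG \<Longrightarrow> dist y x < d \<Longrightarrow> dist (h y) (h x) < h x / 2"
    using h[unfolded continuous_on_iff, rule_format, OF x(1) half_gt_zero[OF x(2)]] by blast
  obtain D where D: "D > 0" "\<And>w x y. x \<in> cell w \<Longrightarrow> y \<in> cell w \<Longrightarrow> dist x y \<le> D / 2 ^ length w"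
    using cell_diam by blast
  have "(\<lambda>m. D * (1/2) ^ m) \<longlonglongrightarrow> D * 0" by (intro tendsto_intros) auto
  then have "\<forall>\<^sub>F m in sequentially. D * (1/2) ^ m < d" using d(1) by (intro order_tendstoD(2)) auto
  then obtain m where m: "D * (1/2) ^ m < d" unfolding eventually_sequentially by blast
  obtain w where w: "w \<in> words m" "x \<in> cell w" using subsetD[OF equalityD1[OF SG_cells[of m]] x(1)] by blast
  have cs: "cell w \<in> sets sg_measure" using cell_sets[OF w(1)] by (simp add: sets_sg)
  have lower: "h x / 2 * indicator (cell w) y \<le> h y" if y: "y \<in> SG" for y
  proof (cases "y \<in> cell w")
    case True
    have "dist y x \<le> D / 2 ^ m" using D(2)[OF True w(2)] words_length[OF w(1)] by simp
    then have "dist y x < d" using m by (simp add: power_one_over)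
    from d(2)[OF y this] have "h x / 2 \<le> h y" unfolding dist_real_def by linarith
    then show ?thesis using True by simp
  next
    case False
    then show ?thesis using nn[OF y] by simp
  qed
  have "0 < h x / 2 * (1/3) ^ m" using x(2) by simp
  also have "\<dots> = (LINT y|sg_measure. h x / 2 * indicator (cell w) y)"
    by (simp add: cs measure_cell[OF w(1)] sets.Int_space_eq2[OF cs])
  also have "\<dots> \<le> (LINT y|sg_measure. h y)"
  proof (rule integral_mono[OF _ integrable_sg_continuous[OF h]])
    show "integrable sg_measure (\<lambda>y. h x / 2 * indicator (cell w) y)"
      by (intro integrable_mult_right integrable_real_indicator cs) (simp add: emeasure_eq_measure)
    show "h x / 2 * indicator (cell w) y \<le> h y" if "y \<in> space sg_measure" for y
      using that unfolding space_sg by (rule lower)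
  qed
  finally show ?thesis .
qed

section \<open>Gram determinants\<close>

text \<open>An inner product on a space of functions, kept abstract so that the forms with weights
  \<open>f\<close> and 1 can be compared on one space.\<close>

locale weighted_form =
  fixes E :: "('a \<Rightarrow> real) set" and g :: "('a \<Rightarrow> real) \<Rightarrow> ('a \<Rightarrow> real) \<Rightarrow> real"
  assumes subspace: "fun_space.subspace E"
    and add_left: "\<And>u v w. \<lbrakk>u \<in> E; v \<in> E; w \<in> E\<rbrakk> \<Longrightarrow> g (u + v) w = g u w + g v w"
    and scale_left: "\<And>c u v. \<lbrakk>u \<in> E; v \<in> E\<rbrakk> \<Longrightarrow> g (\<lambda>x. c * u x) v = c * g u v"
    and sym: "\<And>u v. \<lbrakk>u \<in> E; v \<in> E\<rbrakk> \<Longrightarrow> g u v = g v u"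
    and pos: "\<And>u. \<lbrakk>u \<in> E; u \<noteq> 0\<rbrakk> \<Longrightarrow> g u u > 0"
begin

lemma zero_mem: "0 \<in> E" by (rule fun_space.subspace_0[OF subspace])
lemma add_mem: "u \<in> E \<Longrightarrow> v \<in> E \<Longrightarrow> u + v \<in> E" by (rule fun_space.subspace_add[OF subspace])
lemma scale_mem: "u \<in> E \<Longrightarrow> (\<lambda>x. c * u x) \<in> E" by (rule fun_space.subspace_scale[OF subspace])
lemma diff_mem: "u \<in> E \<Longrightarrow> v \<in> E \<Longrightarrow> u - v \<in> E" by (rule fun_space.subspace_diff[OF subspace])
lemma span_mem: "A \<subseteq> E \<Longrightarrow> fun_space.span A \<subseteq> E" by (rule fun_space.span_minimal[OF _ subspace])

lemma zero_left: "v \<in> E \<Longrightarrow> g 0 v = 0"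
  using scale_left[of v v 0] by (simp add: zero_fun_def)

lemma diff_left: "\<lbrakk>u \<in> E; v \<in> E; w \<in> E\<rbrakk> \<Longrightarrow> g (u - v) w = g u w - g v w"
  using add_left[of "u - v" v w] diff_mem by simp

lemma nonneg: "u \<in> E \<Longrightarrow> g u u \<ge> 0"
  using pos[of u] zero_left[OF zero_mem] by (cases "u = 0") auto

lemma comb_mem: "(\<And>i. i \<in> A \<Longrightarrow> b i \<in> E) \<Longrightarrow> (\<Sum>i\<in>A. (\<lambda>x. c i * b i x)) \<in> E"
  by (intro fun_space.subspace_sum[OF subspace] scale_mem)

lemma comb_left:
  assumes "v \<in> E" "\<And>i. i \<in> A \<Longrightarrow> b i \<in> E"
  shows "g (\<Sum>i\<in>A. (\<lambda>x. c i * b i x)) v = (\<Sum>i\<in>A. c i * g (b i) v)"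
  using assms(2)
proof (induction A rule: infinite_finite_induct)
  case (insert a A)
  have bE: "b a \<in> E" "\<And>i. i \<in> A \<Longrightarrow> b i \<in> E" using insert.prems by auto
  have "g (\<Sum>i\<in>insert a A. (\<lambda>x. c i * b i x)) v = g ((\<lambda>x. c a * b a x) + (\<Sum>i\<in>A. (\<lambda>x. c i * b i x))) v"
    by (simp only: sum.insert[OF insert.hyps])
  also have "\<dots> = g (\<lambda>x. c a * b a x) v + g (\<Sum>i\<in>A. (\<lambda>x. c i * b i x)) v"
    by (rule add_left[OF scale_mem[OF bE(1)] comb_mem[OF bE(2)] assms(1)])
  also have "\<dots> = c a * g (b a) v + (\<Sum>i\<in>A. c i * g (b i) v)"
    by (simp only: scale_left[OF bE(1) assms(1)] insert.IH[OF bE(2)])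
  finally show ?case by (simp only: sum.insert[OF insert.hyps])
qed (simp_all add: zero_left assms(1))

lemma comb_right:
  assumes "v \<in> E" "\<And>i. i \<in> A \<Longrightarrow> b i \<in> E"
  shows "g v (\<Sum>i\<in>A. (\<lambda>x. c i * b i x)) = (\<Sum>i\<in>A. c i * g v (b i))"
proof -
  have "g v (\<Sum>i\<in>A. (\<lambda>x. c i * b i x)) = g (\<Sum>i\<in>A. (\<lambda>x. c i * b i x)) v"
    by (rule sym[OF assms(1) comb_mem[OF assms(2)]])
  also have "\<dots> = (\<Sum>i\<in>A. c i * g (b i) v)" by (rule comb_left[OF assms(1)]) (rule assms(2))
  also have "\<dots> = (\<Sum>i\<in>A. c i * g v (b i))"
    by (intro sum.cong refl) (simp only: sym[OF assms(1) assms(2)])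
  finally show ?thesis .
qed

text \<open>One Gram-Schmidt step per vector: \<open>e\<close> is the part of \<open>a\<close>
  orthogonal to the span of \<open>A\<close>, and the projection of \<open>u\<close> is corrected by
  the component along \<open>e\<close>.\<close>

lemma projection_exists:
  assumes "finite A" "A \<subseteq> E" "u \<in> E"
  shows "\<exists>p\<in>fun_space.span A. \<forall>v\<in>fun_space.span A. g (u - p) v = 0"
  using assms
proof (induction A arbitrary: u rule: finite_induct)
  case empty
  have "g (u - 0) 0 = 0" using sym[OF empty(2) zero_mem] zero_left[OF empty(2)] by (simp only: diff_zero)
  then show ?case unfolding fun_space.span_empty by blast
next
  case (insert a A)
  have aE: "a \<in> E" and AE: "A \<subseteq> E" using insert.prems by auto
  have sE: "fun_space.span A \<subseteq> E" "fun_space.span (insert a A) \<subseteq> E"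
    using span_mem AE insert.prems(1) by auto
  have mono: "v \<in> fun_space.span (insert a A)" if "v \<in> fun_space.span A" for v
    by (rule subsetD[OF fun_space.span_mono[OF subset_insertI] that])
  obtain q where q: "q \<in> fun_space.span A" "\<And>v. v \<in> fun_space.span A \<Longrightarrow> g (a - q) v = 0"
    using insert.IH[OF AE aE] by blast
  obtain p where p: "p \<in> fun_space.span A" "\<And>v. v \<in> fun_space.span A \<Longrightarrow> g (u - p) v = 0"
    using insert.IH[OF AE insert.prems(2)] by blast
  have qE: "q \<in> E" "p \<in> E" using q p sE by auto
  define e where "e = a - q"
  have eE: "e \<in> E" unfolding e_def using aE qE diff_mem by blast
  have as: "a \<in> fun_space.span (insert a A)" by (rule fun_space.span_base) simp
  have es: "e \<in> fun_space.span (insert a A)"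
    unfolding e_def by (rule fun_space.span_diff[OF as mono[OF q(1)]])
  define c where "c = g (u - p) e / g e e"
  define r where "r = p + (\<lambda>x. c * e x)"
  have rs: "r \<in> fun_space.span (insert a A)"
    unfolding r_def by (intro fun_space.span_add fun_space.span_scale mono p(1) es)
  have rE: "r \<in> E" using rs sE by blast
  have ur: "u - r = (u - p) - (\<lambda>x. c * e x)" unfolding r_def by (auto simp: fun_eq_iff)
  have upE: "u - p \<in> E" using diff_mem[OF insert.prems(2) qE(2)] .
  have gur: "g (u - r) v = g (u - p) v - c * g e v" if "v \<in> E" for v
    unfolding ur by (simp add: diff_left[OF upE scale_mem[OF eE] that] scale_left[OF eE that])
  have "g (u - r) v = 0" if v: "v \<in> fun_space.span (insert a A)" for v
  proof -
    obtain k where k: "v - (\<lambda>x. k * a x) \<in> fun_space.span A"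
      using fun_space.span_breakdown_eq[of v a A] v by blast
    define z where "z = v - (\<lambda>x. k * a x) + (\<lambda>x. k * q x)"
    have z: "z \<in> fun_space.span A" unfolding z_def by (intro fun_space.span_add fun_space.span_scale k q(1))
    have zE: "z \<in> E" using z sE by blast
    have vz: "v = z + (\<lambda>x. k * e x)" unfolding z_def e_def by (auto simp: fun_eq_iff algebra_simps)
    have urE: "u - r \<in> E" using diff_mem[OF insert.prems(2) rE] .
    have "g (u - r) v = g (u - r) z + k * g (u - r) e"
      unfolding vz using sym[OF urE] add_left[OF zE scale_mem[OF eE] urE] scale_left[OF eE urE] add_mem zE eE scale_mem
      by metis
    moreover have "g (u - r) z = 0" using gur[OF zE] p(2)[OF z] q(2)[OF z] by (simp add: e_def)
    moreover have "g (u - r) e = 0"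
    proof (cases "e = 0")
      case True
      then show ?thesis using sym[OF urE zero_mem] zero_left[OF urE] by simp
    next
      case False
      then show ?thesis using gur[OF eE] pos[OF eE False] by (simp add: c_def)
    qed
    ultimately show ?thesis by simp
  qed
  then show ?case using rs by blast
qed

text \<open>Pythagoras: \<open>p - q\<close> lies in the span and is orthogonal to
  \<open>u - p\<close>.\<close>

lemma projection_minimal:
  assumes A: "A \<subseteq> E" and u: "u \<in> E" and p: "p \<in> fun_space.span A"
    and orth: "\<And>v. v \<in> fun_space.span A \<Longrightarrow> g (u - p) v = 0" and q: "q \<in> fun_space.span A"
  shows "g (u - p) (u - p) \<le> g (u - q) (u - q)"
proof -
  have pE: "p \<in> E" "q \<in> E" using p q span_mem[OF A] by auto
  define a where "a = u - p"
  define b where "b = p - q"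
  have aE: "a \<in> E" "b \<in> E" unfolding a_def b_def using diff_mem u pE by auto
  have "g a b = 0" unfolding a_def b_def by (rule orth[OF fun_space.span_diff[OF p q]])
  moreover have "u - q = a + b" by (simp add: a_def b_def)
  moreover have "g (a + b) (a + b) = g a a + g a b + g b a + g b b"
    using add_left[OF aE add_mem[OF aE]] sym[OF add_mem[OF aE] aE(1)] sym[OF add_mem[OF aE] aE(2)]
      add_left[OF aE aE(1)] add_left[OF aE aE(2)] sym[OF aE] by simp
  ultimately have "g (u - q) (u - q) = g a a + g b b" using sym[OF aE] by simp
  then show ?thesis using nonneg[OF aE(2)] by (simp add: a_def)
qed

end

definition gram :: "(('a \<Rightarrow> real) \<Rightarrow> ('a \<Rightarrow> real) \<Rightarrow> real) \<Rightarrow> nat \<Rightarrow> (nat \<Rightarrow> 'a \<Rightarrow> real) \<Rightarrow> real mat" where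
  "gram g n b = mat n n (\<lambda>(i, k). g (b i) (b k))"

lemma gram_carrier [simp]: "gram g n b \<in> carrier_mat n n" by (simp add: gram_def)

context weighted_form
begin

lemma gram_change_basis:
  fixes n :: nat
  assumes b: "\<And>i. i < n \<Longrightarrow> b i \<in> E"
    and e: "\<And>k. k < n \<Longrightarrow> e k = (\<Sum>i<n. (\<lambda>x. S $$ (i, k) * b i x))" and S: "S \<in> carrier_mat n n"
  shows "gram g n e = transpose_mat S * gram g n b * S"
proof (rule eq_matI)
  fix i k assume "i < dim_row (transpose_mat S * gram g n b * S)" "k < dim_col (transpose_mat S * gram g n b * S)"
  then have ik: "i < n" "k < n" using S by (auto simp: gram_def)
  have bE: "\<And>j. j \<in> {..<n} \<Longrightarrow> b j \<in> E" using b by simp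
  have eE: "e k \<in> E" if "k < n" for k unfolding e[OF that] by (rule comb_mem[OF bE])
  have "g (e i) (e k) = (\<Sum>p<n. S $$ (p, i) * (\<Sum>q<n. S $$ (q, k) * g (b p) (b q)))"
  proof -
    have "g (e i) (e k) = (\<Sum>p<n. S $$ (p, i) * g (b p) (e k))"
      unfolding e[OF ik(1)] by (rule comb_left[OF eE[OF ik(2)]]) (rule bE)
    also have "g (b p) (e k) = (\<Sum>q<n. S $$ (q, k) * g (b p) (b q))" if "p < n" for p
      unfolding e[OF ik(2)] by (rule comb_right[OF b[OF that]]) (rule bE)
    then have "(\<Sum>p<n. S $$ (p, i) * g (b p) (e k)) = (\<Sum>p<n. S $$ (p, i) * (\<Sum>q<n. S $$ (q, k) * g (b p) (b q)))"
      by simp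
    finally show ?thesis .
  qed
  also have "\<dots> = (transpose_mat S * gram g n b * S) $$ (i, k)"
    using ik S by (simp add: gram_def scalar_prod_def sum_distrib_left sum_distrib_right
      lessThan_atLeast0 mult_ac) (subst sum.swap, intro sum.cong refl, simp add: mult_ac)
  finally show "gram g n e $$ (i, k) = (transpose_mat S * gram g n b * S) $$ (i, k)"
    using ik by (simp add: gram_def)
qed (use S in \<open>auto simp: gram_def\<close>)

lemma det_gram_change_basis:
  fixes n :: nat
  assumes "\<And>i. i < n \<Longrightarrow> b i \<in> E"
    and "\<And>k. k < n \<Longrightarrow> e k = (\<Sum>i<n. (\<lambda>x. S $$ (i, k) * b i x))" and S: "S \<in> carrier_mat n n"
  shows "det (gram g n e) = (det S)\<^sup>2 * det (gram g n b)"
proof -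
  have "det (gram g n e) = det (transpose_mat S) * det (gram g n b) * det S"
  proof -
    have T: "transpose_mat S \<in> carrier_mat n n" using S by simp
    have "det (gram g n e) = det (transpose_mat S * gram g n b * S)"
      by (rule arg_cong[where f = det], rule gram_change_basis[OF _ _ S]) (use assms in auto)
    also have "\<dots> = det (transpose_mat S * gram g n b) * det S"
      by (rule det_mult[OF mult_carrier_mat[OF T gram_carrier] S])
    also have "det (transpose_mat S * gram g n b) = det (transpose_mat S) * det (gram g n b)"
      by (rule det_mult[OF T gram_carrier])
    finally show ?thesis .
  qed
  then show ?thesis using det_transpose[OF S] by (simp add: power2_eq_square)
qed

text \<open>\<open>p\<close> lists the projections of the basis vectors to the span of their predecessors.\<close>

lemma det_gram_product:
  fixes n :: nat
  assumes b: "\<And>i. i < n \<Longrightarrow> b i \<in> E"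
    and p: "\<And>k. k < n \<Longrightarrow> p k \<in> fun_space.span (b ` {..<k})"
    and orth: "\<And>k v. k < n \<Longrightarrow> v \<in> fun_space.span (b ` {..<k}) \<Longrightarrow> g (b k - p k) v = 0"
    and inj: "inj_on b {..<n}" and ind: "fun_space.independent (b ` {..<n})"
  shows "det (gram g n b) = (\<Prod>k<n. g (b k - p k) (b k - p k))"
proof -
  have ex: "\<exists>c. p k = (\<Sum>i<k. (\<lambda>x. c i * b i x))" if k: "k < n" for k
  proof -
    have inj': "inj_on b {..<k}" using inj_on_subset[OF inj] k by auto
    obtain r where "p k = (\<Sum>a\<in>b ` {..<k}. (\<lambda>x. r a * a x))"
      using p[OF k] fun_space.span_finite[of "b ` {..<k}"] by auto
    then have "p k = (\<Sum>i<k. (\<lambda>x. r (b i) * b i x))" by (simp add: sum.reindex[OF inj'])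
    then show ?thesis by (rule exI[of _ "\<lambda>i. r (b i)"])
  qed
  then obtain c where c: "\<And>k. k < n \<Longrightarrow> p k = (\<Sum>i<k. (\<lambda>x. c k i * b i x))" by metis
  \<comment> \<open>The residuals arise from \<open>b\<close> by a triangular matrix with unit
    diagonal, which leaves the Gram determinant unchanged, and the Gram matrix of the residuals is
    diagonal.\<close>
  define S where "S = mat n n (\<lambda>(i, k). if i < k then - c k i else if i = k then 1 else 0)"
  define e where "e k = b k - p k" for k
  have S: "S \<in> carrier_mat n n" by (simp add: S_def)
  have e: "e k = (\<Sum>i<n. (\<lambda>x. S $$ (i, k) * b i x))" if k: "k < n" for k
  proof
    fix x
    have app: "(\<Sum>i\<in>A. (\<lambda>x. f i * b i x)) x = (\<Sum>i\<in>A. f i * b i x)" for f and A :: "nat set"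
      by (induction A rule: infinite_finite_induct) auto
    have "(\<Sum>i<n. (\<lambda>x. S $$ (i, k) * b i x)) x = (\<Sum>i<n. (if i < k then - c k i else if i = k then 1 else 0) * b i x)"
      unfolding app using k by (intro sum.cong) (auto simp: S_def)
    also have "\<dots> = (\<Sum>i<Suc k. (if i < k then - c k i else if i = k then 1 else 0) * b i x)"
      using k by (intro sum.mono_neutral_right) auto
    also have "\<dots> = b k x - (\<Sum>i<k. c k i * b i x)" by (simp add: sum_negf)
    finally show "e k x = (\<Sum>i<n. (\<lambda>x. S $$ (i, k) * b i x)) x" unfolding e_def by (simp add: c[OF k] app)
  qed
  have bE: "b ` {..<n} \<subseteq> E" using b by auto
  have pE: "p k \<in> E" if "k < n" for k
    using p[OF that] span_mem[of "b ` {..<k}"] b that by fastforce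
  have eE: "e k \<in> E" if "k < n" for k unfolding e_def by (rule diff_mem[OF b[OF that] pE[OF that]])
  have es: "e k \<in> fun_space.span (b ` {..<m})" if "k < m" "m \<le> n" for k m
  proof -
    have "b ` {..<k} \<subseteq> b ` {..<m}" using that by auto
    have kn: "k < n" using that by simp
    have "p k \<in> fun_space.span (b ` {..<m})" by (rule subsetD[OF fun_space.span_mono[OF \<open>b ` {..<k} \<subseteq> b ` {..<m}\<close>] p[OF kn]])
    moreover have "b k \<in> fun_space.span (b ` {..<m})" using that by (intro fun_space.span_base) auto
    ultimately show ?thesis unfolding e_def by (intro fun_space.span_diff)
  qed
  have off: "g (e i) (e k) = 0" if "i < n" "k < n" "i \<noteq> k" for i k
  proof (cases "i < k")
    case True
    have "g (e k) (e i) = 0" unfolding e_def[of k] by (rule orth[OF that(2) es]) (use True that in auto)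
    then show ?thesis using sym[OF eE eE] that by simp
  next
    case False
    then show ?thesis unfolding e_def[of i] by (intro orth[OF that(1) es]) (use that in auto)
  qed
  have "det S = 1"
  proof -
    have "upper_triangular S" by (auto simp: S_def upper_triangular_def)
    then have "det S = prod_list (diag_mat S)" by (rule det_upper_triangular[OF _ S])
    also have "diag_mat S = map (\<lambda>i. 1) [0..<n]" by (auto simp: diag_mat_def S_def)
    finally show ?thesis by (simp add: prod_list_replicate map_replicate_const)
  qed
  moreover have "det (gram g n e) = (\<Prod>k<n. g (e k) (e k))"
  proof -
    have "upper_triangular (gram g n e)" using off by (auto simp: gram_def upper_triangular_def)
    then have "det (gram g n e) = prod_list (diag_mat (gram g n e))" by (rule det_upper_triangular[OF _ gram_carrier])
    also have "\<dots> = (\<Prod>k<n. g (e k) (e k))"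
      by (simp add: prod_list_diag_prod gram_def lessThan_atLeast0)
    finally show ?thesis .
  qed
  ultimately show ?thesis using det_gram_change_basis[OF b e S] by (simp add: e_def)
qed

lemma projections_exist:
  fixes n :: nat
  assumes b: "\<And>i. i < n \<Longrightarrow> b i \<in> E"
  shows "\<exists>p. \<forall>k<n. p k \<in> fun_space.span (b ` {..<k}) \<and>
    (\<forall>v\<in>fun_space.span (b ` {..<k}). g (b k - p k) v = 0)"
proof -
  have "\<exists>q. q \<in> fun_space.span (b ` {..<k}) \<and> (\<forall>v\<in>fun_space.span (b ` {..<k}). g (b k - q) v = 0)"
    if "k < n" for k
  proof -
    have bs: "b ` {..<k} \<subseteq> E" using b that by force
    show ?thesis using projection_exists[OF _ bs b[OF that]] by blast
  qed
  then show ?thesis by (intro choice allI) blast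
qed

lemma residual_pos:
  fixes n :: nat
  assumes b: "\<And>i. i < n \<Longrightarrow> b i \<in> E" and k: "k < n"
    and inj: "inj_on b {..<n}" and ind: "fun_space.independent (b ` {..<n})"
    and p: "p \<in> fun_space.span (b ` {..<k})"
  shows "g (b k - p) (b k - p) > 0"
proof (rule pos)
  have "b ` {..<k} \<subseteq> E" using b k by auto
  then have "p \<in> E" using span_mem p by blast
  then show "b k - p \<in> E" using diff_mem b k by blast
  show "b k - p \<noteq> 0"
  proof
    assume "b k - p = 0"
    then have "b k \<in> fun_space.span (b ` {..<k})" using p by simp
    moreover have "b ` {..<k} \<subseteq> b ` {..<n} - {b k}" 
    proof
      fix y assume "y \<in> b ` {..<k}"
      then obtain i where i: "i < k" "y = b i" by blast
      then have "b i \<noteq> b k" using inj_onD[OF inj, of i k] k by auto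
      then show "y \<in> b ` {..<n} - {b k}" using i k by auto
    qed
    ultimately have "b k \<in> fun_space.span (b ` {..<n} - {b k})" using fun_space.span_mono by blast
    then show False using ind k unfolding fun_space.dependent_def by blast
  qed
qed

lemma det_gram_pos:
  fixes n :: nat
  assumes b: "\<And>i. i < n \<Longrightarrow> b i \<in> E" and "inj_on b {..<n}" "fun_space.independent (b ` {..<n})"
  shows "det (gram g n b) > 0"
proof -
  obtain p where "\<forall>k<n. p k \<in> fun_space.span (b ` {..<k}) \<and>
      (\<forall>v\<in>fun_space.span (b ` {..<k}). g (b k - p k) v = 0)"
    using projections_exist[of n b] b by blast
  then have p: "\<And>k. k < n \<Longrightarrow> p k \<in> fun_space.span (b ` {..<k})"
    "\<And>k v. k < n \<Longrightarrow> v \<in> fun_space.span (b ` {..<k}) \<Longrightarrow> g (b k - p k) v = 0"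
    by blast+
  have "det (gram g n b) = (\<Prod>k<n. g (b k - p k) (b k - p k))"
    by (rule det_gram_product[OF _ _ _ assms(2,3)]) (use b p in auto)
  also have "\<dots> > 0"
  proof (intro prod_pos ballI)
    fix k assume "k \<in> {..<n}"
    then have "k < n" by simp
    show "g (b k - p k) (b k - p k) > 0" by (rule residual_pos[OF b \<open>k < n\<close> assms(2,3) p(1)[OF \<open>k < n\<close>]])
  qed
  finally show ?thesis .
qed

end

text \<open>For a basis vector \<open>b k\<close> carried by a cell, \<open>q\<close> will be the restriction of \<open>v\<close> to that cell,
  on which the weight is nearly constant.\<close>

lemma det_gram_ratio:
  fixes n :: nat
  assumes F: "weighted_form E g" and H: "weighted_form E h"
    and b: "\<And>i. i < n \<Longrightarrow> b i \<in> E"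
    and inj: "inj_on b {..<n}" and ind: "fun_space.independent (b ` {..<n})"
    and R1: "\<And>k v. k < n \<Longrightarrow> v \<in> fun_space.span (b ` {..<k}) \<Longrightarrow>
      \<exists>q\<in>fun_space.span (b ` {..<k}). g (b k - q) (b k - q) \<le> C k * h (b k - v) (b k - v)"
    and R2: "\<And>k v. k < n \<Longrightarrow> v \<in> fun_space.span (b ` {..<k}) \<Longrightarrow>
      \<exists>q\<in>fun_space.span (b ` {..<k}). c k * h (b k - q) (b k - q) \<le> g (b k - v) (b k - v)"
    and c: "\<And>k. k < n \<Longrightarrow> c k > 0"
  shows "(\<Prod>k<n. c k) \<le> det (gram g n b) / det (gram h n b)"
    and "det (gram g n b) / det (gram h n b) \<le> (\<Prod>k<n. C k)"
proof -
  interpret F: weighted_form E g by (rule F)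
  interpret H: weighted_form E h by (rule H)
  obtain p where "\<forall>k<n. p k \<in> fun_space.span (b ` {..<k}) \<and>
      (\<forall>v\<in>fun_space.span (b ` {..<k}). g (b k - p k) v = 0)"
    using F.projections_exist[of n b] b by blast
  then have p: "\<And>k. k < n \<Longrightarrow> p k \<in> fun_space.span (b ` {..<k})"
    "\<And>k v. k < n \<Longrightarrow> v \<in> fun_space.span (b ` {..<k}) \<Longrightarrow> g (b k - p k) v = 0"
    by blast+
  obtain q where "\<forall>k<n. q k \<in> fun_space.span (b ` {..<k}) \<and>
      (\<forall>v\<in>fun_space.span (b ` {..<k}). h (b k - q k) v = 0)"
    using H.projections_exist[of n b] b by blast
  then have q: "\<And>k. k < n \<Longrightarrow> q k \<in> fun_space.span (b ` {..<k})"
    "\<And>k v. k < n \<Longrightarrow> v \<in> fun_space.span (b ` {..<k}) \<Longrightarrow> h (b k - q k) v = 0"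
    by blast+
  let ?r = "\<lambda>k. g (b k - p k) (b k - p k) / h (b k - q k) (b k - q k)"
  have bE: "b ` {..<k} \<subseteq> E" if "k < n" for k using b that by auto
  have hp: "h (b k - q k) (b k - q k) > 0" if "k < n" for k
    by (rule H.residual_pos[OF b that inj ind q(1)[OF that]])
  have gp: "g (b k - p k) (b k - p k) > 0" if "k < n" for k
    by (rule F.residual_pos[OF b that inj ind p(1)[OF that]])
  have eq: "det (gram g n b) / det (gram h n b) = (\<Prod>k<n. ?r k)"
  proof -
    have "det (gram g n b) = (\<Prod>k<n. g (b k - p k) (b k - p k))"
      by (rule F.det_gram_product[OF _ _ _ inj ind]) (use b p in auto)
    moreover have "det (gram h n b) = (\<Prod>k<n. h (b k - q k) (b k - q k))"
      by (rule H.det_gram_product[OF _ _ _ inj ind]) (use b q in auto)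
    ultimately show ?thesis by (simp only: prod_dividef)
  qed
  \<comment> \<open>The competitor supplied for the \<open>h\<close>-projection is compared with the
    \<open>g\<close>-projection, which is the minimiser; \<open>lo\<close> exchanges the roles of
    the forms.\<close>
  have up: "?r k \<le> C k" if k: "k < n" for k
  proof -
    obtain v where v: "v \<in> fun_space.span (b ` {..<k})" "g (b k - v) (b k - v) \<le> C k * h (b k - q k) (b k - q k)"
      using R1[OF k q(1)[OF k]] by blast
    have "g (b k - p k) (b k - p k) \<le> g (b k - v) (b k - v)"
      by (rule F.projection_minimal[OF bE[OF k] b[OF k] p(1)[OF k] p(2)[OF k] v(1)])
    then show ?thesis using v(2) hp[OF k] by (simp add: divide_le_eq)
  qed
  have lo: "c k \<le> ?r k" if k: "k < n" for k
  proof -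
    obtain v where v: "v \<in> fun_space.span (b ` {..<k})" "c k * h (b k - v) (b k - v) \<le> g (b k - p k) (b k - p k)"
      using R2[OF k p(1)[OF k]] by blast
    have "h (b k - q k) (b k - q k) \<le> h (b k - v) (b k - v)"
      by (rule H.projection_minimal[OF bE[OF k] b[OF k] q(1)[OF k] q(2)[OF k] v(1)])
    then have "c k * h (b k - q k) (b k - q k) \<le> g (b k - p k) (b k - p k)"
      using v(2) mult_left_mono[of _ _ "c k"] c[OF k] by (meson less_imp_le order_trans)
    then show ?thesis using hp[OF k] by (simp add: le_divide_eq)
  qed
  show "(\<Prod>k<n. c k) \<le> det (gram g n b) / det (gram h n b)"
    unfolding eq by (intro prod_mono) (use lo c in \<open>auto intro: less_imp_le\<close>)
  show "det (gram g n b) / det (gram h n b) \<le> (\<Prod>k<n. C k)"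
    unfolding eq by (intro prod_mono) (use up gp hp in \<open>auto intro!: divide_nonneg_nonneg intro: less_imp_le\<close>)
qed

text \<open>In the basis \<open>bs\<close>, the matrix \<open>M\<close> of \<open>T\<close>
  satisfies \<open>gram g = gram h * M\<close>. A change of basis multiplies both Gram determinants
  by the same square, so the quotient may be computed in any basis, in particular one adapted to the
  cells.\<close>

lemma det_representation:
  assumes H: "weighted_form E h" and F: "weighted_form E g"
    and bs: "distinct bs" "fun_space.independent (set bs)" "fun_space.span (set bs) = E"
    and es: "distinct es" "fun_space.independent (set es)" "fun_space.span (set es) = E"
    and T: "\<And>u. u \<in> E \<Longrightarrow> T u \<in> E" "\<And>u v. u \<in> E \<Longrightarrow> v \<in> E \<Longrightarrow> h (T u) v = g u v"
  shows "det (mat (length bs) (length bs) (\<lambda>(i, k). fun_space.representation (set bs) (T (bs ! k)) (bs ! i)))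
    = det (gram g (length es) ((!) es)) / det (gram h (length es) ((!) es))"
proof -
  interpret F: weighted_form E g by (rule F)
  interpret H: weighted_form E h by (rule H)
  define n where "n = length bs"
  have n: "length es = n"
  proof -
    have "fun_space.dim E = card (set bs)" "fun_space.dim E = card (set es)"
      using fun_space.dim_span_eq_card_independent[OF bs(2)] fun_space.dim_span_eq_card_independent[OF es(2)]
      unfolding bs(3) es(3) by simp_all
    then show ?thesis using distinct_card[OF bs(1)] distinct_card[OF es(1)] by (simp add: n_def)
  qed
  let ?b = "(!) bs" and ?e = "(!) es"
  have setb: "set bs = ?b ` {..<n}" by (auto simp: set_conv_nth n_def)
  have injb: "inj_on ?b {..<n}" using bs(1) by (auto simp: inj_on_def nth_eq_iff_index_eq n_def)
  have sete: "set es = ?e ` {..<n}" by (auto simp: set_conv_nth n[symmetric])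
  have inje: "inj_on ?e {..<n}" using es(1) by (auto simp: inj_on_def nth_eq_iff_index_eq n[symmetric])
  have bE: "bs ! i \<in> E" if "i < n" for i
    using fun_space.span_base[of "bs ! i" "set bs"] that unfolding bs(3) n_def by simp
  have eE: "es ! i \<in> E" if "i < n" for i
    using fun_space.span_base[of "es ! i" "set es"] that unfolding es(3) n[symmetric] by simp
  let ?rep = "fun_space.representation (set bs)"
  have rep: "v = (\<Sum>i<n. (\<lambda>x. ?rep v (bs ! i) * (bs ! i) x))" if v: "v \<in> E" for v
  proof -
    have "(\<Sum>a\<in>set bs. (\<lambda>x. ?rep v a * a x)) = v"
      by (rule fun_space.sum_representation_eq[OF bs(2)]) (use v bs(3) in auto)
    then show ?thesis unfolding setb by (simp add: sum.reindex[OF injb])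
  qed
  define M where "M = mat n n (\<lambda>(i, k). ?rep (T (bs ! k)) (bs ! i))"
  define S where "S = mat n n (\<lambda>(i, k). ?rep (es ! k) (bs ! i))"
  have c: "M \<in> carrier_mat n n" "S \<in> carrier_mat n n" by (simp_all add: M_def S_def)
  have "gram g n ?b = gram h n ?b * M"
  proof (rule eq_matI)
    fix i k assume "i < dim_row (gram h n ?b * M)" "k < dim_col (gram h n ?b * M)"
    then have ik: "i < n" "k < n" using c by (auto simp: gram_def)
    have "g (bs ! i) (bs ! k) = h (T (bs ! k)) (bs ! i)"
      using T(2)[OF bE[OF ik(2)] bE[OF ik(1)]] F.sym[OF bE[OF ik(1)] bE[OF ik(2)]] by simp
    also have "\<dots> = h (bs ! i) (T (bs ! k))" by (rule H.sym[OF T(1)[OF bE[OF ik(2)]] bE[OF ik(1)]])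
    also have "\<dots> = (\<Sum>j<n. ?rep (T (bs ! k)) (bs ! j) * h (bs ! i) (bs ! j))"
      by (subst rep[OF T(1)[OF bE[OF ik(2)]]], rule H.comb_right[OF bE[OF ik(1)]]) (use bE in simp)
    also have "\<dots> = (gram h n ?b * M) $$ (i, k)"
      using ik by (simp add: gram_def M_def scalar_prod_def lessThan_atLeast0 mult.commute)
    finally show "gram g n ?b $$ (i, k) = (gram h n ?b * M) $$ (i, k)" using ik by (simp add: gram_def)
  qed (use c in \<open>auto simp: gram_def\<close>)
  then have 1: "det (gram g n ?b) = det (gram h n ?b) * det M" using det_mult[of "gram h n ?b" n M] c by simp
  have e: "es ! k = (\<Sum>i<n. (\<lambda>x. S $$ (i, k) * (bs ! i) x))" if k: "k < n" for k
    by (subst rep[OF eE[OF k]]) (use k in \<open>simp add: S_def\<close>)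
  note G = F.det_gram_change_basis[OF bE e c(2)] H.det_gram_change_basis[OF bE e c(2)]
  have "det (gram h n ?e) > 0" by (rule H.det_gram_pos[OF eE inje]) (use es(2) sete in simp_all)
  then have "det (gram g n ?e) / det (gram h n ?e) = det M" using G 1 by (auto simp: field_simps)
  then show ?thesis unfolding M_def n by (simp add: n_def)
qed

section \<open>Spectral decimation\<close>

text \<open>The extension rule of spectral decimation: for \<open>k \<noteq> i\<close>, the value at
  the midpoint of the corners \<open>i\<close> and \<open>k\<close> that solves the level-1
  eigenvalue equations for \<open>g\<close>. The third index is \<open>6 - i - k\<close> because the
  three add up to 6.\<close>

definition sub_data :: "real \<Rightarrow> nat \<Rightarrow> (nat \<Rightarrow> real) \<Rightarrow> nat \<Rightarrow> real" where
  "sub_data g i d k = (if k = i then d i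
     else ((4 - g) * (d i + d k) + 2 * d (6 - i - k)) / ((5 - g) * (2 - g)))"

lemma third_eq:
  assumes "{i, a, b} = {1,2,3::nat}" "i \<noteq> a" "i \<noteq> b" "a \<noteq> b"
  shows "b = 6 - i - a"
proof -
  note I = index_sets[OF assms]
  have "i + a + b = \<Sum>{i, a, b}" using assms(2-4) by simp
  also have "\<dots> = 6" unfolding assms(1) by simp
  finally show ?thesis by simp
qed

lemma sub_data_sym: "sub_data g i d k = sub_data g k d i"
  by (auto simp: sub_data_def add.commute diff_right_commute)

lemma sub_data_self [simp]: "sub_data g i d i = d i"
  by (simp add: sub_data_def)

lemma sub_data_other:
  assumes "{i, a, b} = {1,2,3::nat}" "i \<noteq> a" "i \<noteq> b" "a \<noteq> b"
  shows "sub_data g i d a = ((4 - g) * (d i + d a) + 2 * d b) / ((5 - g) * (2 - g))"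
  unfolding sub_data_def using assms(2) third_eq[OF assms] by simp

lemma add_fractions_eq:
  fixes D :: real
  assumes "D \<noteq> 0" "D * x + D * y + p + q = c * r"
  shows "x + p / D + (y + q / D) = c * (r / D)"
proof -
  have "x + p / D + (y + q / D) = (D * x + D * y + p + q) / D"
    using assms(1) by (simp add: add_divide_distrib)
  then show ?thesis unfolding assms(2) by simp
qed

text \<open>The quadratic relation inverts the recursion for \<open>\<gamma>\<close>. The
  denominator in \<open>sub_data\<close> vanishes at 2 and 5; these are excluded only beyond
  \<open>j\<close>, since the series may start with the value 5. From \<open>K\<close> on the values
  are small enough for the subdivision to contract.\<close>

locale spectral_decimation =
  fixes \<gamma> :: "nat \<Rightarrow> real" and j K :: nat
  assumes rec: "\<And>k. k \<ge> j \<Longrightarrow> \<gamma> k = \<gamma> (Suc k) * (5 - \<gamma> (Suc k))"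
    and nz: "\<And>k. k \<ge> j \<Longrightarrow> \<gamma> (Suc k) \<noteq> 5" "\<And>k. k \<ge> j \<Longrightarrow> \<gamma> (Suc k) \<noteq> 2"
    and pos: "\<And>k. k \<ge> j \<Longrightarrow> \<gamma> k > 0"
    and small: "\<And>k. k \<ge> K \<Longrightarrow> \<gamma> k \<le> 1/2" and jK: "j \<le> K"
begin

text \<open>Subdivide \<open>n\<close> times by the extension rule, then interpolate affinely. The
  index \<open>k\<close> tells which eigenvalue the next subdivision uses.\<close>

primrec approx :: "nat \<Rightarrow> nat \<Rightarrow> (nat \<Rightarrow> real) \<Rightarrow> point \<Rightarrow> real" where
  "approx 0 k d = (\<lambda>x. \<Sum>i\<in>{1,2,3}. d i * bary i x)"
| "approx (Suc n) k d = glue (\<lambda>i. approx n (Suc k) (sub_data (\<gamma> (Suc k)) i d))"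

lemma approx_corner: "i \<in> {1,2,3} \<Longrightarrow> approx n k d (corner i) = d i"
proof (induction n arbitrary: k d i)
  case 0
  have "approx 0 k d (corner i) = (\<Sum>p\<in>{1,2,3}. if p = i then d i else 0)"
    unfolding approx.simps by (intro sum.cong refl) (use bary_corner[OF 0] in auto)
  also have "\<dots> = d i" using 0 by simp
  finally show ?case .
next
  case (Suc n)
  let ?v = "\<lambda>i. approx n (Suc k) (sub_data (\<gamma> (Suc k)) i d)"
  have c: "compatible ?v" unfolding compatible_def using Suc.IH sub_data_sym by simp
  have "glue ?v (sg_map i (corner i)) = ?v i (corner i)" by (rule glue_map[OF c Suc.prems corner_SG[OF Suc.prems]])
  then show ?case unfolding approx.simps(2) sg_map_fixed using Suc.IH[OF Suc.prems] by simp
qed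

lemma approx_compatible: "compatible (\<lambda>i. approx n k (sub_data g i d))"
  unfolding compatible_def using approx_corner sub_data_sym by simp

lemma approx_map:
  "\<lbrakk>i \<in> {1,2,3}; y \<in> SG\<rbrakk> \<Longrightarrow> approx (Suc n) k d (sg_map i y) = approx n (Suc k) (sub_data (\<gamma> (Suc k)) i d) y"
  unfolding approx.simps(2) by (rule glue_map[OF approx_compatible])

lemma continuous_on_approx: "continuous_on SG (approx n k d)"
proof (induction n arbitrary: k d)
  case 0
  then show ?case unfolding approx.simps by (intro continuous_intros continuous_on_bary)
next
  case (Suc n)
  then show ?case unfolding approx.simps(2) by (intro continuous_on_glue[OF approx_compatible])
qed

text \<open>\<^term>\<open>data_bound k p d\<close>: the corner data \<^term>\<open>d\<close> has size \<open>s\<close> and oscillation \<open>t\<close> with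
  \<open>t + \<gamma> k s \<le> p\<close>. This quantity contracts by \<open>12/13\<close> under subdivision once \<open>\<gamma> \<le> 1/2\<close>.\<close>

definition data_bound :: "nat \<Rightarrow> real \<Rightarrow> (nat \<Rightarrow> real) \<Rightarrow> bool" where
  "data_bound k p d \<longleftrightarrow> (\<exists>s t. (\<forall>i\<in>{1,2,3}. \<bar>d i\<bar> \<le> s) \<and> (\<forall>i\<in>{1,2,3}. \<forall>l\<in>{1,2,3}. \<bar>d i - d l\<bar> \<le> t) \<and> t + \<gamma> k * s \<le> p)"

lemma data_bound_exists: assumes "k \<ge> K" shows "\<exists>p\<ge>0. data_bound k p d"
proof -
  define s where "s = Max ((\<lambda>i. \<bar>d i\<bar>) ` {1,2,3::nat})"
  have s: "\<bar>d i\<bar> \<le> s" if "i \<in> {1,2,3}" for i unfolding s_def using that by (intro Max_ge) auto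
  have s0: "s \<ge> 0" using s[of 1] by simp
  have g: "\<gamma> k > 0" using pos[of k] assms jK by simp
  have "\<bar>d i - d l\<bar> \<le> 2 * s" if "i \<in> {1,2,3}" "l \<in> {1,2,3}" for i l
    using s[OF that(1)] s[OF that(2)] by linarith
  then have "data_bound k (2 * s + \<gamma> k * s) d" unfolding data_bound_def using s by blast
  moreover have "2 * s + \<gamma> k * s \<ge> 0" using s0 g by simp
  ultimately show ?thesis by blast
qed

lemma sub_data_estimates:
  assumes k: "k \<ge> K" and s: "\<And>i. i \<in> {1,2,3} \<Longrightarrow> \<bar>d i\<bar> \<le> s"
    and t: "\<And>i l. i \<in> {1,2,3} \<Longrightarrow> l \<in> {1,2,3} \<Longrightarrow> \<bar>d i - d l\<bar> \<le> t"
    and I: "{i, a, b} = {1,2,3::nat}" "i \<noteq> a" "i \<noteq> b" "a \<noteq> b"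
  defines "g \<equiv> \<gamma> (Suc k)"
  shows "\<bar>sub_data g i d a\<bar> \<le> 4/3 * s"
    and "\<bar>d i - sub_data g i d a\<bar> \<le> 12/13 * t + 2/3 * g * s"
    and "\<bar>sub_data g i d a - sub_data g i d b\<bar> \<le> 12/13 * t"
proof -
  note J = index_sets[OF I]
  have g: "0 < g" "g \<le> 1/2" using pos[of "Suc k"] small[of "Suc k"] k jK by (auto simp: g_def)
  define D where "D = (5 - g) * (2 - g)"
  \<comment> \<open>The square is dropped and \<open>7 * g \<le> 7/2\<close> is used. The
    differences have coefficients \<open>(4 - g) + 2 \<le> 6\<close>, and
    \<open>6 / (13/2) = 12/13\<close> is the contraction factor.\<close>
  have D: "D \<ge> 13/2"
  proof -
    have "D = 10 - 7 * g + g * g" by (simp add: D_def algebra_simps)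
    moreover have "g * g \<ge> 0" by simp
    ultimately show ?thesis using g by linarith
  qed
  have I2: "{i, b, a} = {1,2,3}" using I(1) by auto
  have ea: "sub_data g i d a = ((4 - g) * (d i + d a) + 2 * d b) / D" unfolding D_def by (rule sub_data_other[OF I])
  have eb: "sub_data g i d b = ((4 - g) * (d i + d b) + 2 * d a) / D"
    unfolding D_def by (rule sub_data_other[OF I2 I(3,2) I(4)[symmetric]])
  have s0: "s \<ge> 0" using s[OF J(1)] by linarith
  have t0: "t \<ge> 0" using t[OF J(1,2)] by linarith
  have "\<bar>(4 - g) * (d i + d a) + 2 * d b\<bar> \<le> (4 - g) * (2 * s) + 2 * s"
  proof -
    have "\<bar>(4 - g) * (d i + d a)\<bar> \<le> (4 - g) * (2 * s)"
      unfolding abs_mult using g s[OF J(1)] s[OF J(2)] by (intro mult_mono) auto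
    then show ?thesis using s[OF J(3)] by linarith
  qed
  also have "\<dots> = (2 * (5 - g)) * s" by (simp add: algebra_simps)
  \<comment> \<open>After division by \<open>D\<close> the factor is \<open>2 / (2 - g)\<close>, at
    most \<open>4/3\<close> for \<open>g \<le> 1/2\<close>.\<close>
  also have "\<dots> \<le> (4/3 * D) * s"
  proof (intro mult_right_mono s0)
    have "4/3 * D - 2 * (5 - g) = (5 - g) * (2 - 4 * g) / 3" by (simp add: D_def algebra_simps)
    also have "\<dots> \<ge> 0" using g by (intro divide_nonneg_nonneg mult_nonneg_nonneg) auto
    finally show "2 * (5 - g) \<le> 4/3 * D" by simp
  qed
  finally show "\<bar>sub_data g i d a\<bar> \<le> 4/3 * s" unfolding ea using D by (simp add: abs_divide divide_le_eq mult_ac)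
  have "d i - sub_data g i d a = ((4 - g) * (d i - d a) + 2 * (d i - d b) - g * (5 - g) * d i) / D"
    unfolding ea using D by (simp add: field_simps) (simp add: D_def algebra_simps)
  moreover have "\<bar>(4 - g) * (d i - d a) + 2 * (d i - d b) - g * (5 - g) * d i\<bar> \<le> (4 - g) * t + 2 * t + g * (5 - g) * s"
  proof -
    have "\<bar>(4 - g) * (d i - d a)\<bar> \<le> (4 - g) * t"
      unfolding abs_mult using g t[OF J(1,2)] by (intro mult_mono) auto
    moreover have "\<bar>2 * (d i - d b)\<bar> \<le> 2 * t" using t[OF J(1,3)] by simp
    moreover have "\<bar>g * (5 - g) * d i\<bar> \<le> g * (5 - g) * s"
      unfolding abs_mult[of "g * (5 - g)"] using g s[OF J(1)] by (intro mult_mono) auto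
    ultimately show ?thesis by linarith
  qed
  moreover have "(4 - g) * t + 2 * t + g * (5 - g) * s \<le> (12/13 * t + 2/3 * g * s) * D"
  proof -
    have "(6 - g) * t \<le> (12/13 * D) * t" using g D by (intro mult_right_mono t0) linarith
    moreover have "(5 - g) * (g * s) \<le> (2/3 * D) * (g * s)"
    proof (intro mult_right_mono)
      have "2/3 * D - (5 - g) = (5 - g) * (1 - 2 * g) / 3" by (simp add: D_def algebra_simps)
      also have "\<dots> \<ge> 0" using g by (intro divide_nonneg_nonneg mult_nonneg_nonneg) auto
      finally show "5 - g \<le> 2/3 * D" by simp
      show "0 \<le> g * s" using g s0 by simp
    qed
    ultimately show ?thesis by (simp add: algebra_simps)
  qed
  ultimately show "\<bar>d i - sub_data g i d a\<bar> \<le> 12/13 * t + 2/3 * g * s"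
    using D by (simp add: abs_divide divide_le_eq)
  have "sub_data g i d a - sub_data g i d b = ((2 - g) * (d a - d b)) / D"
    unfolding ea eb using D by (simp add: field_simps)
  moreover have "\<bar>(2 - g) * (d a - d b)\<bar> \<le> 2 * t"
    unfolding abs_mult using g t[OF J(2,3)] by (intro mult_mono) auto
  moreover have "2 * t \<le> 12/13 * t * D"
  proof -
    have "(12/13 * t) * (13/2) \<le> (12/13 * t) * D" using D t0 by (intro mult_left_mono) auto
    then show ?thesis using t0 by linarith
  qed
  ultimately have "sub_data g i d a - sub_data g i d b = ((2 - g) * (d a - d b)) / D"
    "\<bar>(2 - g) * (d a - d b)\<bar> \<le> 12/13 * t * D" by (simp_all only: order_trans)
  then show "\<bar>sub_data g i d a - sub_data g i d b\<bar> \<le> 12/13 * t"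
    using D by (simp only: abs_divide) (simp add: divide_le_eq)
qed

lemma gamma_ratio: assumes "k \<ge> K" shows "\<gamma> (Suc k) \<le> 2/9 * \<gamma> k"
proof -
  have g: "0 < \<gamma> (Suc k)" "\<gamma> (Suc k) \<le> 1/2" using pos[of "Suc k"] small[of "Suc k"] assms jK by auto
  have "\<gamma> (Suc k) * (9/2) \<le> \<gamma> (Suc k) * (5 - \<gamma> (Suc k))" using g by (intro mult_left_mono) auto
  then show ?thesis using rec[of k] assms jK by simp
qed

lemma data_bound_sub:
  assumes k: "k \<ge> K" and d: "data_bound k p d" and i: "i \<in> {1,2,3}"
  shows "data_bound (Suc k) (12/13 * p) (sub_data (\<gamma> (Suc k)) i d)"
proof -
  obtain s t where s: "\<And>i. i \<in> {1,2,3} \<Longrightarrow> \<bar>d i\<bar> \<le> s"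
    and t: "\<And>i l. i \<in> {1,2,3} \<Longrightarrow> l \<in> {1,2,3} \<Longrightarrow> \<bar>d i - d l\<bar> \<le> t" and p: "t + \<gamma> k * s \<le> p"
    using d unfolding data_bound_def by blast
  obtain a b where I: "{i, a, b} = {1,2,3::nat}" "i \<noteq> a" "i \<noteq> b" "a \<noteq> b" using third_index[OF i] by metis
  have I2: "{i, b, a} = {1,2,3}" using I(1) by auto
  let ?g = "\<gamma> (Suc k)"
  let ?e = "sub_data ?g i d"
  have g: "0 < ?g" using pos[of "Suc k"] k jK by auto
  note E = sub_data_estimates[where d = d and s = s and t = t, OF k s t I]
    sub_data_estimates[where d = d and s = s and t = t, OF k s t I2 I(3,2) I(4)[symmetric]]
  have s0: "s \<ge> 0" using s[OF i] by linarith
  have t0: "t \<ge> 0" using t[OF i i] by linarith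
  have gs: "?g * s \<ge> 0" using g s0 by simp
  have mem: "l = i \<or> l = a \<or> l = b" if "l \<in> {1,2,3}" for l using that unfolding I(1)[symmetric] by simp
  have 1: "\<bar>?e l\<bar> \<le> 4/3 * s" if l: "l \<in> {1,2,3}" for l
    using mem[OF l] E(1,4) s[OF i] s0 by auto
  have 2: "\<bar>?e l - ?e q\<bar> \<le> 12/13 * t + 2/3 * (?g * s)" if l: "l \<in> {1,2,3}" and q: "q \<in> {1,2,3}" for l q
  proof -
    have x: "\<bar>d i - ?e a\<bar> \<le> 12/13 * t + 2/3 * (?g * s)" "\<bar>d i - ?e b\<bar> \<le> 12/13 * t + 2/3 * (?g * s)"
      "\<bar>?e a - ?e b\<bar> \<le> 12/13 * t" using E by (simp_all add: mult.assoc)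
    have "\<bar>?e a - d i\<bar> \<le> 12/13 * t + 2/3 * (?g * s)" "\<bar>?e b - d i\<bar> \<le> 12/13 * t + 2/3 * (?g * s)"
      "\<bar>?e b - ?e a\<bar> \<le> 12/13 * t + 2/3 * (?g * s)" "\<bar>?e a - ?e b\<bar> \<le> 12/13 * t + 2/3 * (?g * s)"
      using x gs by linarith+
    then show ?thesis using mem[OF l] mem[OF q] x(1,2) gs t0 by (auto simp: abs_minus_commute)
  qed
  \<comment> \<open>The new size and the new oscillation together contain
    \<open>2/3 + 4/3 = 2\<close> copies of \<open>?g * s\<close>. These are at most
    \<open>4/9 * (\<gamma> k * s)\<close>, well below the factor \<open>12/13\<close>.\<close>
  have "?g * s \<le> 2/9 * (\<gamma> k * s)" using mult_right_mono[OF gamma_ratio[OF k] s0] by simp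
  moreover have "\<gamma> k * s \<ge> 0" using pos[of k] k jK s0 by simp
  ultimately have 3: "(12/13 * t + 2/3 * (?g * s)) + ?g * (4/3 * s) \<le> 12/13 * p"
    using p by (simp add: algebra_simps)
  show ?thesis unfolding data_bound_def using 1 2 3 by blast
qed

lemma approx_step_0:
  assumes k: "k \<ge> K" and d: "data_bound k p d" and x: "x \<in> SG"
  shows "\<bar>approx (Suc 0) k d x - approx 0 k d x\<bar> \<le> 2 * p"
proof -
  obtain s t where s: "\<And>i. i \<in> {1,2,3} \<Longrightarrow> \<bar>d i\<bar> \<le> s"
    and t: "\<And>i l. i \<in> {1,2,3} \<Longrightarrow> l \<in> {1,2,3} \<Longrightarrow> \<bar>d i - d l\<bar> \<le> t" and p: "t + \<gamma> k * s \<le> p"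
    using d unfolding data_bound_def by blast
  obtain i y where i: "i \<in> {1,2,3}" and y: "y \<in> SG" "x = sg_map i y" using x by (rule SG_cases)
  obtain a b where I: "{i, a, b} = {1,2,3::nat}" "i \<noteq> a" "i \<noteq> b" "a \<noteq> b" using third_index[OF i] by metis
  have I2: "{i, b, a} = {1,2,3}" using I(1) by auto
  let ?g = "\<gamma> (Suc k)"
  let ?e = "sub_data ?g i d"
  have g: "0 < ?g" using pos[of "Suc k"] k jK by auto
  note E = sub_data_estimates[where d = d and s = s and t = t, OF k s t I]
    sub_data_estimates[where d = d and s = s and t = t, OF k s t I2 I(3,2) I(4)[symmetric]]
  have s0: "s \<ge> 0" using s[OF i] by linarith
  have t0: "t \<ge> 0" using t[OF i i] by linarith
  have gs: "?g * s \<ge> 0" using g s0 by simp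
  have mem: "l = i \<or> l = a \<or> l = b" if "l \<in> {1,2,3}" for l using that unfolding I(1)[symmetric] by simp
  \<comment> \<open>Barycentric coordinates on SG are nonnegative with sum 1, so an interpolant
    strays from \<open>d i\<close> no further than its corner values do.\<close>
  have avg: "\<bar>(\<Sum>l\<in>{1,2,3}. c l * bary l z) - d i\<bar> \<le> r"
    if z: "z \<in> SG" and c: "\<And>l. l \<in> {1,2,3} \<Longrightarrow> \<bar>c l - d i\<bar> \<le> r" for c r z
  proof -
    have b: "bary l z \<ge> 0" if "l \<in> {1,2,3}" for l
      using SG_subset_triangle z that unfolding triangle_def by blast
    have bs: "(\<Sum>l\<in>{1,2,3::nat}. bary l z) = 1" using bary_sum[of z] by simp
    have "(\<Sum>l\<in>{1,2,3}. c l * bary l z) - d i = (\<Sum>l\<in>{1,2,3}. c l * bary l z) - (\<Sum>l\<in>{1,2,3}. d i * bary l z)"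
      unfolding sum_distrib_left[symmetric] bs by simp
    also have "\<dots> = (\<Sum>l\<in>{1,2,3}. (c l - d i) * bary l z)"
      unfolding sum_subtractf[symmetric] by (simp only: left_diff_distrib)
    also have "\<bar>\<dots>\<bar> \<le> (\<Sum>l\<in>{1,2,3::nat}. \<bar>(c l - d i) * bary l z\<bar>)" by (rule sum_abs)
    also have "\<dots> \<le> (\<Sum>l\<in>{1,2,3::nat}. r * bary l z)"
    proof (rule sum_mono)
      fix l :: nat assume l: "l \<in> {1,2,3}"
      have "\<bar>(c l - d i) * bary l z\<bar> = \<bar>c l - d i\<bar> * bary l z" using b[OF l] by (simp add: abs_mult)
      also have "\<dots> \<le> r * bary l z" by (rule mult_right_mono[OF c[OF l] b[OF l]])
      finally show "\<bar>(c l - d i) * bary l z\<bar> \<le> r * bary l z" .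
    qed
    also have "\<dots> = r" unfolding sum_distrib_left[symmetric] bs by simp
    finally show ?thesis .
  qed
  have "\<bar>approx 0 (Suc k) ?e y - d i\<bar> \<le> t + 2/3 * (?g * s)"
    unfolding approx.simps
  proof (rule avg[OF y(1)])
    fix l :: nat assume l: "l \<in> {1,2,3}"
    show "\<bar>?e l - d i\<bar> \<le> t + 2/3 * (?g * s)"
      using mem[OF l] E(2,5) t0 gs by (auto simp: abs_minus_commute)
  qed
  moreover have "\<bar>approx 0 k d x - d i\<bar> \<le> t"
    unfolding approx.simps by (rule avg[OF x]) (use t i in auto)
  moreover have "approx (Suc 0) k d x = approx 0 (Suc k) ?e y"
    unfolding y(2) by (rule approx_map[OF i y(1)])
  moreover have "?g * s \<le> 2/9 * (\<gamma> k * s)" using mult_right_mono[OF gamma_ratio[OF k] s0] by simp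
  moreover have "\<gamma> k * s \<ge> 0" using pos[of k] k jK s0 by simp
  ultimately show ?thesis using p by linarith
qed

lemma approx_step:
  assumes "k \<ge> K" "data_bound k p d" "x \<in> SG"
  shows "\<bar>approx (Suc n) k d x - approx n k d x\<bar> \<le> 2 * p * (12/13) ^ n"
  using assms
proof (induction n arbitrary: k p d x)
  case 0
  then show ?case using approx_step_0 by simp
next
  case (Suc n)
  obtain i y where i: "i \<in> {1,2,3}" and y: "y \<in> SG" "x = sg_map i y" using Suc.prems(3) by (rule SG_cases)
  have "\<bar>approx (Suc n) (Suc k) (sub_data (\<gamma> (Suc k)) i d) y - approx n (Suc k) (sub_data (\<gamma> (Suc k)) i d) y\<bar>
    \<le> 2 * (12/13 * p) * (12/13) ^ n"
    by (rule Suc.IH[OF _ data_bound_sub[OF Suc.prems(1,2) i] y(1)]) (use Suc.prems(1) in simp)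
  then show ?case unfolding y(2) approx_map[OF i y(1)] by simp
qed

definition psi :: "nat \<Rightarrow> (nat \<Rightarrow> real) \<Rightarrow> point \<Rightarrow> real" where
  "psi k d x = lim (\<lambda>n. approx n k d x)"

lemma psi_corner: "i \<in> {1,2,3} \<Longrightarrow> psi k d (corner i) = d i"
  unfolding psi_def using approx_corner by simp

lemma psi_map:
  assumes "i \<in> {1,2,3}" "y \<in> SG"
  shows "psi k d (sg_map i y) = psi (Suc k) (sub_data (\<gamma> (Suc k)) i d) y"
proof -
  \<comment> \<open>Only the possible limits are compared, so the equation holds before any
    convergence is known.\<close>
  have "(\<lambda>n. approx n k d (sg_map i y)) \<longlonglongrightarrow> L \<longleftrightarrow>
    (\<lambda>n. approx n (Suc k) (sub_data (\<gamma> (Suc k)) i d) y) \<longlonglongrightarrow> L" for L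
    unfolding approx_map[OF assms, symmetric] by (rule filterlim_sequentially_Suc[symmetric])
  then show ?thesis unfolding psi_def lim_def by simp
qed

lemma psi_compatible: "compatible (\<lambda>i. psi k (sub_data g i d))"
  unfolding compatible_def using psi_corner sub_data_sym by simp

lemma psi_glue: "x \<in> SG \<Longrightarrow> psi k d x = glue (\<lambda>i. psi (Suc k) (sub_data (\<gamma> (Suc k)) i d)) x"
  by (erule SG_cases) (simp add: psi_map glue_map[OF psi_compatible])

lemma continuous_on_psi_large:
  assumes k: "k \<ge> K" shows "continuous_on SG (psi k d)"
proof -
  obtain p where p: "p \<ge> 0" "data_bound k p d" using data_bound_exists[OF k] by blast
  let ?f = "\<lambda>n x. approx (Suc n) k d x - approx n k d x"
  have sm: "summable (\<lambda>n. 2 * p * (12/13) ^ n)" by (intro summable_mult summable_geometric) simp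
  have ul: "uniform_limit SG (\<lambda>n x. \<Sum>i<n. ?f i x) (\<lambda>x. suminf (\<lambda>i. ?f i x)) sequentially"
    by (rule Weierstrass_m_test[OF _ sm]) (simp only: real_norm_def approx_step[OF k p(2)])
  have "continuous_on SG (\<lambda>x. suminf (\<lambda>i. ?f i x))"
    by (rule uniform_limit_theorem[OF _ ul])
      (intro always_eventually allI continuous_on_sum continuous_on_diff continuous_on_approx, simp)
  then have c: "continuous_on SG (\<lambda>x. suminf (\<lambda>i. ?f i x) + approx 0 k d x)"
    by (intro continuous_on_add continuous_on_approx)
  have "psi k d x = suminf (\<lambda>i. ?f i x) + approx 0 k d x" if x: "x \<in> SG" for x
  proof -
    have "(\<lambda>n. \<Sum>i<n. ?f i x) \<longlonglongrightarrow> suminf (\<lambda>i. ?f i x)" by (rule tendsto_uniform_limitI[OF ul x])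
    then have "(\<lambda>n. approx n k d x - approx 0 k d x) \<longlonglongrightarrow> suminf (\<lambda>i. ?f i x)"
      using sum_lessThan_telescope[of "\<lambda>n. approx n k d x"] by (simp only:)
    then have "(\<lambda>n. approx n k d x - approx 0 k d x + approx 0 k d x) \<longlonglongrightarrow> suminf (\<lambda>i. ?f i x) + approx 0 k d x"
      by (intro tendsto_add tendsto_const)
    then show ?thesis unfolding psi_def by (intro limI) (simp only: diff_add_cancel)
  qed
  then show ?thesis by (intro continuous_on_eq[OF c]) (rule sym)
qed

text \<open>Below \<open>K\<close> the subdivision need not contract, but finitely many gluing steps
  lead from \<open>k\<close> to \<open>K\<close>.\<close>

lemma continuous_on_psi: "continuous_on SG (psi k d)"
proof (induction "K - k" arbitrary: k d)
  case 0
  then show ?case by (intro continuous_on_psi_large) simp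
next
  case (Suc n)
  have "continuous_on SG (glue (\<lambda>i. psi (Suc k) (sub_data (\<gamma> (Suc k)) i d)))"
    by (intro continuous_on_glue[OF psi_compatible] Suc.hyps(1)) (use Suc.hyps(2) in simp)
  then show ?case by (rule continuous_on_eq) (rule psi_glue[symmetric])
qed

text \<open>Adding the two values of \<open>sub_data\<close> next to a corner expresses its
  neighbour sum through the corner value and the previous neighbour sum; the common denominator is
  multiplied out.\<close>

definition nbr_rec :: "nat \<Rightarrow> (point \<Rightarrow> real) \<Rightarrow> nat \<Rightarrow> bool" where
  "nbr_rec k v m \<longleftrightarrow> (\<forall>i\<in>{1,2,3}. nbr_sum (Suc m) v (corner i) * ((5 - \<gamma> (Suc (k + m))) * (2 - \<gamma> (Suc (k + m))))
     = 2 * (4 - \<gamma> (Suc (k + m))) * v (corner i) + (6 - \<gamma> (Suc (k + m))) * nbr_sum m v (corner i))"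

lemma nbr_recD:
  assumes "nbr_rec k v m" "i \<in> {1,2,3}"
  shows "nbr_sum (Suc m) v (corner i) * ((5 - \<gamma> (Suc (k + m))) * (2 - \<gamma> (Suc (k + m))))
     = 2 * (4 - \<gamma> (Suc (k + m))) * v (corner i) + (6 - \<gamma> (Suc (k + m))) * nbr_sum m v (corner i)"
  using assms unfolding nbr_rec_def by (rule bspec)

definition eigen_level :: "nat \<Rightarrow> (point \<Rightarrow> real) \<Rightarrow> nat \<Rightarrow> bool" where
  "eigen_level k v m \<longleftrightarrow> (\<forall>x\<in>V m - V 0. graph_laplacian m v x = - \<gamma> (k + m) * v x)"

lemma nbr_rec_cong:
  assumes "\<And>x. x \<in> SG \<Longrightarrow> u x = v x" shows "nbr_rec k u m = nbr_rec k v m"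
proof -
  have "nbr_sum n u x = nbr_sum n v x" for n x
    by (rule nbr_sum_cong) (rule assms[OF subsetD[OF V_subset_SG]])
  moreover have "u (corner i) = v (corner i)" if "i \<in> {1,2,3}" for i by (rule assms[OF corner_SG[OF that]])
  ultimately show ?thesis unfolding nbr_rec_def by (intro ball_cong refl) (simp only:)
qed

lemma eigen_level_cong:
  assumes "\<And>x. x \<in> SG \<Longrightarrow> u x = v x" shows "eigen_level k u m = eigen_level k v m"
proof -
  have V: "x \<in> SG" if "x \<in> V n" for x n using that by (rule subsetD[OF V_subset_SG])
  have "graph_laplacian m u x = graph_laplacian m v x" if "x \<in> V m" for x
    by (rule graph_laplacian_cong[OF _ that]) (rule assms[OF V])
  moreover have "u x = v x" if "x \<in> V m" for x by (rule assms[OF V[OF that]])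
  ultimately show ?thesis unfolding eigen_level_def by auto
qed

text \<open>The one-sided recursion makes the eigenvalue equation at a junction pass to all finer levels.\<close>

lemma junction_rec:
  assumes u: "\<And>m. m \<ge> s \<Longrightarrow> nbr_rec k u m" and v: "\<And>m. m \<ge> s \<Longrightarrow> nbr_rec k v m"
    and ks: "k + s \<ge> j" and il: "i \<in> {1,2,3}" "l \<in> {1,2,3}" and c: "u (corner i) = v (corner l)"
    and b: "nbr_sum s u (corner i) + nbr_sum s v (corner l) = (4 - \<gamma> (k + s)) * u (corner i)" and m: "m \<ge> s"
  shows "nbr_sum m u (corner i) + nbr_sum m v (corner l) = (4 - \<gamma> (k + m)) * u (corner i)"
  using m
proof (induction m rule: dec_induct)
  case base
  show ?case by (rule b)
next
  case (step m)
  let ?g = "\<gamma> (Suc (k + m))"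
  have D: "(5 - ?g) * (2 - ?g) \<noteq> 0" using nz[of "k + m"] ks step.hyps by auto
  have r: "\<gamma> (k + m) = ?g * (5 - ?g)" using rec[of "k + m"] ks step.hyps by simp
  have "(nbr_sum (Suc m) u (corner i) + nbr_sum (Suc m) v (corner l)) * ((5 - ?g) * (2 - ?g))
    = 4 * (4 - ?g) * u (corner i) + (6 - ?g) * (nbr_sum m u (corner i) + nbr_sum m v (corner l))"
    using nbr_recD[OF u[OF step.hyps(1)] il(1)] nbr_recD[OF v[OF step.hyps(1)] il(2)] c
    by (simp add: distrib_right distrib_left)
  \<comment> \<open>With \<open>\<gamma> (k + m) = ?g * (5 - ?g)\<close> one has
    \<open>4 - \<gamma> (k + m) = (4 - ?g) * (1 - ?g)\<close>, and
    \<open>4 + (6 - ?g) * (1 - ?g) = (5 - ?g) * (2 - ?g)\<close>.\<close>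
  also have "\<dots> = (4 - ?g) * u (corner i) * ((5 - ?g) * (2 - ?g))"
    unfolding step.IH r by (simp add: algebra_simps)
  finally show ?case using D by simp
qed

lemma nbr_rec_glue:
  assumes c: "compatible v" and r: "\<And>i. i \<in> {1,2,3} \<Longrightarrow> nbr_rec (Suc k) (v i) m"
  shows "nbr_rec k (glue v) (Suc m)"
  unfolding nbr_rec_def
proof
  fix i :: nat assume i: "i \<in> {1,2,3}"
  have "nbr_sum n (glue v \<circ> sg_map i) x = nbr_sum n (v i) x" for n x
    by (rule nbr_sum_cong) (rule glue_compose[OF c i subsetD[OF V_subset_SG]])
  then have "nbr_sum (Suc n) (glue v) (corner i) = nbr_sum n (v i) (corner i)" for n
    unfolding nbr_sum_corner_Suc[OF i] by simp
  moreover have "glue v (corner i) = v i (corner i)"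
    using glue_map[OF c i corner_SG[OF i]] by (simp only: sg_map_fixed)
  ultimately show "nbr_sum (Suc (Suc m)) (glue v) (corner i) * ((5 - \<gamma> (Suc (k + Suc m))) * (2 - \<gamma> (Suc (k + Suc m))))
     = 2 * (4 - \<gamma> (Suc (k + Suc m))) * glue v (corner i) + (6 - \<gamma> (Suc (k + Suc m))) * nbr_sum (Suc m) (glue v) (corner i)"
    using nbr_recD[OF r[OF i] i] by simp
qed

text \<open>The condition on pairs is the eigenvalue equation at a junction, with the four
  neighbours split between the two cells.\<close>

lemma eigen_level_glue:
  assumes c: "compatible v" and e: "\<And>i. i \<in> {1,2,3} \<Longrightarrow> eigen_level (Suc k) (v i) m"
    and b: "\<And>i l. i \<in> {1,2,3} \<Longrightarrow> l \<in> {1,2,3} \<Longrightarrow> i \<noteq> l \<Longrightarrow>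
      nbr_sum m (v i) (corner l) + nbr_sum m (v l) (corner i) = (4 - \<gamma> (Suc k + m)) * v i (corner l)"
  shows "eigen_level k (glue v) (Suc m)"
  unfolding eigen_level_def
proof
  have VSG: "y \<in> SG" if "y \<in> V n" for y n using that by (rule subsetD[OF V_subset_SG])
  have S: "nbr_sum n (glue v \<circ> sg_map i) x = nbr_sum n (v i) x" if "i \<in> {1,2,3}" for n x i
    by (rule nbr_sum_cong) (rule glue_compose[OF c that VSG])
  have L: "graph_laplacian n (glue v \<circ> sg_map i) y = graph_laplacian n (v i) y"
    if "i \<in> {1,2,3}" "y \<in> V n" for i n y
    by (rule graph_laplacian_cong[OF _ that(2)]) (rule glue_compose[OF c that(1) VSG])
  fix x assume "x \<in> V (Suc m) - V 0"
  then show "graph_laplacian (Suc m) (glue v) x = - \<gamma> (k + Suc m) * glue v x"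
  proof (cases rule: interior_cases)
    case (map i y)
    have y: "y \<in> V m" using map(2) by simp
    show ?thesis
      unfolding map(3) laplacian_map[OF map(1,2)] L[OF map(1) y] glue_map[OF c map(1) VSG[OF y]]
      using e[OF map(1)] map(2) unfolding eigen_level_def by simp
  next
    case (junction i l)
    have g: "glue v (sg_map i (corner l)) = v i (corner l)"
      by (rule glue_map[OF c junction(1) corner_SG[OF junction(2)]])
    have v: "v i (corner l) = v l (corner i)" using c junction(1,2) unfolding compatible_def by blast
    have gl: "glue v (sg_map i (corner l)) = v l (corner i)" using g v by simp
    show ?thesis
      unfolding junction(4) laplacian_junction[OF junction(1-3)] corner_diff_def S[OF junction(1)] S[OF junction(2)] o_apply
        sg_map_commute[of l i] g
      using b[OF junction(1-3)] by (simp add: algebra_simps)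
  qed
qed

lemma nbr_sum_0_psi:
  assumes "{i, a, b} = {1,2,3::nat}" "i \<noteq> a" "i \<noteq> b" "a \<noteq> b"
  shows "nbr_sum 0 (psi k d) (corner i) = d a + d b"
  unfolding nbr_sum_0[OF assms] using psi_corner index_sets[OF assms] by simp

lemma nbr_sum_psi_Suc:
  assumes i: "i \<in> {1,2,3}"
  shows "nbr_sum (Suc m) (psi k d) (corner i) = nbr_sum m (psi (Suc k) (sub_data (\<gamma> (Suc k)) i d)) (corner i)"
  unfolding nbr_sum_corner_Suc[OF i]
  by (rule nbr_sum_cong) (simp add: psi_map[OF i subsetD[OF V_subset_SG]])

lemma nbr_rec_psi:
  assumes "k \<ge> j" shows "nbr_rec k (psi k d) m"
  using assms
proof (induction m arbitrary: k d)
  case 0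
  show ?case unfolding nbr_rec_def
  proof
    fix i :: nat assume i: "i \<in> {1,2,3}"
    obtain a b where I: "{i, a, b} = {1,2,3::nat}" "i \<noteq> a" "i \<noteq> b" "a \<noteq> b" using third_index[OF i] by metis
    have I2: "{i, b, a} = {1,2,3}" using I(1) by auto
    let ?g = "\<gamma> (Suc k)"
    have D: "(5 - ?g) * (2 - ?g) \<noteq> 0" using nz[of k] 0 by auto
    have "nbr_sum (Suc 0) (psi k d) (corner i) = sub_data ?g i d a + sub_data ?g i d b"
      unfolding nbr_sum_psi_Suc[OF i] nbr_sum_0_psi[OF I] ..
    also have "\<dots> = (2 * (4 - ?g) * d i + (6 - ?g) * (d a + d b)) / ((5 - ?g) * (2 - ?g))"
      unfolding sub_data_other[OF I] sub_data_other[OF I2 I(3,2) I(4)[symmetric]]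
      by (simp add: add_divide_distrib[symmetric] algebra_simps)
    finally show "nbr_sum (Suc 0) (psi k d) (corner i) * ((5 - \<gamma> (Suc (k + 0))) * (2 - \<gamma> (Suc (k + 0))))
     = 2 * (4 - \<gamma> (Suc (k + 0))) * psi k d (corner i) + (6 - \<gamma> (Suc (k + 0))) * nbr_sum 0 (psi k d) (corner i)"
      unfolding nbr_sum_0_psi[OF I] psi_corner[OF i] using D by simp
  qed
next
  case (Suc m)
  have "nbr_rec k (glue (\<lambda>i. psi (Suc k) (sub_data (\<gamma> (Suc k)) i d))) (Suc m)"
    by (rule nbr_rec_glue[OF psi_compatible]) (rule Suc.IH, use Suc.prems in simp)
  moreover have "nbr_rec k (psi k d) (Suc m) = nbr_rec k (glue (\<lambda>i. psi (Suc k) (sub_data (\<gamma> (Suc k)) i d))) (Suc m)"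
    by (rule nbr_rec_cong) (rule psi_glue)
  ultimately show ?case by (simp only:)
qed

lemma eigen_level_psi:
  assumes "k \<ge> j" shows "eigen_level k (psi k d) m"
  using assms
proof (induction m arbitrary: k d)
  case 0
  show ?case unfolding eigen_level_def by simp
next
  case (Suc m)
  let ?v = "\<lambda>i. psi (Suc k) (sub_data (\<gamma> (Suc k)) i d)"
  let ?g = "\<gamma> (Suc k)"
  have "eigen_level k (glue ?v) (Suc m)"
  proof (rule eigen_level_glue[OF psi_compatible])
    fix i :: nat assume i: "i \<in> {1,2,3}"
    show "eigen_level (Suc k) (?v i) m" using Suc by simp
  next
    fix i l :: nat assume i: "i \<in> {1,2,3}" and l: "l \<in> {1,2,3}" and n: "i \<noteq> l"
    obtain b where I: "{i, l, b} = {1,2,3}" "i \<noteq> b" "l \<noteq> b" using third_index_of[OF i l n] by metis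
    have S: "{l, i, b} = {1,2,3}" "{i, b, l} = {1,2,3}" "{l, b, i} = {1,2,3}" using I(1) by auto
    show "nbr_sum m (?v i) (corner l) + nbr_sum m (?v l) (corner i) = (4 - \<gamma> (Suc k + m)) * ?v i (corner l)"
    proof (rule junction_rec[where s = 0])
      show "nbr_rec (Suc k) (?v i) n" "nbr_rec (Suc k) (?v l) n" for n
        using nbr_rec_psi[of "Suc k"] Suc.prems by simp_all
      show "?v i (corner l) = ?v l (corner i)" using psi_corner i l sub_data_sym by simp
      show "nbr_sum 0 (?v i) (corner l) + nbr_sum 0 (?v l) (corner i) = (4 - \<gamma> (Suc k + 0)) * ?v i (corner l)"
      proof -
        define D where "D = (5 - ?g) * (2 - ?g)"
        have Dn: "D \<noteq> 0" using nz[of k] Suc.prems by (simp add: D_def)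
        note so = sub_data_other[OF I(1) n I(2,3), of ?g d, folded D_def]
          sub_data_other[OF S(2) I(2) n I(3)[symmetric], of ?g d, folded D_def]
          sub_data_other[OF S(3) I(3) n[symmetric] I(2)[symmetric], of ?g d, folded D_def]
        \<comment> \<open>The equation at the midpoint on the first level, multiplied by the common
          denominator; \<open>junction_rec\<close> passes it on to finer levels.\<close>
        have "D * d i + D * d l + ((4 - ?g) * (d i + d b) + 2 * d l) + ((4 - ?g) * (d l + d b) + 2 * d i)
          = (4 - ?g) * ((4 - ?g) * (d i + d l) + 2 * d b)"
          unfolding D_def by (simp add: algebra_simps)
        then show ?thesis
          unfolding nbr_sum_0_psi[OF S(1) n[symmetric] I(3,2)] nbr_sum_0_psi[OF I(1) n I(2,3)] psi_corner[OF l]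
            sub_data_self so add_0_right by (rule add_fractions_eq[OF Dn])
      qed
      show "j \<le> Suc k + 0" using Suc.prems by simp
    qed (rule l i le0)+
  qed
  moreover have "eigen_level k (psi k d) (Suc m) = eigen_level k (glue ?v) (Suc m)"
    by (rule eigen_level_cong) (rule psi_glue)
  ultimately show ?case by (simp only:)
qed

end

section \<open>Localized eigenfunctions in the two series\<close>

definition nb :: "(nat \<Rightarrow> real) \<Rightarrow> nat \<Rightarrow> real" where
  "nb d c = d 1 + d 2 + d 3 - d c"

lemma nb_third:
  assumes "{i, a, b} = {1,2,3::nat}" "i \<noteq> a" "i \<noteq> b" "a \<noteq> b"
  shows "nb d i = d a + d b"
proof -
  have "d 1 + d 2 + d 3 = (\<Sum>k\<in>{1,2,3}. d k)" by simp
  also have "\<dots> = (\<Sum>k\<in>{i,a,b}. d k)" unfolding assms(1) ..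
  also have "\<dots> = d i + d a + d b" using assms(2-4) by simp
  finally show ?thesis by (simp add: nb_def)
qed

context spectral_decimation
begin

lemma nbr_sum_0_nb: assumes i: "i \<in> {1,2,3}" shows "nbr_sum 0 (psi k d) (corner i) = nb d i"
proof -
  obtain a b where I: "{i, a, b} = {1,2,3::nat}" "i \<noteq> a" "i \<noteq> b" "a \<noteq> b" using third_index[OF i] by metis
  show ?thesis unfolding nbr_sum_0_psi[OF I] nb_third[OF I] ..
qed

lemma nbr_sum_Suc_glue:
  assumes c: "compatible v" and i: "i \<in> {1,2,3}"
  shows "nbr_sum (Suc n) (glue v) (corner i) = nbr_sum n (v i) (corner i)"
  unfolding nbr_sum_corner_Suc[OF i]
  by (rule nbr_sum_cong) (rule glue_compose[OF c i subsetD[OF V_subset_SG]])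

lemma glue_corner:
  assumes c: "compatible v" and i: "i \<in> {1,2,3}" shows "glue v (corner i) = v i (corner i)"
  using glue_map[OF c i corner_SG[OF i]] by (simp only: sg_map_fixed)

text \<open>\<open>D a b c\<close> is the value at corner \<open>c\<close> of the cell with address \<open>[a, b]\<close>; the assumptions say that
  these values form a localized eigenfunction of the level-2 graph with eigenvalue \<open>\<gamma> j\<close>.\<close>

lemma loc_space_nontrivial:
  fixes D :: "nat \<Rightarrow> nat \<Rightarrow> nat \<Rightarrow> real"
  assumes j2: "j \<ge> 2" and lim: "(\<lambda>k. 3/2 * (5 ^ k * \<gamma> k)) \<longlonglongrightarrow> l"
    and s1: "\<And>a b c. a \<in> {1,2,3} \<Longrightarrow> b \<in> {1,2,3} \<Longrightarrow> c \<in> {1,2,3} \<Longrightarrow> D a b c = D a c b"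
    and s2: "\<And>a c. a \<in> {1,2,3} \<Longrightarrow> c \<in> {1,2,3} \<Longrightarrow> D a c c = D c a a"
    and e1: "\<And>a b c. a \<in> {1,2,3} \<Longrightarrow> b \<in> {1,2,3} \<Longrightarrow> c \<in> {1,2,3} \<Longrightarrow> b \<noteq> c \<Longrightarrow>
      nb (D a b) c + nb (D a c) b = (4 - \<gamma> j) * D a b c"
    and e2: "\<And>a c. a \<in> {1,2,3} \<Longrightarrow> c \<in> {1,2,3} \<Longrightarrow> a \<noteq> c \<Longrightarrow>
      nb (D a c) c + nb (D c a) a = (4 - \<gamma> j) * D a c c"
    and z: "\<And>a. a \<in> {1,2,3} \<Longrightarrow> D a a a = 0" "\<And>a. a \<in> {1,2,3} \<Longrightarrow> nb (D a a) a = 0"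
    and ne: "D 1 2 1 \<noteq> 0"
  shows "\<exists>v\<in>loc_space (l / 5 ^ (j - 2)). v \<noteq> 0"
proof -
  define cf where "cf a = glue (\<lambda>b. psi j (D a b))" for a
  define v where "v = glue cf"
  \<comment> \<open>The level-2 graph carries the eigenvalue \<open>\<gamma> j\<close>, so the
    function itself belongs to level \<open>k = j - 2\<close>.\<close>
  obtain k where jk: "j = Suc (Suc k)" using j2 by (metis add_2_eq_Suc le_Suc_ex)
  have c1: "compatible (\<lambda>b. psi j (D a b))" if "a \<in> {1,2,3}" for a
    unfolding compatible_def using s1[OF that] psi_corner by simp
  have cfc: "cf a (corner c) = D a c c" if "a \<in> {1,2,3}" "c \<in> {1,2,3}" for a c
    unfolding cf_def glue_corner[OF c1[OF that(1)] that(2)] by (rule psi_corner[OF that(2)])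
  have c2: "compatible cf" unfolding compatible_def using cfc s2 by simp
  have r1: "nbr_rec (Suc k) (cf a) m" if a: "a \<in> {1,2,3}" and m: "m \<ge> 1" for a m
  proof -
    obtain n where n: "m = Suc n" using m by (metis Suc_le_D One_nat_def)
    show ?thesis unfolding n cf_def
      by (rule nbr_rec_glue[OF c1[OF a]]) (unfold jk, rule nbr_rec_psi, simp add: jk)
  qed
  have l1: "eigen_level (Suc k) (cf a) m" if a: "a \<in> {1,2,3}" and m: "m \<ge> 1" for a m
  proof -
    obtain n where n: "m = Suc n" using m by (metis Suc_le_D One_nat_def)
    show ?thesis unfolding n cf_def
    proof (rule eigen_level_glue[OF c1[OF a]])
      fix i :: nat assume i: "i \<in> {1,2,3}"
      show "eigen_level (Suc (Suc k)) (psi j (D a i)) n" unfolding jk by (rule eigen_level_psi) (simp add: jk)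
      fix b :: nat assume b: "b \<in> {1,2,3}" and ib: "i \<noteq> b"
      show "nbr_sum n (psi j (D a i)) (corner b) + nbr_sum n (psi j (D a b)) (corner i)
        = (4 - \<gamma> (Suc (Suc k) + n)) * psi j (D a i) (corner b)"
        unfolding jk[symmetric]
      proof (rule junction_rec[where s = 0])
        show "nbr_rec j (psi j (D a i)) m" "nbr_rec j (psi j (D a b)) m" for m by (rule nbr_rec_psi, simp)+
        show "psi j (D a i) (corner b) = psi j (D a b) (corner i)" using c1[OF a] i b unfolding compatible_def by blast
        show "nbr_sum 0 (psi j (D a i)) (corner b) + nbr_sum 0 (psi j (D a b)) (corner i)
          = (4 - \<gamma> (j + 0)) * psi j (D a i) (corner b)"
          unfolding nbr_sum_0_nb[OF b] nbr_sum_0_nb[OF i] psi_corner[OF b] add_0_right by (rule e1[OF a i b ib])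
      qed (use i b in auto)
    qed
  qed
  have n1: "nbr_sum (Suc 0) (cf a) (corner c) = nb (D a c) c" if "a \<in> {1,2,3}" "c \<in> {1,2,3}" for a c
    unfolding cf_def nbr_sum_Suc_glue[OF c1[OF that(1)] that(2)] by (rule nbr_sum_0_nb[OF that(2)])
  have r2: "nbr_rec k v m" if m: "m \<ge> 2" for m
  proof -
    obtain n where n: "m = Suc n" "n \<ge> 1" using m by (cases m) auto
    show ?thesis unfolding n v_def by (rule nbr_rec_glue[OF c2]) (rule r1[OF _ n(2)])
  qed
  have l2: "eigen_level k v m" if m: "m \<ge> 2" for m
  proof -
    obtain n where n: "m = Suc n" "n \<ge> 1" using m by (cases m) auto
    show ?thesis unfolding n(1) v_def
    proof (rule eigen_level_glue[OF c2])
      fix i :: nat assume i: "i \<in> {1,2,3}"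
      show "eigen_level (Suc k) (cf i) n" by (rule l1[OF i n(2)])
      fix b :: nat assume b: "b \<in> {1,2,3}" and ib: "i \<noteq> b"
      show "nbr_sum n (cf i) (corner b) + nbr_sum n (cf b) (corner i) = (4 - \<gamma> (Suc k + n)) * cf i (corner b)"
      \<comment> \<open>The pieces \<open>cf\<close> are themselves glued and obey the recursion
        only from level 1 on, so the junctions between them start there, with \<open>e2\<close> as
        the initial equation.\<close>
      proof (rule junction_rec[where s = 1])
        show "nbr_rec (Suc k) (cf i) m" "nbr_rec (Suc k) (cf b) m" if "m \<ge> 1" for m
          by (rule r1[OF i that], rule r1[OF b that])
        show "cf i (corner b) = cf b (corner i)" using c2 i b unfolding compatible_def by blast
        show "nbr_sum 1 (cf i) (corner b) + nbr_sum 1 (cf b) (corner i) = (4 - \<gamma> (Suc k + 1)) * cf i (corner b)"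
          using e2[OF i b ib] n1[OF i b] n1[OF b i] cfc[OF i b] by (simp add: jk)
      qed (use i b n in \<open>auto simp: jk\<close>)
    qed
  qed
  have v0: "v (corner i) = 0" if i: "i \<in> {1,2,3}" for i
    unfolding v_def glue_corner[OF c2 i] cfc[OF i i] by (rule z(1)[OF i])
  \<comment> \<open>With value 0 at the corner the recursion merely multiplies the neighbour sum, so
    the sum 0 on level 2 persists. Hence \<open>corner_diff\<close> is exactly 0 from level 2
    on.\<close>
  have n0: "nbr_sum m v (corner i) = 0" if m: "m \<ge> 2" and i: "i \<in> {1,2,3}" for i m
    using m
  proof (induction m rule: dec_induct)
    case base
    show ?case unfolding v_def numeral_2_eq_2 nbr_sum_Suc_glue[OF c2 i] n1[OF i i] by (rule z(2)[OF i])
  next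
    case (step m)
    have "(5 - \<gamma> (Suc (k + m))) * (2 - \<gamma> (Suc (k + m))) \<noteq> 0"
      using nz[of "k + m"] step.hyps by (auto simp: jk)
    then show ?case using nbr_recD[OF r2[OF step.hyps(1)] i] v0[OF i] step.IH by simp
  qed
  have cont: "continuous_on SG v"
    unfolding v_def
  proof (rule continuous_on_glue[OF c2])
    fix i :: nat assume "i \<in> {1,2,3}"
    then show "continuous_on SG (cf i)" unfolding cf_def by (intro continuous_on_glue c1 continuous_on_psi)
  qed
  let ?l = "l / 5 ^ (j - 2)"
  have h: "has_laplacian v (\<lambda>x. - (?l * v x))"
    unfolding has_laplacian_alt
  proof (intro conjI allI impI cont)
    show "continuous_on SG (\<lambda>x. - (?l * v x))" using cont by (intro continuous_intros)
    fix e :: real assume e: "e > 0"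
    obtain p where B: "\<And>y. y \<in> SG \<Longrightarrow> \<bar>v y\<bar> \<le> \<bar>v p\<bar>" using bounded_on_SG[OF cont] by blast
    define B where "B = \<bar>v p\<bar> + 1"
    have B0: "B > 0" "\<And>y. y \<in> SG \<Longrightarrow> \<bar>v y\<bar> \<le> B" using B by (auto simp: B_def intro: add_increasing2)
    have "(\<lambda>m. 3/2 * (5 ^ (m + k) * \<gamma> (m + k))) \<longlonglongrightarrow> l" by (rule LIMSEQ_ignore_initial_segment[OF lim])
    then have "(\<lambda>m. 3/2 * (5 ^ (m + k) * \<gamma> (m + k)) / 5 ^ k) \<longlonglongrightarrow> l / 5 ^ k" by (intro tendsto_divide tendsto_const) auto
    then have "(\<lambda>m. 3/2 * (5 ^ m * \<gamma> (k + m))) \<longlonglongrightarrow> ?l" by (simp add: power_add jk add.commute)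
    then have "\<forall>\<^sub>F m in sequentially. dist (3/2 * (5 ^ m * \<gamma> (k + m))) ?l < e / B"
      using e B0 by (intro tendstoD) auto
    then show "\<forall>\<^sub>F m in sequentially. \<forall>x\<in>V m - V 0. \<bar>3/2 * (5 ^ m * graph_laplacian m v x) - - (?l * v x)\<bar> < e"
      using eventually_ge_at_top[of 2]
    proof eventually_elim
      case (elim m)
      show ?case
      proof
        fix x assume x: "x \<in> V m - V 0"
        then have "x \<in> SG" by (auto intro: subsetD[OF V_subset_SG])
        have L: "graph_laplacian m v x = - \<gamma> (k + m) * v x" using l2[OF elim(2)] x unfolding eigen_level_def by (rule bspec)
        have "3/2 * (5 ^ m * graph_laplacian m v x) - - (?l * v x) = - ((3/2 * (5 ^ m * \<gamma> (k + m)) - ?l) * v x)"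
          unfolding L by (simp add: algebra_simps)
        then have "\<bar>3/2 * (5 ^ m * graph_laplacian m v x) - - (?l * v x)\<bar> = \<bar>3/2 * (5 ^ m * \<gamma> (k + m)) - ?l\<bar> * \<bar>v x\<bar>"
          by (simp only: abs_minus abs_mult)
        also have "\<dots> \<le> \<bar>3/2 * (5 ^ m * \<gamma> (k + m)) - ?l\<bar> * B" by (rule mult_left_mono[OF B0(2)[OF \<open>x \<in> SG\<close>] abs_ge_zero])
        also have "\<dots> < e" using elim(1) B0(1) unfolding dist_real_def by (simp add: less_divide_eq)
        finally show "\<bar>3/2 * (5 ^ m * graph_laplacian m v x) - - (?l * v x)\<bar> < e" .
      qed
    qed
  qed
  have "v \<in> eigenspace ?l"
    unfolding eigenspace_iff
  proof (intro conjI allI impI h ballI)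
    show "v x = 0" if "x \<notin> SG" for x unfolding v_def by (rule glue_outside[OF that])
    fix x assume "x \<in> V 0"
    then obtain i where "i \<in> {1,2,3}" "x = corner i" unfolding V_0 by blast
    then show "v x = 0" using v0 by simp
  qed
  moreover have "(\<lambda>m. 5 ^ m * corner_diff m v i) \<longlonglongrightarrow> 0" if i: "i \<in> {1,2,3}" for i
  proof (rule tendsto_eventually)
    show "\<forall>\<^sub>F m in sequentially. 5 ^ m * corner_diff m v i = 0"
      using eventually_ge_at_top[of 2]
      by eventually_elim (simp add: corner_diff_def n0[OF _ i] v0[OF i])
  qed
  ultimately have "v \<in> loc_space ?l" unfolding loc_space_def by blast
  moreover have "v \<noteq> 0"
  proof
    assume v: "v = 0"
    have i: "1 \<in> {1,2,3::nat}" "2 \<in> {1,2,3::nat}" by simp_all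
    have "v (sg_map 1 (sg_map 2 (corner 1))) = cf 1 (sg_map 2 (corner 1))"
      unfolding v_def by (rule glue_map[OF c2 i(1) sg_map_SG[OF i(2) corner_SG[OF i(1)]]])
    also have "\<dots> = psi j (D 1 2) (corner 1)"
      unfolding cf_def by (rule glue_map[OF c1[OF i(1)] i(2) corner_SG[OF i(1)]])
    also have "\<dots> = D 1 2 1" by (rule psi_corner[OF i(1)])
    finally show False using ne v by simp
  qed
  ultimately show ?thesis by blast
qed

end

text \<open>The value 2 would require \<open>g = 2 * 3 = 6\<close>, contrary to
  \<open>g \<le> 5\<close>. Positivity of \<open>g\<close> keeps the root below 5, and so
  \<open>g'\<close> strictly between 0 and 5 for either sign.\<close>

lemma decimation_step:
  assumes g: "g' = 1/2 * (5 + e * sqrt (25 - 4 * g))" and e: "e \<in> {-1, 1}" and b: "0 < g" "g \<le> 5"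
  shows "g = g' * (5 - g')" "0 < g'" "g' < 5" "g' \<noteq> 2"
proof -
  define r where "r = sqrt (25 - 4 * g)"
  have r2: "r\<^sup>2 = 25 - 4 * g" using b by (simp add: r_def)
  have r0: "r > 0" using b by (simp add: r_def)
  have r5: "r < 5"
  proof (rule power2_less_imp_less)
    show "r\<^sup>2 < 5\<^sup>2" using r2 b by simp
  qed simp
  have e2: "e * e = 1" using e by auto
  have "g' * (5 - g') = (25 - (e * e) * r\<^sup>2) / 4"
    unfolding g r_def[symmetric] by (simp add: power2_eq_square field_simps)
  then show eq: "g = g' * (5 - g')" using e2 r2 by simp
  show "0 < g'" "g' < 5" using e r0 r5 unfolding g r_def[symmetric] by auto
  show "g' \<noteq> 2" using eq b by auto
qed

lemma decimation_locale:
  assumes d: "decimation j l \<gamma> \<epsilon>" and s: "\<gamma> j = 5 \<or> (\<gamma> j = 6 \<and> \<epsilon> (j + 1) = 1)"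
  shows "\<exists>K. spectral_decimation \<gamma> j K"
proof -
  have step: "\<epsilon> (Suc k) \<in> {-1, 1}" "\<gamma> (Suc k) = 1/2 * (5 + \<epsilon> (Suc k) * sqrt (25 - 4 * \<gamma> k))" if "k \<ge> j" for k
    using d that unfolding decimation_def by (auto dest!: spec[of _ "Suc k"])
  have lim: "(\<lambda>k. 3/2 * (5 ^ k * \<gamma> k)) \<longlonglongrightarrow> l" using d unfolding decimation_def by blast
  have first: "\<gamma> j = \<gamma> (Suc j) * (5 - \<gamma> (Suc j)) \<and> 0 < \<gamma> (Suc j) \<and> \<gamma> (Suc j) < 5 \<and> \<gamma> (Suc j) \<noteq> 2"
  proof (cases "\<gamma> j = 5")
    case True
    then show ?thesis using decimation_step[OF step(2)[OF order_refl] step(1)[OF order_refl]] by simp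
  next
    case False
    \<comment> \<open>In the 6-series the sign \<open>+1\<close> gives 3 as the next value; the sign
      \<open>-1\<close> would give the forbidden value 2.\<close>
    then have "\<gamma> j = 6" "\<epsilon> (Suc j) = 1" using s by auto
    then have "\<gamma> (Suc j) = 3" using step(2)[of j] by simp
    then show ?thesis using \<open>\<gamma> j = 6\<close> by simp
  qed
  have all: "\<gamma> k = \<gamma> (Suc k) * (5 - \<gamma> (Suc k)) \<and> 0 < \<gamma> (Suc k) \<and> \<gamma> (Suc k) < 5 \<and> \<gamma> (Suc k) \<noteq> 2" if "k \<ge> j" for k
    using that
  proof (induction k rule: dec_induct)
    case base
    show ?case by (rule first)
  next
    case (step k)
    have "Suc k \<ge> j" using step.hyps by simp
    note st = \<open>\<And>k. j \<le> k \<Longrightarrow> \<epsilon> (Suc k) \<in> {-1, 1}\<close>[OF this]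
      \<open>\<And>k. j \<le> k \<Longrightarrow> \<gamma> (Suc k) = 1/2 * (5 + \<epsilon> (Suc k) * sqrt (25 - 4 * \<gamma> k))\<close>[OF this]
    show ?case using decimation_step[OF st(2,1)] step.IH by simp
  qed
  \<comment> \<open>Convergence of \<open>5 ^ k * \<gamma> k\<close> forces \<open>\<gamma>\<close>
    to 0, which yields the threshold \<open>K\<close>.\<close>
  have "(\<lambda>k. 2/3 * (3/2 * (5 ^ k * \<gamma> k)) * (1/5) ^ k) \<longlonglongrightarrow> 2/3 * l * 0"
    by (intro tendsto_intros lim) auto
  moreover have "2/3 * (3/2 * (5 ^ k * \<gamma> k)) * (1/5) ^ k = \<gamma> k" for k by (simp add: power_one_over)
  ultimately have "\<gamma> \<longlonglongrightarrow> 0" by (simp only: mult_zero_right)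
  then have "\<forall>\<^sub>F k in sequentially. \<gamma> k < 1/2" by (intro order_tendstoD(2)) auto
  then obtain K where K: "\<And>k. k \<ge> K \<Longrightarrow> \<gamma> k < 1/2" unfolding eventually_sequentially by blast
  have "spectral_decimation \<gamma> j (max j K)"
  proof
    fix k assume k: "k \<ge> j"
    show "\<gamma> k = \<gamma> (Suc k) * (5 - \<gamma> (Suc k))" "\<gamma> (Suc k) \<noteq> 5" "\<gamma> (Suc k) \<noteq> 2" using all[OF k] by auto
    show "\<gamma> k > 0"
    proof (cases "k = j")
      case True
      then show ?thesis using s by auto
    next
      case False
      then obtain n where "k = Suc n" "n \<ge> j" using k by (cases k) auto
      then show ?thesis using all[of n] by simp
    qed
  next
    show "\<gamma> k \<le> 1/2" if "k \<ge> max j K" for k using K[of k] that by simp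
  qed simp
  then show ?thesis by blast
qed

lemma ball_123: "(\<forall>x\<in>{1,2,3::nat}. P x) = (P 1 \<and> P 2 \<and> P 3)"
  by simp

text \<open>Values 1 and -1, alternating around the boundary of the triangle, at the six quarter
  points of its sides, and 0 at all other vertices of level 2. The indices are those of
  \<open>D\<close> in \<open>loc_space_nontrivial\<close>.\<close>

definition loop_data :: "nat \<Rightarrow> nat \<Rightarrow> nat \<Rightarrow> real" where
  "loop_data a b c = (if b = c \<or> (b \<noteq> a \<and> c \<noteq> a) then 0
     else if (if b = a then c else b) = a mod 3 + 1 then 1 else -1)"

text \<open>Value 2 at the junction of the cells 1 and 2, -1 at its four neighbours, and in each of
  these two cells 1 at the midpoint between its outer corner and its junction with cell 3; elsewhere
  0.\<close>

definition pair_data :: "nat \<Rightarrow> nat \<Rightarrow> nat \<Rightarrow> real" where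
  "pair_data a b c = (if a = 3 then 0
     else if b = c then (if b = 3 - a then 2 else 0) else if b = 3 - a \<or> c = 3 - a then -1 else 1)"

text \<open>The depth \<open>j - 2\<close> reached here becomes the exponent in the lower bound for
  the dimension. The equations for the two explicit functions are numerical checks over the indices
  1, 2, 3.\<close>

lemma loc_space_series:
  assumes j: "j \<ge> 2" and s: "five_series j l \<or> six_series j l"
  shows "\<exists>v\<in>loc_space (l / 5 ^ (j - 2)). v \<noteq> 0"
proof -
  obtain \<gamma> \<epsilon> where d: "decimation j l \<gamma> \<epsilon>" and g: "\<gamma> j = 5 \<or> (\<gamma> j = 6 \<and> \<epsilon> (j + 1) = 1)"
    using s unfolding five_series_def six_series_def by blast
  obtain K where "spectral_decimation \<gamma> j K" using decimation_locale[OF d g] by blast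
  then interpret spectral_decimation \<gamma> j K .
  have lim: "(\<lambda>k. 3/2 * (5 ^ k * \<gamma> k)) \<longlonglongrightarrow> l" using d unfolding decimation_def by blast
  show ?thesis
  proof (cases "\<gamma> j = 5")
    case True
    have "\<forall>a\<in>{1,2,3}. \<forall>b\<in>{1,2,3}. \<forall>c\<in>{1,2,3}. loop_data a b c = loop_data a c b" "\<forall>a\<in>{1,2,3}. \<forall>c\<in>{1,2,3}. loop_data a c c = loop_data c a a"
      "\<forall>a\<in>{1,2,3}. \<forall>b\<in>{1,2,3}. \<forall>c\<in>{1,2,3}. b \<noteq> c \<longrightarrow> nb (loop_data a b) c + nb (loop_data a c) b = (4 - \<gamma> j) * loop_data a b c"
      "\<forall>a\<in>{1,2,3}. \<forall>c\<in>{1,2,3}. a \<noteq> c \<longrightarrow> nb (loop_data a c) c + nb (loop_data c a) a = (4 - \<gamma> j) * loop_data a c c"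
      "\<forall>a\<in>{1,2,3}. loop_data a a a = 0" "\<forall>a\<in>{1,2,3}. nb (loop_data a a) a = 0" "loop_data 1 2 1 \<noteq> 0"
      unfolding ball_123 by (simp_all add: loop_data_def nb_def True)
    note D = this
    show ?thesis
      by (rule loc_space_nontrivial[OF j lim D(1-6)[rule_format] D(7)])
  next
    case False
    then have "\<gamma> j = 6" using g by blast
    have "\<forall>a\<in>{1,2,3}. \<forall>b\<in>{1,2,3}. \<forall>c\<in>{1,2,3}. pair_data a b c = pair_data a c b" "\<forall>a\<in>{1,2,3}. \<forall>c\<in>{1,2,3}. pair_data a c c = pair_data c a a"
      "\<forall>a\<in>{1,2,3}. \<forall>b\<in>{1,2,3}. \<forall>c\<in>{1,2,3}. b \<noteq> c \<longrightarrow> nb (pair_data a b) c + nb (pair_data a c) b = (4 - \<gamma> j) * pair_data a b c"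
      "\<forall>a\<in>{1,2,3}. \<forall>c\<in>{1,2,3}. a \<noteq> c \<longrightarrow> nb (pair_data a c) c + nb (pair_data c a) a = (4 - \<gamma> j) * pair_data a c c"
      "\<forall>a\<in>{1,2,3}. pair_data a a a = 0" "\<forall>a\<in>{1,2,3}. nb (pair_data a a) a = 0" "pair_data 1 2 1 \<noteq> 0"
      unfolding ball_123 by (simp_all add: pair_data_def nb_def \<open>\<gamma> j = 6\<close>)
    note D = this
    show ?thesis
      by (rule loc_space_nontrivial[OF j lim D(1-6)[rule_format] D(7)])
  qed
qed

section \<open>Effective resistance on cells\<close>

definition edge_sum :: "nat \<Rightarrow> (point \<Rightarrow> real) \<Rightarrow> real" where
  "edge_sum m u = (\<Sum>(x, y)\<in>{(x, y). adj m x y}. (u x - u y)\<^sup>2)"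

lemma finite_edges: "finite {(x, y). adj m x y}"
  by (rule finite_subset[OF _ finite_cartesian_product[OF finite_V[of m] finite_V[of m]]]) (auto dest: adj_V)

lemma graph_energy_edge_sum: "graph_energy m u = (5/3) ^ m * (edge_sum m u / 2)"
  by (simp add: graph_energy_def edge_sum_def)

lemma adj_sym: "adj m x y \<Longrightarrow> adj m y x"
  unfolding adj_def by blast

lemma edge_sum_Suc: "edge_sum (Suc m) u = (\<Sum>i\<in>{1,2,3}. edge_sum m (u \<circ> sg_map i))"
proof -
  let ?E = "{(x, y). adj m x y}"
  let ?F = "\<lambda>i. map_prod (sg_map i) (sg_map i)"
  have F: "(x, z) \<in> ?F i ` ?E \<longleftrightarrow> (\<exists>y y'. x = sg_map i y \<and> z = sg_map i y' \<and> adj m y y')" for x z i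
  proof
    assume "(x, z) \<in> ?F i ` ?E"
    then obtain e where e: "e \<in> ?E" "(x, z) = ?F i e" by (rule imageE)
    have "x = sg_map i (fst e)" "z = sg_map i (snd e)" "adj m (fst e) (snd e)"
      using e by (simp_all add: map_prod_def case_prod_unfold)
    then show "\<exists>y y'. x = sg_map i y \<and> z = sg_map i y' \<and> adj m y y'" by blast
  next
    assume "\<exists>y y'. x = sg_map i y \<and> z = sg_map i y' \<and> adj m y y'"
    then obtain y y' where "x = sg_map i y" "z = sg_map i y'" "adj m y y'" by blast
    then show "(x, z) \<in> ?F i ` ?E" by (intro image_eqI[of _ _ "(y, y')"]) simp_all
  qed
  have iff: "(x, z) \<in> {(x, y). adj (Suc m) x y} \<longleftrightarrow> (x, z) \<in> (\<Union>i\<in>{1,2,3}. ?F i ` ?E)" for x z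
    unfolding UN_iff F mem_Collect_eq case_prod_conv by (rule adj_Suc_iff)
  have img: "{(x, y). adj (Suc m) x y} = (\<Union>i\<in>{1,2,3}. ?F i ` ?E)"
  proof (rule subset_antisym)
    have iff': "p \<in> {(x, y). adj (Suc m) x y} \<longleftrightarrow> p \<in> (\<Union>i\<in>{1,2,3}. ?F i ` ?E)" for p
      using iff[of "fst p" "snd p"] unfolding prod.collapse .
    show "{(x, y). adj (Suc m) x y} \<subseteq> (\<Union>i\<in>{1,2,3}. ?F i ` ?E)"
      by (rule subsetI) (rule iffD1[OF iff'])
    show "(\<Union>i\<in>{1,2,3}. ?F i ` ?E) \<subseteq> {(x, y). adj (Suc m) x y}"
      by (rule subsetI) (rule iffD2[OF iff'])
  qed
  \<comment> \<open>A common edge would have both ends at the single junction of the two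
    cells.\<close>
  have disj: "?F i ` ?E \<inter> ?F l ` ?E = {}" if i: "i \<in> {1,2,3}" and l: "l \<in> {1,2,3}" and n: "i \<noteq> l" for i l
  proof (rule ccontr)
    assume "?F i ` ?E \<inter> ?F l ` ?E \<noteq> {}"
    then obtain q where "q \<in> ?F i ` ?E \<inter> ?F l ` ?E" unfolding ex_in_conv[symmetric] by (rule exE)
    then have q: "(fst q, snd q) \<in> ?F i ` ?E" "(fst q, snd q) \<in> ?F l ` ?E"
      unfolding prod.collapse by (rule IntD1, rule IntD2)
    obtain x y where 1: "fst q = sg_map i x" "snd q = sg_map i y" "adj m x y" using q(1) unfolding F by (elim exE conjE)
    obtain x' y' where 2: "fst q = sg_map l x'" "snd q = sg_map l y'" "adj m x' y'" using q(2) unfolding F by (elim exE conjE)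
    note a = 1(3) 2(3)
    note qe = 1(1,2) 2(1,2)
    have e: "sg_map i x = sg_map l x'" "sg_map i y = sg_map l y'" using qe by simp_all
    have s: "x \<in> SG" "y \<in> SG" "x' \<in> SG" "y' \<in> SG"
      using adj_V[OF a(1)] adj_V[OF a(2)] V_subset_SG[of m] by blast+
    have "x = corner l" by (rule SG_inter(1)[OF i l n s(1,3) e(1)])
    moreover have "y = corner l" by (rule SG_inter(1)[OF i l n s(2,4) e(2)])
    ultimately show False using a(1) by (simp add: adj_def)
  qed
  have "edge_sum (Suc m) u = (\<Sum>i\<in>{1,2,3}. \<Sum>(x, y)\<in>?F i ` ?E. (u x - u y)\<^sup>2)"
    unfolding edge_sum_def img
    by (rule sum.UNION_disjoint) (use disj finite_edges in auto)
  also have "\<dots> = (\<Sum>i\<in>{1,2,3}. edge_sum m (u \<circ> sg_map i))"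
  proof (rule sum.cong[OF refl])
    fix i :: nat
    have "inj_on (?F i) ?E" by (auto simp: inj_on_def)
    then show "(\<Sum>(x, y)\<in>?F i ` ?E. (u x - u y)\<^sup>2) = edge_sum m (u \<circ> sg_map i)"
      unfolding edge_sum_def by (subst sum.reindex) (auto simp: case_prod_unfold intro!: sum.cong)
  qed
  finally show ?thesis .
qed

lemma edge_sum_0:
  "edge_sum 0 u = 2 * ((u (corner 1) - u (corner 2))\<^sup>2 + (u (corner 2) - u (corner 3))\<^sup>2 + (u (corner 3) - u (corner 1))\<^sup>2)"
proof -
  have ne: "corner 1 \<noteq> corner 2" "corner 2 \<noteq> corner 3" "corner 3 \<noteq> corner 1"
    using corner_eq_iff[of 1 2] corner_eq_iff[of 2 3] corner_eq_iff[of 3 1] by simp_all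
  have V0: "V 0 = {corner 1, corner 2, corner 3}" unfolding V_0 by simp
  have "{(x, y). adj 0 x y} = (SIGMA x:V 0. V 0 - {x})"
    by (rule subset_antisym; rule subrelI; simp add: adj_0_iff; blast)
  then have "edge_sum 0 u = (\<Sum>x\<in>V 0. \<Sum>y\<in>V 0 - {x}. (u x - u y)\<^sup>2)"
    unfolding edge_sum_def by (simp add: sum.Sigma finite_V)
  also have "\<dots> = 2 * ((u (corner 1) - u (corner 2))\<^sup>2 + (u (corner 2) - u (corner 3))\<^sup>2 + (u (corner 3) - u (corner 1))\<^sup>2)"
    unfolding V0 using ne ne[symmetric] by (simp add: insert_Diff_if power2_commute)
  finally show ?thesis .
qed

text \<open>\<open>p\<close>, \<open>q\<close>, \<open>r\<close> are the deviations of the midpoint values from the harmonic extension.\<close>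

lemma energy_subdivision_ineq:
  fixes a b c x y z :: real
  shows "(a - b)\<^sup>2 + (b - c)\<^sup>2 + (c - a)\<^sup>2 \<le> 5/3 * (((a - x)\<^sup>2 + (x - z)\<^sup>2 + (z - a)\<^sup>2)
    + ((x - b)\<^sup>2 + (b - y)\<^sup>2 + (y - x)\<^sup>2) + ((z - y)\<^sup>2 + (y - c)\<^sup>2 + (c - z)\<^sup>2))"
proof -
  \<comment> \<open>Division by 5 makes the harmonic extension, with weights 2/5, 2/5, 1/5,
    integral. In these coordinates the energy splits into the harmonic part and a nonnegative form
    in the deviations.\<close>
  define A B C where "A = a / 5" and "B = b / 5" and "C = c / 5"
  then have abc: "a = 5 * A" "b = 5 * B" "c = 5 * C" by simp_all
  define p q r where "p = x - (2 * A + 2 * B + C)" and "q = y - (A + 2 * B + 2 * C)" and "r = z - (2 * A + B + 2 * C)"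
  then have xyz: "x = p + (2 * A + 2 * B + C)" "y = q + (A + 2 * B + 2 * C)" "z = r + (2 * A + B + 2 * C)"
    by simp_all
  have "5 * (((a - x)\<^sup>2 + (x - z)\<^sup>2 + (z - a)\<^sup>2) + ((x - b)\<^sup>2 + (b - y)\<^sup>2 + (y - x)\<^sup>2)
    + ((z - y)\<^sup>2 + (y - c)\<^sup>2 + (c - z)\<^sup>2)) = 3 * ((a - b)\<^sup>2 + (b - c)\<^sup>2 + (c - a)\<^sup>2)
    + 5 * (2 * p\<^sup>2 + 2 * q\<^sup>2 + 2 * r\<^sup>2 + (p - q)\<^sup>2 + (q - r)\<^sup>2 + (r - p)\<^sup>2)"
    unfolding xyz abc by (simp add: power2_eq_square algebra_simps)
  moreover have "0 \<le> 2 * p\<^sup>2 + 2 * q\<^sup>2 + 2 * r\<^sup>2 + (p - q)\<^sup>2 + (q - r)\<^sup>2 + (r - p)\<^sup>2" by simp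
  ultimately show ?thesis by argo
qed

lemma edge_sum_mono: "edge_sum m u \<le> 5/3 * edge_sum (Suc m) u"
proof (induction m arbitrary: u)
  case 0
  have c: "sg_map 2 (corner 1) = sg_map 1 (corner 2)" "sg_map 3 (corner 1) = sg_map 1 (corner 3)"
    "sg_map 3 (corner 2) = sg_map 2 (corner 3)" by (rule sg_map_commute)+
  have "edge_sum (Suc 0) u = edge_sum 0 (u \<circ> sg_map 1) + edge_sum 0 (u \<circ> sg_map 2) + edge_sum 0 (u \<circ> sg_map 3)"
    unfolding edge_sum_Suc by simp
  then show ?case
    using energy_subdivision_ineq[of "u (corner 1)" "u (corner 2)" "u (corner 3)" "u (sg_map 1 (corner 2))"
      "u (sg_map 1 (corner 3))" "u (sg_map 2 (corner 3))"]
    unfolding edge_sum_0 o_apply sg_map_fixed c by argo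
next
  case (Suc m)
  have "edge_sum (Suc m) u = (\<Sum>i\<in>{1,2,3}. edge_sum m (u \<circ> sg_map i))" by (rule edge_sum_Suc)
  also have "\<dots> \<le> (\<Sum>i\<in>{1,2,3::nat}. 5/3 * edge_sum (Suc m) (u \<circ> sg_map i))" by (intro sum_mono Suc)
  also have "\<dots> = 5/3 * edge_sum (Suc (Suc m)) u" unfolding edge_sum_Suc[of "Suc m"] sum_distrib_left ..
  finally show ?case .
qed

lemma incseq_graph_energy: "incseq (\<lambda>m. graph_energy m u)"
proof (rule incseq_SucI)
  fix m
  have "(5/3) ^ m * (edge_sum m u / 2) \<le> (5/3) ^ m * (5/3 * edge_sum (Suc m) u / 2)"
    by (intro mult_left_mono divide_right_mono edge_sum_mono) simp_all
  then show "graph_energy m u \<le> graph_energy (Suc m) u" unfolding graph_energy_edge_sum by simp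
qed

lemma graph_energy_le_energy: "ennreal (graph_energy m u) \<le> energy u"
proof -
  have i: "incseq (\<lambda>m. ennreal (graph_energy m u))"
    using incseq_graph_energy[of u] by (auto simp: mono_def intro!: ennreal_leI)
  have "energy u = (SUP m. ennreal (graph_energy m u))"
    unfolding energy_def by (rule limI[OF LIMSEQ_SUP[OF i]])
  then show ?thesis by (simp only:) (rule SUP_upper, simp)
qed

section \<open>Oscillation and resistance on a cell\<close>

lemma edge_le_graph_energy:
  assumes "adj m x y" shows "(5/3) ^ m * (u x - u y)\<^sup>2 \<le> graph_energy m u"
proof -
  have "x \<noteq> y" using assms by (simp add: adj_def)
  then have "2 * (u x - u y)\<^sup>2 = (\<Sum>(x, y)\<in>{(x, y), (y, x)}. (u x - u y)\<^sup>2)" by (simp add: power2_commute)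
  also have "\<dots> \<le> edge_sum m u"
    unfolding edge_sum_def by (rule sum_mono2[OF finite_edges]) (use assms adj_sym in auto)
  finally show ?thesis unfolding graph_energy_edge_sum by (intro mult_left_mono) auto
qed

text \<open>Here \<open>4/5\<close> is used as an upper bound for \<open>sqrt (3/5)\<close>, so that \<open>5 s \<cdot> 4/5 + s = 5 s\<close>.\<close>

lemma chain_bound:
  assumes "x \<in> V m" "i \<in> {1,2,3}"
    and "\<And>n x y. adj n x y \<Longrightarrow> \<bar>u x - u y\<bar> \<le> s * sqrt (3/5) ^ n"
  shows "\<bar>u x - u (corner i)\<bar> \<le> 5 * s"
  using assms
proof (induction m arbitrary: u x i s)
  case 0
  obtain k where k: "k \<in> {1,2,3}" "x = corner k" using 0(1) unfolding V_0 by blast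
  have s: "\<bar>u (corner a) - u (corner b)\<bar> \<le> s" if "a \<in> {1,2,3}" "b \<in> {1,2,3}" "a \<noteq> b" for a b
    using 0(3)[of 0 "corner a" "corner b"] corner_in_V0[OF that(1)] corner_in_V0[OF that(2)]
      corner_eq_iff[OF that(1,2)] that(3) unfolding adj_0_iff by simp
  have "0 \<le> \<bar>u (corner 1) - u (corner 2)\<bar>" by simp
  also have "\<dots> \<le> s" by (rule s) auto
  finally have s0: "s \<ge> 0" .
  show ?case
  proof (cases "k = i")
    case True
    then show ?thesis using s0 k(2) by simp
  next
    case False
    from s[OF k(1) 0(2) this] show ?thesis using s0 unfolding k(2) by linarith
  qed
next
  case (Suc m)
  obtain l y where l: "l \<in> {1,2,3}" "y \<in> V m" "x = sg_map l y" using Suc.prems(1) unfolding V.simps(2) by blast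
  have edge: "\<bar>(u \<circ> sg_map l) a - (u \<circ> sg_map l) b\<bar> \<le> (s * sqrt (3/5)) * sqrt (3/5) ^ n" if a: "adj n a b" for n a b
  proof -
    have "adj (Suc n) (sg_map l a) (sg_map l b)" unfolding adj_Suc_iff using l(1) a by blast
    from Suc.prems(3)[OF this] show ?thesis by (simp add: mult.assoc)
  qed
  have 1: "\<bar>(u \<circ> sg_map l) y - (u \<circ> sg_map l) (corner l)\<bar> \<le> 5 * (s * sqrt (3/5))"
    by (rule Suc.IH[OF l(2,1) edge])
  have s: "\<bar>u (corner a) - u (corner b)\<bar> \<le> s" if "a \<in> {1,2,3}" "b \<in> {1,2,3}" "a \<noteq> b" for a b
    using Suc.prems(3)[of 0 "corner a" "corner b"] corner_in_V0[OF that(1)] corner_in_V0[OF that(2)]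
      corner_eq_iff[OF that(1,2)] that(3) unfolding adj_0_iff by simp
  have "0 \<le> \<bar>u (corner 1) - u (corner 2)\<bar>" by simp
  also have "\<dots> \<le> s" by (rule s) auto
  finally have s0: "s \<ge> 0" .
  have 2: "\<bar>u (corner l) - u (corner i)\<bar> \<le> s" using s[OF l(1) Suc.prems(2)] s0 by (cases "l = i") auto
  have "sqrt (3/5) \<le> 4/5" by (rule real_le_lsqrt) (auto simp: power2_eq_square)
  then have "s * sqrt (3/5) \<le> s * (4/5)" by (rule mult_left_mono[OF _ s0])
  then show ?case using 1 2 unfolding l(3) o_apply sg_map_fixed by linarith
qed

lemma edge_word_map:
  assumes "w \<in> words n" "adj m x y" shows "adj (n + m) (word_map w x) (word_map w y)"
  using assms(1)
proof (induction n arbitrary: w)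
  case 0
  then show ?case using assms(2) by simp
next
  case (Suc n)
  then obtain i v where w: "i \<in> {1,2,3}" "v \<in> words n" "w = i # v" unfolding words_Suc by blast
  show ?case unfolding w(3) word_map_Cons o_apply add_Suc adj_Suc_iff using w(1) Suc.IH[OF w(2)] by blast
qed

text \<open>Energy \<open>e\<close> bounds the jump along an edge of level \<open>m\<close> by
  \<open>sqrt (e * (3/5) ^ m)\<close>. Both points are joined by chains of edges in the cell to the
  same corner, hence twice the constant 5 of \<open>chain_bound\<close>.\<close>

lemma cell_oscillation:
  assumes u: "continuous_on SG u" and e: "energy u \<le> ennreal e" "e \<ge> 0"
    and w: "w \<in> words n" and x: "x \<in> cell w" and y: "y \<in> cell w"
  shows "\<bar>u x - u y\<bar> \<le> 10 * (sqrt e * sqrt (3/5) ^ n)"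
proof -
  have edge: "\<bar>u a - u b\<bar> \<le> sqrt e * sqrt (3/5) ^ m" if a: "adj m a b" for m a b
  proof -
    have "ennreal ((5/3) ^ m * (u a - u b)\<^sup>2) \<le> ennreal (graph_energy m u)"
      by (rule ennreal_leI[OF edge_le_graph_energy[OF a]])
    also have "\<dots> \<le> ennreal e" using graph_energy_le_energy e(1) by (rule order_trans)
    finally have "(5/3) ^ m * (u a - u b)\<^sup>2 \<le> e" using e(2) by simp
    then have "(3/5) ^ m * ((5/3) ^ m * (u a - u b)\<^sup>2) \<le> (3/5) ^ m * e" by (intro mult_left_mono) auto
    moreover have "(3/5 :: real) ^ m * (5/3) ^ m = 1" by (simp flip: power_mult_distrib)
    ultimately have "(u a - u b)\<^sup>2 \<le> (3/5) ^ m * e" by (simp only: mult.assoc[symmetric] mult_1)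
    then have "(u a - u b)\<^sup>2 \<le> e * (3/5) ^ m" by (simp only: mult.commute)
    then have "sqrt ((u a - u b)\<^sup>2) \<le> sqrt (e * (3/5) ^ m)" by (rule real_sqrt_le_mono)
    moreover have "sqrt (e * (3/5) ^ m) = sqrt e * sqrt (3/5) ^ m" by (simp only: real_sqrt_mult real_sqrt_power)
    ultimately show ?thesis by (simp only: real_sqrt_abs)
  qed
  let ?v = "u \<circ> word_map w"
  let ?s = "sqrt e * sqrt (3/5) ^ n"
  have edge': "\<bar>?v a - ?v b\<bar> \<le> ?s * sqrt (3/5) ^ m" if "adj m a b" for m a b
    using edge[OF edge_word_map[OF w that]] by (simp add: power_add mult.assoc)
  have c: "continuous_on SG ?v"
  proof (intro continuous_on_compose continuous_on_word_map continuous_on_subset[OF u])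
    show "word_map w ` SG \<subseteq> SG" using cell_subset_SG[OF w] by (simp add: cell_def)
  qed
  have b: "\<bar>?v z - ?v (corner 1)\<bar> \<le> 5 * ?s" if z: "z \<in> SG" for z
  proof (rule V_dense_bound[where w = "[]" and n = 0 and g = "\<lambda>z. \<bar>?v z - ?v (corner 1)\<bar>"])
    show "continuous_on SG (\<lambda>z. \<bar>?v z - ?v (corner 1)\<bar>)"
      by (intro continuous_on_rabs continuous_on_diff continuous_on_const c)
    show "\<bar>?v y - ?v (corner 1)\<bar> \<le> 5 * ?s" if "y \<in> V m" for m y
      by (rule chain_bound[OF that _ edge']) auto
  qed (use z in auto)
  obtain a b where ab: "a \<in> SG" "x = word_map w a" "b \<in> SG" "y = word_map w b" using x y unfolding cell_def by blast
  show ?thesis using b[OF ab(1)] b[OF ab(3)] unfolding ab o_apply by linarith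
qed

text \<open>A function running from 0 to 1 inside an \<open>n\<close>-cell has energy at least
  \<open>(5/3) ^ n / 100\<close>; the constant is the square of the 10 in
  \<open>cell_oscillation\<close>.\<close>

lemma resistance_le:
  assumes w: "w \<in> words n" and x: "x \<in> cell w" and y: "y \<in> cell w"
  shows "0 \<le> resistance x y" "resistance x y \<le> 100 * (3/5) ^ n"
proof -
  show "0 \<le> resistance x y" unfolding resistance_def by simp
  show "resistance x y \<le> 100 * (3/5) ^ n"
  proof (cases "x = y")
    case False
    let ?I = "INF u\<in>{u. continuous_on SG u \<and> u x = 0 \<and> u y = 1}. energy u"
    have "ennreal ((5/3) ^ n / 100) \<le> ?I"
    proof (rule INF_greatest)
      fix u :: "point \<Rightarrow> real" assume "u \<in> {u. continuous_on SG u \<and> u x = 0 \<and> u y = 1}"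
      then have u: "continuous_on SG u" "u x = 0" "u y = 1" by auto
      show "ennreal ((5/3) ^ n / 100) \<le> energy u"
      proof (cases "energy u")
        case (real e)
        have "1 \<le> 10 * (sqrt e * sqrt (3/5) ^ n)"
          using cell_oscillation[OF u(1) _ real(1) w x y] real(2) u(2,3) by simp
        then have "1\<^sup>2 \<le> (10 * (sqrt e * sqrt (3/5) ^ n))\<^sup>2" by (intro power_mono) auto
        also have "\<dots> = 100 * (e * (3/5) ^ n)"
          using real(1) by (simp add: power_mult_distrib flip: power_mult real_sqrt_power) (simp add: mult.commute power_mult)
        finally have "1 * (5/3) ^ n \<le> 100 * (e * (3/5) ^ n) * (5/3) ^ n" by (intro mult_right_mono) auto
        also have "\<dots> = 100 * e * ((3/5) ^ n * (5/3) ^ n)" by (simp only: mult_ac)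
        also have "(3/5 :: real) ^ n * (5/3) ^ n = 1" by (simp flip: power_mult_distrib)
        finally show ?thesis unfolding real(2) by (intro ennreal_leI) simp
      qed simp
    qed
    \<comment> \<open>An infinite infimum is read as 0 by \<open>enn2real\<close>, and
      \<open>inverse 0 = 0\<close>, so the bound holds in that case too.\<close>
    then have I: "?I = \<infinity> \<or> (5/3) ^ n / 100 \<le> enn2real ?I"
      by (cases ?I) (auto simp: ennreal_le_iff2)
    then show ?thesis
    proof
      assume "?I = \<infinity>"
      then show ?thesis using False unfolding resistance_def by simp
    next
      assume a: "(5/3) ^ n / 100 \<le> enn2real ?I"
      have "resistance x y = inverse (enn2real ?I)" using False unfolding resistance_def by simp
      also have "\<dots> \<le> inverse ((5/3) ^ n / 100)" by (rule le_imp_inverse_le[OF a]) simp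
      also have "\<dots> = 100 * (3/5) ^ n" by (simp add: power_divide field_simps)
      finally show ?thesis .
    qed
  qed (simp add: resistance_def)
qed

section \<open>A basis adapted to the cells\<close>

text \<open>Elimination: if an unknown occurs in the equation \<open>s\<close>, solve for it and
  substitute, which leaves one equation and one unknown fewer.\<close>

lemma linear_system_nontrivial:
  fixes \<phi> :: "'b \<Rightarrow> 's \<Rightarrow> real"
  assumes "finite I" "finite B" "card I < card B"
  shows "\<exists>c. (\<exists>b\<in>B. c b \<noteq> 0) \<and> (\<forall>s\<in>I. (\<Sum>b\<in>B. c b * \<phi> b s) = 0)"
  using assms
proof (induction I arbitrary: B \<phi> rule: finite_induct)
  case empty
  then have "B \<noteq> {}" by auto
  then show ?case by (intro exI[of _ "\<lambda>_. 1"]) auto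
next
  case (insert s I)
  have cI: "card I < card B" using insert.prems insert.hyps by simp
  show ?case
  proof (cases "\<forall>b\<in>B. \<phi> b s = 0")
    case True
    obtain c where c: "\<exists>b\<in>B. c b \<noteq> 0" "\<forall>t\<in>I. (\<Sum>b\<in>B. c b * \<phi> b t) = 0"
      using insert.IH[OF insert.prems(1) cI, of \<phi>] by blast
    have "(\<Sum>b\<in>B. c b * \<phi> b s) = 0" by (rule sum.neutral) (use True in simp)
    then show ?thesis using c by (intro exI[of _ c]) simp
  next
    case False
    then obtain p where p: "p \<in> B" "\<phi> p s \<noteq> 0" by blast
    define B' where "B' = B - {p}"
    have B': "finite B'" "card I < card B'" using insert.prems insert.hyps p(1) by (simp_all add: B'_def)
    define \<phi>' where "\<phi>' b t = \<phi> b t - \<phi> b s / \<phi> p s * \<phi> p t" for b t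
    obtain c where c: "\<exists>b\<in>B'. c b \<noteq> 0" "\<forall>t\<in>I. (\<Sum>b\<in>B'. c b * \<phi>' b t) = 0"
      using insert.IH[OF B', of \<phi>'] by blast
    define c' where "c' b = (if b = p then - (\<Sum>b\<in>B'. c b * \<phi> b s) / \<phi> p s else c b)" for b
    have split: "(\<Sum>b\<in>B. c' b * \<phi> b t) = - (\<Sum>b\<in>B'. c b * \<phi> b s) / \<phi> p s * \<phi> p t + (\<Sum>b\<in>B'. c b * \<phi> b t)" for t
    proof -
      have "(\<Sum>b\<in>B. c' b * \<phi> b t) = c' p * \<phi> p t + (\<Sum>b\<in>B'. c' b * \<phi> b t)"
        unfolding B'_def by (rule sum.remove[OF insert.prems(1) p(1)])
      also have "(\<Sum>b\<in>B'. c' b * \<phi> b t) = (\<Sum>b\<in>B'. c b * \<phi> b t)"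
        by (rule sum.cong) (auto simp: c'_def B'_def)
      finally show ?thesis by (simp add: c'_def)
    qed
    have "(\<Sum>b\<in>B. c' b * \<phi> b s) = 0" unfolding split using p(2) by simp
    moreover have "(\<Sum>b\<in>B. c' b * \<phi> b t) = 0" if t: "t \<in> I" for t
    proof -
      have "(\<Sum>b\<in>B'. c b * \<phi>' b t) = (\<Sum>b\<in>B'. c b * \<phi> b t) - (\<Sum>b\<in>B'. c b * \<phi> b s * (\<phi> p t / \<phi> p s))"
        unfolding sum_subtractf[symmetric] by (rule sum.cong) (simp_all add: \<phi>'_def algebra_simps)
      also have "\<dots> = (\<Sum>b\<in>B'. c b * \<phi> b t) - (\<Sum>b\<in>B'. c b * \<phi> b s) * (\<phi> p t / \<phi> p s)"
        by (simp only: sum_distrib_right)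
      finally show ?thesis using c(2) t unfolding split by simp
    qed
    moreover have "\<exists>b\<in>B. c' b \<noteq> 0" using c(1) by (auto simp: c'_def B'_def)
    ultimately show ?thesis by (intro exI[of _ c']) simp
  qed
qed

lemma comb_apply: "(\<Sum>b\<in>B. (\<lambda>x. c b * b x)) x = (\<Sum>b\<in>B. c b * b x :: real)"
  by (rule sum_fun_apply)

lemma comb_subspace:
  assumes "fun_space.subspace W" "B \<subseteq> W"
  shows "(\<Sum>b\<in>B. (\<lambda>x. c b * b x)) \<in> W"
  by (intro fun_space.subspace_sum[OF assms(1)] fun_space.subspace_scale[OF assms(1)]) (use assms(2) in blast)

text \<open>Eigenfunctions are determined by their values on a fine enough \<open>V m\<close>, so
  more than \<open>card (V m)\<close> independent ones would have a nontrivial combination that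
  vanishes there.\<close>

lemma finite_independent_eigenspace:
  assumes B: "fun_space.independent B" "B \<subseteq> eigenspace l"
  shows "finite B"
proof (rule ccontr)
  assume inf: "infinite B"
  obtain m where m: "\<bar>l\<bar> < 5 ^ m" using real_arch_pow[of 5 "\<bar>l\<bar>"] by auto
  obtain B' where B': "finite B'" "card B' = Suc (card (V m))" "B' \<subseteq> B"
    using infinite_arbitrarily_large[OF inf] by blast
  have lt: "card (V m) < card B'" using B'(2) by simp
  obtain c where c: "\<exists>b\<in>B'. c b \<noteq> 0" "\<forall>x\<in>V m. (\<Sum>b\<in>B'. c b * b x) = 0"
    using linear_system_nontrivial[OF finite_V[of m] B'(1) lt, of "\<lambda>b x. b x"] by blast
  let ?u = "\<Sum>b\<in>B'. (\<lambda>x. c b * b x)"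
  have "?u \<in> eigenspace l" by (rule comb_subspace[OF subspace_eigenspace]) (use B' B in blast)
  then have "?u = 0"
    by (rule eigenfunction_eq_0[where m = m]) (use c(2) m in \<open>simp_all add: comb_apply\<close>)
  then have "c b = 0" if "b \<in> B'" for b
    using fun_space.independentD[OF B(1) B'(1,3)] that by blast
  then show False using c(1) by blast
qed

lemma eigenspace_subspace_basis:
  assumes W: "fun_space.subspace W" "W \<subseteq> eigenspace l" and S: "fun_space.independent S" "S \<subseteq> W"
  shows "\<exists>B. finite B \<and> S \<subseteq> B \<and> fun_space.independent B \<and> fun_space.span B = W"
proof -
  obtain B where B: "S \<subseteq> B" "B \<subseteq> W" "fun_space.independent B" "W \<subseteq> fun_space.span B"
    using fun_space.maximal_independent_subset_extend[OF S(2,1)] by blast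
  have "finite B" by (rule finite_independent_eigenspace[OF B(3)]) (use B(2) W(2) in blast)
  moreover have "fun_space.span B = W" using B(4) fun_space.span_minimal[OF B(2) W(1)] by blast
  ultimately show ?thesis using B by blast
qed

section \<open>Linearity of localization, and bases of localized functions\<close>

lemma glue_add: "glue (\<lambda>k. u k + v k) = glue u + glue v"
  by (auto simp: glue_def fun_eq_iff)

lemma glue_scale: "glue (\<lambda>k x. c * u k x) = (\<lambda>x. c * glue u x)"
  by (auto simp: glue_def fun_eq_iff)

lemma loc_add: "loc w (u + v) = loc w u + loc w v"
proof (induction w)
  case (Cons i w)
  have "(\<lambda>k. if k = i then loc w u + loc w v else 0) = (\<lambda>k. (if k = i then loc w u else 0) + (if k = i then loc w v else 0))"
    by auto
  then show ?case unfolding loc.simps Cons glue_add[symmetric] by (simp only:)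
qed simp

lemma loc_scale: "loc w (\<lambda>x. c * u x) = (\<lambda>x. c * loc w u x)"
proof (induction w)
  case (Cons i w)
  have "(\<lambda>k. if k = i then (\<lambda>x. c * loc w u x) else 0) = (\<lambda>k x. c * (if k = i then loc w u else 0) x)"
    by (auto simp: fun_eq_iff)
  then show ?case unfolding loc.simps Cons glue_scale[symmetric] by (simp only:)
qed simp

lemma loc_zero: "loc w 0 = 0"
  using loc_scale[of w 0 0] by (simp add: zero_fun_def)

lemma loc_span:
  assumes "v \<in> fun_space.span A"
  shows "loc w v \<in> fun_space.span (loc w ` A)"
proof -
  have "fun_space.subspace {v. loc w v \<in> fun_space.span (loc w ` A)}"
    by (intro fun_space.subspaceI) (auto simp: loc_add loc_scale loc_zero
      intro: fun_space.span_zero fun_space.span_add fun_space.span_scale)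
  then have "fun_space.span A \<subseteq> {v. loc w v \<in> fun_space.span (loc w ` A)}"
    by (intro fun_space.span_minimal) (auto intro: fun_space.span_base)
  then show ?thesis using assms by blast
qed

definition loc_basis :: "nat \<Rightarrow> (point \<Rightarrow> real) set \<Rightarrow> (point \<Rightarrow> real) set" where
  "loc_basis N A = (\<lambda>(w, a). loc w a) ` (words N \<times> A)"

lemma
  assumes A: "fun_space.independent A" "finite A" "A \<subseteq> loc_space (l / 5 ^ N)"
  shows inj_loc: "inj_on (\<lambda>(w, a). loc w a) (words N \<times> A)"
    and independent_loc_basis: "fun_space.independent (loc_basis N A)"
proof -
  have out: "a x = 0" if "a \<in> A" "x \<notin> SG" for a x
    by (rule eigenspace_outside[OF loc_space_eigenspace that(2)]) (use that A(3) in blast)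
  have app: "loc w a (word_map w' y) = (if w = w' then a y else 0)"
    if "a \<in> A" "w \<in> words N" "w' \<in> words N" "y \<in> SG" for a w w' y
    by (rule loc_apply[OF _ that(2-4)]) (use that A(3) in blast)
  have nz: "a \<noteq> 0" if "a \<in> A" for a using that A(1) fun_space.dependent_zero by blast
  have eqI: "a = b" if "\<And>y. y \<in> SG \<Longrightarrow> a y = b y" "\<And>y. y \<notin> SG \<Longrightarrow> a y = b y" for a b :: "point \<Rightarrow> real"
    using that by blast
  show inj: "inj_on (\<lambda>(w, a). loc w a) (words N \<times> A)"
  proof (rule inj_onI, clarify)
    fix w a v b assume w: "w \<in> words N" and a: "a \<in> A" and v: "v \<in> words N" and b: "b \<in> A" and e: "loc w a = loc v b"
    have ay: "a y = (if v = w then b y else 0)" if "y \<in> SG" for y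
      using app[OF a w w that] app[OF b v w that] e by simp
    have "v = w"
    proof (rule ccontr)
      assume "v \<noteq> w"
      then have "a = 0" using ay out[OF a] by (intro eqI) auto
      then show False using nz[OF a] by blast
    qed
    moreover have "a = b" using ay out[OF a] out[OF b] \<open>v = w\<close> by (intro eqI) auto
    ultimately show "w = v \<and> a = b" by blast
  qed
  have fin: "finite (words N \<times> A)" using finite_words A(2) by blast
  show "fun_space.independent (loc_basis N A)"
  proof
    assume "fun_space.dependent (loc_basis N A)"
    then obtain c where c: "\<exists>b\<in>loc_basis N A. c b \<noteq> 0" "(\<Sum>b\<in>loc_basis N A. (\<lambda>x. c b * b x)) = 0"
      using fun_space.dependent_finite[of "loc_basis N A"] fin unfolding loc_basis_def by auto
    have s: "(\<Sum>(w, a)\<in>words N \<times> A. c (loc w a) * loc w a x) = 0" for x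
    proof -
      have "0 = (\<Sum>b\<in>loc_basis N A. c b * b x)" using fun_cong[OF c(2), of x] by (simp add: comb_apply)
      also have "\<dots> = (\<Sum>(w, a)\<in>words N \<times> A. c (loc w a) * loc w a x)"
        unfolding loc_basis_def by (subst sum.reindex[OF inj]) (simp add: case_prod_unfold)
      finally show ?thesis by simp
    qed
    \<comment> \<open>Evaluated on the cell \<open>w\<close>, the relation keeps only the functions
      placed there and becomes a relation in \<open>A\<close>.\<close>
    have "c (loc w a) = 0" if w: "w \<in> words N" and a: "a \<in> A" for w a
    proof -
      have "(\<Sum>b\<in>A. c (loc w b) * b y) = 0" for y
      proof (cases "y \<in> SG")
        case True
        have "0 = (\<Sum>v\<in>words N. \<Sum>b\<in>A. c (loc v b) * loc v b (word_map w y))"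
          using s[of "word_map w y"] by (simp add: sum.cartesian_product)
        also have "\<dots> = (\<Sum>v\<in>words N. if v = w then (\<Sum>b\<in>A. c (loc w b) * b y) else 0)"
          by (intro sum.cong refl) (use app[OF _ _ w True] in \<open>auto intro!: sum.neutral sum.cong\<close>)
        also have "\<dots> = (\<Sum>b\<in>A. c (loc w b) * b y)" using w finite_words by simp
        finally show ?thesis by simp
      next
        case False
        then show ?thesis using out by (intro sum.neutral) simp
      qed
      then have "(\<Sum>b\<in>A. (\<lambda>x. c (loc w b) * b x)) = 0"
        by (intro ext) (simp add: sum_fun_apply)
      then show ?thesis
        using fun_space.independentD[OF A(1,2) order_refl, of "\<lambda>b. c (loc w b)"] a by blast
    qed
    then show False using c(1) unfolding loc_basis_def by auto
  qed
qed

lemma word_corner_limit_sum: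
  fixes w :: "point \<Rightarrow> point"
  assumes "finite R" and h: "\<And>b. b \<in> R \<Longrightarrow> convergent (\<lambda>m. (5/3) ^ m * corner_diff m (b \<circ> w) i)"
    and z: "(\<Sum>b\<in>R. c b * lim (\<lambda>m. (5/3) ^ m * corner_diff m (b \<circ> w) i)) = 0"
  shows "(\<lambda>m. (5/3) ^ m * corner_diff m ((\<Sum>b\<in>R. (\<lambda>x. c b * b x)) \<circ> w) i) \<longlonglongrightarrow> 0"
proof -
  have cd: "corner_diff m ((\<Sum>b\<in>R. (\<lambda>x. c b * b x)) \<circ> w) i = (\<Sum>b\<in>R. c b * corner_diff m (b \<circ> w) i)" for m
    using assms(1)
  proof (induction R rule: finite_induct)
    case empty
    have "(0 :: point \<Rightarrow> real) \<circ> w = 0" by (auto simp: fun_eq_iff)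
    then show ?case by (simp only: sum.empty corner_diff_zero)
  next
    case (insert b R)
    have e: "(\<Sum>b\<in>insert b R. (\<lambda>x. c b * b x)) \<circ> w = (\<lambda>x. c b * (b \<circ> w) x) + ((\<Sum>b\<in>R. (\<lambda>x. c b * b x)) \<circ> w)"
      using insert.hyps by (auto simp: fun_eq_iff)
    show ?case unfolding e corner_diff_add corner_diff_scale insert.IH by (simp only: sum.insert[OF insert.hyps])
  qed
  have "(\<lambda>m. \<Sum>b\<in>R. c b * ((5/3) ^ m * corner_diff m (b \<circ> w) i)) \<longlonglongrightarrow>
    (\<Sum>b\<in>R. c b * lim (\<lambda>m. (5/3) ^ m * corner_diff m (b \<circ> w) i))"
    by (intro tendsto_sum tendsto_mult_left) (use h convergent_LIMSEQ_iff in blast)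
  moreover have "(5/3) ^ m * (\<Sum>b\<in>R. c b * corner_diff m (b \<circ> w) i) = (\<Sum>b\<in>R. c b * ((5/3) ^ m * corner_diff m (b \<circ> w) i))" for m
    by (simp add: sum_distrib_left mult_ac)
  ultimately show ?thesis unfolding cd z by simp
qed

text \<open>An eigenfunction all of whose values and normal derivatives at the corners of the \<open>N\<close>-cells
  vanish is a sum of localized ones; these are \<open>6 \<cdot> 3^N\<close> conditions.\<close>

lemma eigenspace_basis:
  obtains A R where "finite A" "fun_space.independent A" "fun_space.span A = loc_space (l / 5 ^ N)"
    "finite R" "loc_basis N A \<inter> R = {}" "fun_space.independent (loc_basis N A \<union> R)"
    "fun_space.span (loc_basis N A \<union> R) = eigenspace l" "card R \<le> 6 * 3 ^ N"
proof -
  have "loc_space (l / 5 ^ N) \<subseteq> eigenspace (l / 5 ^ N)" using loc_space_eigenspace by blast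
  from eigenspace_subspace_basis[OF subspace_loc_space this fun_space.independent_empty]
  obtain A where A: "finite A" "fun_space.independent A" "fun_space.span A = loc_space (l / 5 ^ N)" by blast
  have AL: "A \<subseteq> loc_space (l / 5 ^ N)" using fun_space.span_superset[of A] A(3) by simp
  have iL: "fun_space.independent (loc_basis N A)" by (rule independent_loc_basis[OF A(2,1) AL])
  have LE: "loc_basis N A \<subseteq> eigenspace l"
  proof
    fix b assume "b \<in> loc_basis N A"
    then obtain w a where "w \<in> words N" "a \<in> A" "b = loc w a" unfolding loc_basis_def by auto
    then show "b \<in> eigenspace l" using loc_space_eigenspace[OF loc_loc_space] AL by blast
  qed
  from eigenspace_subspace_basis[OF subspace_eigenspace order_refl iL LE]
  obtain B where B: "finite B" "loc_basis N A \<subseteq> B" "fun_space.independent B" "fun_space.span B = eigenspace l" by blast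
  define R where "R = B - loc_basis N A"
  have R: "finite R" "loc_basis N A \<inter> R = {}" "loc_basis N A \<union> R = B" using B(1,2) by (auto simp: R_def)
  have RE: "b \<in> eigenspace l" if "b \<in> R" for b
    using fun_space.span_superset[of B] B(4) that R_def by blast
  have "card R \<le> 6 * 3 ^ N"
  proof (rule ccontr)
    assume "\<not> card R \<le> 6 * 3 ^ N"
    \<comment> \<open>One condition for each cell, each corner and each kind: \<open>True\<close>
      stands for the value, \<open>False\<close> for the normal derivative.\<close>
    define I where "I = words N \<times> ({1,2,3::nat} \<times> (UNIV :: bool set))"
    have I: "finite I" "card I = 6 * 3 ^ N"
      unfolding I_def using finite_words by (simp_all add: card_cartesian_product card_words)
    define \<phi> :: "(point \<Rightarrow> real) \<Rightarrow> nat list \<times> nat \<times> bool \<Rightarrow> real" where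
      "\<phi> b s = (case s of (w, i, t) \<Rightarrow> if t then b (word_map w (corner i))
        else lim (\<lambda>m. (5/3) ^ m * corner_diff m (b \<circ> word_map w) i))" for b s
    have lt: "card I < card R" using I(2) \<open>\<not> card R \<le> 6 * 3 ^ N\<close> by simp
    obtain c where c: "\<exists>b\<in>R. c b \<noteq> 0" "\<forall>s\<in>I. (\<Sum>b\<in>R. c b * \<phi> b s) = 0"
      using linear_system_nontrivial[OF I(1) R(1) lt, of \<phi>] by blast
    define u where "u = (\<Sum>b\<in>R. (\<lambda>x. c b * b x))"
    have uE: "u \<in> eigenspace l" unfolding u_def by (rule comb_subspace[OF subspace_eigenspace]) (use RE in blast)
    have u0: "u (word_map w (corner i)) = 0" if "w \<in> words N" "i \<in> {1,2,3}" for w i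
    proof -
      have "(w, i, True) \<in> I" using that unfolding I_def by blast
      from bspec[OF c(2) this] show ?thesis unfolding u_def comb_apply by (simp add: \<phi>_def)
    qed
    have ud: "(\<lambda>m. (5/3) ^ m * corner_diff m (u \<circ> word_map w) i) \<longlonglongrightarrow> 0" if w: "w \<in> words N" and i: "i \<in> {1,2,3}" for w i
      unfolding u_def
    proof (rule word_corner_limit_sum[OF R(1)])
      have "(w, i, False) \<in> I" using that unfolding I_def by blast
      from bspec[OF c(2) this]
      show "(\<Sum>b\<in>R. c b * lim (\<lambda>m. (5/3) ^ m * corner_diff m (b \<circ> word_map w) i)) = 0" by (simp add: \<phi>_def)
      fix b assume "b \<in> R"
      then have "has_laplacian b (\<lambda>x. - (l * b x))" using RE by (simp only: eigenspace_iff)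
      from corner_diff_convergent[OF has_laplacian_word_map[OF this w] i]
      show "convergent (\<lambda>m. (5/3) ^ m * corner_diff m (b \<circ> word_map w) i)" .
    qed
    have zl: "zero_ext (u \<circ> word_map w) \<in> loc_space (l / 5 ^ N)" if w: "w \<in> words N" for w
      by (rule eigenfunction_localize[OF uE w u0[OF w] ud[OF w]])
    have "u = (\<Sum>w\<in>words N. loc w (zero_ext (u \<circ> word_map w)))"
      by (rule sum_loc_eq[OF zl eigenspace_outside[OF uE]])
    also have "\<dots> \<in> fun_space.span (loc_basis N A)"
    proof (rule fun_space.span_sum)
      fix w assume w: "w \<in> words N"
      have "loc w (zero_ext (u \<circ> word_map w)) \<in> fun_space.span (loc w ` A)"
        by (rule loc_span) (use zl[OF w] A(3) in simp)
      moreover have "loc w ` A \<subseteq> loc_basis N A" unfolding loc_basis_def using w by auto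
      ultimately show "loc w (zero_ext (u \<circ> word_map w)) \<in> fun_space.span (loc_basis N A)"
        using fun_space.span_mono by blast
    qed
    finally have us: "u \<in> fun_space.span (loc_basis N A)" .
    have fL: "finite (loc_basis N A)" using finite_subset[OF B(2,1)] .
    obtain d where d: "u = (\<Sum>b\<in>loc_basis N A. (\<lambda>x. d b * b x))"
      using us fun_space.span_finite[OF fL] by auto
    \<comment> \<open>Subtracting the localized expansion of \<open>u\<close> from its expansion in
      \<open>R\<close> gives a relation in \<open>B\<close> with a nonzero coefficient.\<close>
    define e where "e b = (if b \<in> R then c b else - d b)" for b
    have "(\<Sum>b\<in>B. (\<lambda>x. e b * b x)) = 0"
    proof
      fix x
      have "(\<Sum>b\<in>B. e b * b x) = (\<Sum>b\<in>loc_basis N A. e b * b x) + (\<Sum>b\<in>R. e b * b x)"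
        unfolding R(3)[symmetric] by (rule sum.union_disjoint[OF fL R(1,2)])
      also have "(\<Sum>b\<in>R. e b * b x) = u x" unfolding u_def comb_apply by (rule sum.cong) (simp_all add: e_def)
      also have "(\<Sum>b\<in>loc_basis N A. e b * b x) = (\<Sum>b\<in>loc_basis N A. - (d b * b x))"
        by (rule sum.cong) (use R(2) in \<open>auto simp: e_def\<close>)
      also have "\<dots> = - u x" by (subst d) (simp add: comb_apply sum_negf)
      finally show "(\<Sum>b\<in>B. (\<lambda>x. e b * b x)) x = 0 x" unfolding comb_apply by simp
    qed
    then have "e b = 0" if "b \<in> B" for b using fun_space.independentD[OF B(3,1) order_refl] that by blast
    moreover obtain b where b: "b \<in> R" "c b \<noteq> 0" using c(1) by blast
    ultimately have "e b = 0" using R(3) by blast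
    then show False using b by (simp add: e_def)
  qed
  then show thesis using that[OF A R(1,2)] B(3,4) R(3) by blast
qed

section \<open>The determinant estimate\<close>

definition wform :: "(point \<Rightarrow> real) \<Rightarrow> (point \<Rightarrow> real) \<Rightarrow> (point \<Rightarrow> real) \<Rightarrow> real" where
  "wform f u v = (LINT x|sg_measure. f x * (u x * v x))"

text \<open>Prescribing 0 outside SG ensures that a nonzero function is nonzero somewhere on SG;
  definiteness of \<open>wform\<close> depends on it.\<close>

definition cspace :: "(point \<Rightarrow> real) set" where
  "cspace = {u. continuous_on SG u \<and> (\<forall>x. x \<notin> SG \<longrightarrow> u x = 0)}"

lemma cspaceD: "u \<in> cspace \<Longrightarrow> continuous_on SG u" "u \<in> cspace \<Longrightarrow> x \<notin> SG \<Longrightarrow> u x = 0"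
  unfolding cspace_def by blast+

lemma subspace_cspace: "fun_space.subspace cspace"
  by (rule fun_space.subspaceI)
    (auto simp: cspace_def plus_fun_def zero_fun_def intro!: continuous_intros)

lemma eigenspace_cspace: "eigenspace l \<subseteq> cspace"
  unfolding cspace_def using eigenspace_iff has_laplacianD(1) by blast

lemma integrable_wform:
  assumes "continuous_on SG f" "u \<in> cspace" "v \<in> cspace"
  shows "integrable sg_measure (\<lambda>x. f x * (u x * v x))"
  by (intro integrable_sg_continuous continuous_on_mult assms(1) cspaceD(1)[OF assms(2)] cspaceD(1)[OF assms(3)])

lemma weighted_form_wform:
  assumes f: "continuous_on SG f" "\<And>x. x \<in> SG \<Longrightarrow> f x > 0"
  shows "weighted_form cspace (wform f)"
proof
  show "fun_space.subspace cspace" by (rule subspace_cspace)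
  fix u v w assume u: "u \<in> cspace" and v: "v \<in> cspace" and w: "w \<in> cspace"
  have "wform f (u + v) w = (LINT x|sg_measure. f x * (u x * w x) + f x * (v x * w x))"
    unfolding wform_def by (rule Bochner_Integration.integral_cong) (simp_all add: algebra_simps)
  also have "\<dots> = wform f u w + wform f v w"
    unfolding wform_def by (rule Bochner_Integration.integral_add[OF integrable_wform[OF f(1) u w] integrable_wform[OF f(1) v w]])
  finally show "wform f (u + v) w = wform f u w + wform f v w" .
next
  fix c u v assume u: "u \<in> cspace" and v: "v \<in> cspace"
  have "wform f (\<lambda>x. c * u x) v = (LINT x|sg_measure. c * (f x * (u x * v x)))"
    unfolding wform_def by (rule Bochner_Integration.integral_cong) (simp_all add: mult_ac)
  then show "wform f (\<lambda>x. c * u x) v = c * wform f u v" unfolding wform_def by simp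
next
  fix u v assume "u \<in> cspace" "v \<in> cspace"
  show "wform f u v = wform f v u" unfolding wform_def by (simp only: mult.commute[of "u _"])
next
  fix u assume u: "u \<in> cspace" and u0: "u \<noteq> 0"
  obtain x where x: "u x \<noteq> 0" using u0 by (auto simp: fun_eq_iff)
  have xS: "x \<in> SG" using cspaceD(2)[OF u] x by blast
  show "wform f u u > 0"
    unfolding wform_def
  proof (rule integral_sg_pos[OF _ _ xS])
    show "continuous_on SG (\<lambda>x. f x * (u x * u x))" by (intro continuous_on_mult f(1) cspaceD(1)[OF u])
    show "0 \<le> f y * (u y * u y)" if "y \<in> SG" for y using less_imp_le[OF f(2)[OF that]] by simp
    show "0 < f x * (u x * u x)" by (rule mult_pos_pos[OF f(2)[OF xS]]) (use x not_real_square_gt_zero in blast)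
  qed
qed

lemma weighted_form_subspace:
  assumes "weighted_form E g" "fun_space.subspace F" "F \<subseteq> E"
  shows "weighted_form F g"
proof -
  interpret weighted_form E g by (rule assms(1))
  show ?thesis
  proof
    show "fun_space.subspace F" by (rule assms(2))
    show "g (u + v) w = g u w + g v w" if "u \<in> F" "v \<in> F" "w \<in> F" for u v w
      using that assms(3) by (intro add_left) blast+
    show "g (\<lambda>x. c * u x) v = c * g u v" if "u \<in> F" "v \<in> F" for c u v
      using that assms(3) by (intro scale_left) blast+
    show "g u v = g v u" if "u \<in> F" "v \<in> F" for u v
      using that assms(3) by (intro sym) blast+
    show "g u u > 0" if "u \<in> F" "u \<noteq> 0" for u
      using that assms(3) by (intro pos) blast+
  qed
qed

lemma L2_inner_wform: "L2_inner u v = wform (\<lambda>_. 1) u v"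
  by (simp add: L2_inner_def wform_def)

text \<open>Definiteness leaves only one function satisfying the orthogonality conditions, so the
  definite description denotes the projection.\<close>

lemma ortho_proj:
  assumes E: "fun_space.subspace E" "E \<subseteq> cspace" and B: "finite B" "fun_space.span B = E" and g: "g \<in> cspace"
  shows "ortho_proj E g \<in> E" "\<And>v. v \<in> E \<Longrightarrow> wform (\<lambda>_. 1) (ortho_proj E g) v = wform (\<lambda>_. 1) g v"
proof -
  interpret weighted_form cspace "wform (\<lambda>_. 1)" by (rule weighted_form_wform) auto
  have BE: "B \<subseteq> cspace" using fun_space.span_superset[of B] B(2) E(2) by blast
  obtain p where p: "p \<in> E" "\<And>v. v \<in> E \<Longrightarrow> wform (\<lambda>_. 1) (g - p) v = 0"
    using projection_exists[OF B(1) BE g] unfolding B(2) by blast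
  have u: "h = p" if h: "h \<in> E" "\<And>v. v \<in> E \<Longrightarrow> wform (\<lambda>_. 1) (g - h) v = 0" for h
  proof (rule ccontr)
    assume ne: "h \<noteq> p"
    have d: "p - h \<in> E" by (rule fun_space.subspace_diff[OF E(1) p(1) h(1)])
    have m: "p \<in> cspace" "h \<in> cspace" "p - h \<in> cspace" using p(1) h(1) d E(2) by blast+
    have "wform (\<lambda>_. 1) (g - h) (p - h) - wform (\<lambda>_. 1) (g - p) (p - h) = wform (\<lambda>_. 1) (p - h) (p - h)"
      unfolding diff_left[OF g m(2,3)] diff_left[OF g m(1,3)] diff_left[OF m(1,2,3)] by simp
    then have "wform (\<lambda>_. 1) (p - h) (p - h) = 0" using p(2)[OF d] h(2)[OF d] by simp
    moreover have "wform (\<lambda>_. 1) (p - h) (p - h) > 0" by (rule pos[OF m(3)]) (use ne in simp)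
    ultimately show False by simp
  qed
  have "ortho_proj E g = p"
    unfolding ortho_proj_def L2_inner_wform by (rule the_equality) (use p u in blast)+
  then show "ortho_proj E g \<in> E" "\<And>v. v \<in> E \<Longrightarrow> wform (\<lambda>_. 1) (ortho_proj E g) v = wform (\<lambda>_. 1) g v"
    using p diff_left[OF g] E(2) by (auto simp: subset_eq)
qed

lemma mult_cspace: "continuous_on SG f \<Longrightarrow> u \<in> cspace \<Longrightarrow> mult_op f u \<in> cspace"
  unfolding cspace_def mult_op_def by (auto intro!: continuous_on_mult)

text \<open>On \<open>E\<close> the inner projection is the identity, so the operator represents the
  form with weight \<open>f\<close> relative to the form with weight 1.\<close>

lemma operator_det_gram:
  assumes E: "fun_space.subspace E" "E \<subseteq> cspace" and f: "continuous_on SG f" "\<And>x. x \<in> SG \<Longrightarrow> f x > 0"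
    and es: "distinct es" "fun_space.independent (set es)" "fun_space.span (set es) = E"
  shows "operator_det E (ortho_proj E \<circ> mult_op f \<circ> ortho_proj E)
    = det (gram (wform f) (length es) ((!) es)) / det (gram (wform (\<lambda>_. 1)) (length es) ((!) es))"
proof -
  have W1: "weighted_form cspace (wform (\<lambda>_. 1))" by (rule weighted_form_wform) auto
  interpret W: weighted_form cspace "wform (\<lambda>_. 1)" by (rule W1)
  note P = ortho_proj[OF E finite_set es(3)]
  have Pid: "ortho_proj E u = u" if u: "u \<in> E" for u
  proof (rule ccontr)
    assume ne: "ortho_proj E u \<noteq> u"
    have uc: "u \<in> cspace" using u E(2) by blast
    have pE: "ortho_proj E u \<in> E" by (rule P(1)[OF uc])
    have d: "ortho_proj E u - u \<in> E" by (rule fun_space.subspace_diff[OF E(1) pE u])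
    have "wform (\<lambda>_. 1) (ortho_proj E u - u) (ortho_proj E u - u) = 0"
      using W.diff_left[of "ortho_proj E u" u "ortho_proj E u - u"] P(2)[OF uc d] pE uc d E(2) by (simp add: subset_eq)
    moreover have "wform (\<lambda>_. 1) (ortho_proj E u - u) (ortho_proj E u - u) > 0"
      by (rule W.pos) (use d E(2) ne in auto)
    ultimately show False by simp
  qed
  define bs where "bs = (SOME bs. distinct bs \<and> fun_space.independent (set bs) \<and> fun_space.span (set bs) = E)"
  have bs: "distinct bs \<and> fun_space.independent (set bs) \<and> fun_space.span (set bs) = E"
    unfolding bs_def by (rule someI[where x = es]) (use es in blast)
  let ?T = "ortho_proj E \<circ> mult_op f \<circ> ortho_proj E"
  have T: "?T u \<in> E" "v \<in> E \<Longrightarrow> wform (\<lambda>_. 1) (?T u) v = wform f u v" if u: "u \<in> E" for u v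
  proof -
    have m: "mult_op f u \<in> cspace" using mult_cspace[OF f(1)] u E(2) by blast
    show "?T u \<in> E" using P(1)[OF m] by (simp add: Pid[OF u])
    show "wform (\<lambda>_. 1) (?T u) v = wform f u v" if v: "v \<in> E"
    proof -
      have "wform (\<lambda>_. 1) (?T u) v = wform (\<lambda>_. 1) (mult_op f u) v" using P(2)[OF m v] by (simp add: Pid[OF u])
      also have "\<dots> = wform f u v" by (simp add: wform_def mult_op_def mult.assoc)
      finally show ?thesis .
    qed
  qed
  have "det (mat (length bs) (length bs) (\<lambda>(i, k). fun_space.representation (set bs) (?T (bs ! k)) (bs ! i)))
    = det (gram (wform f) (length es) ((!) es)) / det (gram (wform (\<lambda>_. 1)) (length es) ((!) es))"
    by (rule det_representation[where E = E])
      (use bs es T weighted_form_subspace[OF W1 E] weighted_form_subspace[OF weighted_form_wform[OF f] E] in auto)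
  then show ?thesis unfolding operator_det_def Let_def bs_def .
qed

text \<open>In general this cut-off destroys continuity; spans of localized functions are preserved
  by it.\<close>

definition restr :: "nat list \<Rightarrow> (point \<Rightarrow> real) \<Rightarrow> point \<Rightarrow> real" where
  "restr w u x = (if x \<in> cell w then u x else 0)"

lemma restr_add: "restr w (u + v) = restr w u + restr w v"
  by (auto simp: restr_def fun_eq_iff)
lemma restr_diff: "restr w (u - v) = restr w u - restr w v"
  by (auto simp: restr_def fun_eq_iff)
lemma restr_scale: "restr w (\<lambda>x. c * u x) = (\<lambda>x. c * restr w u x)"
  by (auto simp: restr_def fun_eq_iff)
lemma restr_zero: "restr w 0 = 0"
  by (auto simp: restr_def fun_eq_iff)

text \<open>A function placed in a cell vanishes at the corners of that cell, so the points shared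
  with a neighbouring closed cell contribute nothing.\<close>

lemma restr_loc:
  assumes a: "a \<in> loc_space (l / 5 ^ n)" and w: "w \<in> words n" and v: "v \<in> words n"
  shows "restr w (loc v a) = (if v = w then loc v a else 0)"
proof
  fix x
  have out: "loc v a x = 0" if "x \<notin> SG"
    by (rule eigenspace_outside[OF loc_space_eigenspace[OF loc_loc_space[OF a v]] that])
  show "restr w (loc v a) x = (if v = w then loc v a else 0) x"
  proof (cases "x \<in> cell w")
    case True
    then obtain y where y: "y \<in> SG" "x = word_map w y" unfolding cell_def by blast
    show ?thesis
    proof (cases "v = w")
      case False
      then show ?thesis using loc_apply[OF a v w y(1)] y(2) True by (simp add: restr_def)
    next
      case eq: True
      show ?thesis unfolding eq using True by (simp add: restr_def)
    qed
  next
    case False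
    have "loc w a x = 0"
    proof (cases "x \<in> SG")
      case True
      then obtain q where q: "q \<in> words n" "x \<in> cell q" using subsetD[OF equalityD1[OF SG_cells[of n]] True] by blast
      then obtain y where y: "y \<in> SG" "x = word_map q y" unfolding cell_def by blast
      have "w \<noteq> q" using False q(2) by blast
      then show ?thesis using loc_apply[OF a w q(1) y(1)] y(2) by simp
    qed (rule eigenspace_outside[OF loc_space_eigenspace[OF loc_loc_space[OF a w]]])
    then show ?thesis using False by (auto simp: restr_def)
  qed
qed

lemma restr_span:
  assumes S: "\<And>s. s \<in> S \<Longrightarrow> restr w s \<in> fun_space.span S" and v: "v \<in> fun_space.span S"
  shows "restr w v \<in> fun_space.span S"
proof -
  have "fun_space.subspace {v. restr w v \<in> fun_space.span S}"
    by (intro fun_space.subspaceI) (auto simp: restr_add restr_scale restr_zero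
      intro: fun_space.span_zero fun_space.span_add fun_space.span_scale)
  then have "fun_space.span S \<subseteq> {v. restr w v \<in> fun_space.span S}"
    by (intro fun_space.span_minimal) (auto intro: S)
  then show ?thesis using v by blast
qed

lemma wform_mono:
  assumes "continuous_on SG f" "continuous_on SG g" "u \<in> cspace" "v \<in> cspace"
    and "\<And>x. x \<in> SG \<Longrightarrow> f x * (u x * u x) \<le> g x * (v x * v x)"
  shows "wform f u u \<le> wform g v v"
  unfolding wform_def
  by (intro integral_mono integrable_wform assms(1-4)) (use assms(5) space_sg in auto)

lemma wform_const: "c * wform (\<lambda>_. 1) u u = wform (\<lambda>_. c) u u"
  unfolding wform_def by simp

text \<open>The quotient of the Gram determinants is squeezed between the products of the extremal
  values of \<open>f\<close> over the cells carrying the localized basis functions.\<close>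

lemma log_det_estimate:
  assumes f: "continuous_on SG f" "\<And>x. x \<in> SG \<Longrightarrow> f x > 0"
    and osc: "\<And>w x y. w \<in> words N \<Longrightarrow> x \<in> cell w \<Longrightarrow> y \<in> cell w \<Longrightarrow> \<bar>ln (f x) - ln (f y)\<bar> \<le> \<omega>"
    and bd: "\<And>x. x \<in> SG \<Longrightarrow> \<bar>ln (f x)\<bar> \<le> \<Lambda>"
    and E: "E = eigenspace l" and d: "d = fun_space.dim E" "d > 0"
  shows "\<bar>1 / real d * ln (operator_det E (ortho_proj E \<circ> mult_op f \<circ> ortho_proj E))
    - (LINT x|sg_measure. ln (f x))\<bar> \<le> 2 * \<omega> + 12 * \<Lambda> * 3 ^ N / real d"
proof -
  obtain A R where A: "finite A" "fun_space.independent A" "fun_space.span A = loc_space (l / 5 ^ N)"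
    and R: "finite R" "loc_basis N A \<inter> R = {}" "fun_space.independent (loc_basis N A \<union> R)"
    "fun_space.span (loc_basis N A \<union> R) = eigenspace l" "card R \<le> 6 * 3 ^ N"
    by (rule eigenspace_basis)
  have AL: "a \<in> loc_space (l / 5 ^ N)" if "a \<in> A" for a using fun_space.span_base[OF that] A(3) by simp
  have EC: "fun_space.subspace E" "E \<subseteq> cspace" unfolding E by (rule subspace_eigenspace, rule eigenspace_cspace)
  have fW: "finite (words N \<times> A)" using finite_words A(1) by blast
  obtain ps where ps: "set ps = words N \<times> A" "distinct ps" using finite_distinct_list[OF fW] by blast
  obtain rs where rs: "set rs = R" "distinct rs" using finite_distinct_list[OF R(1)] by blast
  \<comment> \<open>The localized functions come first: all predecessors of a localized basis vector
    are then localized, and restriction to a cell preserves their span.\<close>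
  define es where "es = map (\<lambda>(w, a). loc w a) ps @ rs"
  have inj: "inj_on (\<lambda>(w, a). loc w a) (set ps)"
    unfolding ps(1) by (rule inj_loc[OF A(2,1)]) (use AL in blast)
  have set_es: "set es = loc_basis N A \<union> R" unfolding es_def loc_basis_def using ps(1) rs(1) by simp
  have dist_es: "distinct es"
    unfolding es_def using ps rs inj R(2) by (simp add: distinct_map loc_basis_def)
  define n where "n = length es"
  define p where "p = length ps"
  have p: "p = 3 ^ N * card A"
    unfolding p_def distinct_card[OF ps(2), symmetric] ps(1) by (simp add: card_cartesian_product card_words)
  have n: "n = p + card R" unfolding n_def es_def p_def using distinct_card[OF rs(2)] rs(1) by simp
  have dn: "d = n"
    using fun_space.dim_span_eq_card_independent[OF R(3)] distinct_card[OF dist_es]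
    unfolding d(1) E R(4)[symmetric] fun_space.dim_span set_es n_def by simp
  let ?b = "(!) es"
  let ?h = "wform (\<lambda>_. 1)"
  have W: "weighted_form cspace (wform f)" "weighted_form cspace ?h" 
    by (rule weighted_form_wform[OF f]) (assumption, rule weighted_form_wform, auto)
  have bm: "?b i \<in> set es" if "i < n" for i using that unfolding n_def by simp
  have bE: "?b i \<in> cspace" if "i < n" for i
    using bm[OF that] fun_space.span_superset[of "set es"] EC(2) unfolding set_es R(4) E by blast
  have im: "?b ` {..<n} = set es" by (auto simp: set_conv_nth n_def)
  have injb: "inj_on ?b {..<n}" using dist_es by (auto simp: inj_on_def nth_eq_iff_index_eq n_def)
  have ind: "fun_space.independent (?b ` {..<n})" unfolding im set_es by (rule R(3))
  define c1 where "c1 = corner 1"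
  have c1: "c1 \<in> SG" unfolding c1_def by (rule corner_SG) simp
  define a where "a w = ln (f (word_map w c1))" for w
  have cw: "word_map w c1 \<in> cell w" for w unfolding cell_def using c1 by blast
  have aw: "\<bar>ln (f x) - a w\<bar> \<le> \<omega>" if "w \<in> words N" "x \<in> cell w" for w x
    unfolding a_def by (rule osc[OF that cw])
  define hi where "hi k = (if k < p then exp (a (fst (ps ! k)) + \<omega>) else exp \<Lambda>)" for k
  define lo where "lo k = (if k < p then exp (a (fst (ps ! k)) - \<omega>) else exp (- \<Lambda>))" for k
  \<comment> \<open>For a localized vector the competitor is cut to its cell, where \<open>f\<close>
    lies between \<open>lo k\<close> and \<open>hi k\<close>; the other vectors use the global
    bounds.\<close>
  define rho where "rho k = (if k < p then restr (fst (ps ! k)) else (\<lambda>u. u))" for k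
  have psk: "fst (ps ! k) \<in> words N" "snd (ps ! k) \<in> A" "?b k = loc (fst (ps ! k)) (snd (ps ! k))" if "k < p" for k
  proof -
    have "ps ! k \<in> words N \<times> A" using nth_mem[of k ps] that unfolding p_def ps(1) by blast
    then show "fst (ps ! k) \<in> words N" "snd (ps ! k) \<in> A" by auto
    show "?b k = loc (fst (ps ! k)) (snd (ps ! k))"
      using that unfolding es_def p_def by (simp add: nth_append case_prod_unfold)
  qed
  have rb: "rho k (?b k) = ?b k" if "k < n" for k
    using psk[of k] restr_loc[OF AL] by (simp add: rho_def)
  have rdiff: "rho k (u - v) = rho k u - rho k v" for k u v by (simp add: rho_def restr_diff)
  have rspan: "rho k v \<in> fun_space.span (?b ` {..<k})" if k: "k < n" and v: "v \<in> fun_space.span (?b ` {..<k})" for k v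
  proof (cases "k < p")
    case True
    have "restr (fst (ps ! k)) v \<in> fun_space.span (?b ` {..<k})"
    proof (rule restr_span[OF _ v])
      fix s assume "s \<in> ?b ` {..<k}"
      then obtain i where i: "i < k" "s = ?b i" by blast
      then have "restr (fst (ps ! k)) s = (if fst (ps ! i) = fst (ps ! k) then s else 0)"
        using psk[of i] psk[of k] True restr_loc[OF AL] by simp
      moreover have "s \<in> fun_space.span (?b ` {..<k})" using i by (intro fun_space.span_base) blast
      ultimately show "restr (fst (ps ! k)) s \<in> fun_space.span (?b ` {..<k})"
        by (simp add: fun_space.span_zero)
    qed
    then show ?thesis using True by (simp add: rho_def)
  qed (simp add: rho_def v)
  have spanE: "v \<in> cspace" if "k < n" "v \<in> fun_space.span (?b ` {..<k})" for k v
  proof -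
    have "?b ` {..<k} \<subseteq> cspace" using bE that(1) by force
    then show ?thesis using fun_space.span_minimal[OF _ subspace_cspace] that(2) by blast
  qed
  have pt: "f x * (rho k u x * rho k u x) \<le> hi k * (u x * u x)" "lo k * (rho k u x * rho k u x) \<le> f x * (u x * u x)"
    if k: "k < n" and x: "x \<in> SG" for k u x
  proof -
    have fx: "f x = exp (ln (f x))" "f x > 0" using f(2)[OF x] by simp_all
    have sq: "0 \<le> u x * u x" by simp
    have "\<bar>ln (f x)\<bar> \<le> \<Lambda>" by (rule bd[OF x])
    then have L: "f x \<le> exp \<Lambda>" "exp (- \<Lambda>) \<le> f x" by (subst fx(1), simp)+
    have C: "f x \<le> exp (a w + \<omega>)" "exp (a w - \<omega>) \<le> f x" if "w \<in> words N" "x \<in> cell w" for w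
      using aw[OF that] by (subst fx(1), simp)+
    have "f x * (rho k u x * rho k u x) \<le> hi k * (u x * u x) \<and> lo k * (rho k u x * rho k u x) \<le> f x * (u x * u x)"
    proof (cases "k < p")
      case True
      show ?thesis
      proof (cases "x \<in> cell (fst (ps ! k))")
        case c: True
        note C' = C[OF psk(1)[OF True] c]
        show ?thesis using True c mult_right_mono[OF C'(1) sq] mult_right_mono[OF C'(2) sq]
          by (simp add: rho_def restr_def hi_def lo_def)
      next
        case False
        then show ?thesis using True fx(2) sq by (simp add: rho_def restr_def hi_def)
      qed
    next
      case False
      then show ?thesis using mult_right_mono[OF L(1) sq] mult_right_mono[OF L(2) sq]
        by (simp add: rho_def hi_def lo_def)
    qed
    then show "f x * (rho k u x * rho k u x) \<le> hi k * (u x * u x)" "lo k * (rho k u x * rho k u x) \<le> f x * (u x * u x)"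
      by blast+
  qed
  have R1: "\<exists>q\<in>fun_space.span (?b ` {..<k}). wform f (?b k - q) (?b k - q) \<le> hi k * ?h (?b k - v) (?b k - v)"
    if k: "k < n" and v: "v \<in> fun_space.span (?b ` {..<k})" for k v
  proof (rule bexI[OF _ rspan[OF k v]])
    have m: "?b k - v \<in> cspace" "?b k - rho k v \<in> cspace"
      using bE[OF k] spanE[OF k v] spanE[OF k rspan[OF k v]] fun_space.subspace_diff[OF subspace_cspace] by blast+
    have e: "?b k - rho k v = rho k (?b k - v)" unfolding rdiff rb[OF k] ..
    show "wform f (?b k - rho k v) (?b k - rho k v) \<le> hi k * ?h (?b k - v) (?b k - v)"
      unfolding wform_const by (rule wform_mono[OF f(1) continuous_on_const m(2,1)]) (unfold e, rule pt(1)[OF k])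
  qed
  have R2: "\<exists>q\<in>fun_space.span (?b ` {..<k}). lo k * ?h (?b k - q) (?b k - q) \<le> wform f (?b k - v) (?b k - v)"
    if k: "k < n" and v: "v \<in> fun_space.span (?b ` {..<k})" for k v
  proof (rule bexI[OF _ rspan[OF k v]])
    have m: "?b k - v \<in> cspace" "?b k - rho k v \<in> cspace"
      using bE[OF k] spanE[OF k v] spanE[OF k rspan[OF k v]] fun_space.subspace_diff[OF subspace_cspace] by blast+
    have e: "?b k - rho k v = rho k (?b k - v)" unfolding rdiff rb[OF k] ..
    show "lo k * ?h (?b k - rho k v) (?b k - rho k v) \<le> wform f (?b k - v) (?b k - v)"
      unfolding wform_const by (rule wform_mono[OF continuous_on_const f(1) m(2,1)]) (unfold e, rule pt(2)[OF k])
  qed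
  have lo0: "lo k > 0" for k by (simp add: lo_def)
  define X where "X = operator_det E (ortho_proj E \<circ> mult_op f \<circ> ortho_proj E)"
  have X: "X = det (gram (wform f) n ?b) / det (gram ?h n ?b)"
    unfolding X_def n_def
    by (rule operator_det_gram[OF EC f dist_es]) (use R(3,4) set_es E in simp_all)
  have ratio: "(\<Prod>k<n. lo k) \<le> X" "X \<le> (\<Prod>k<n. hi k)"
    unfolding X by (rule det_gram_ratio[OF W bE injb ind R1 R2 lo0]; assumption)+
  \<comment> \<open>Every cell carries the same number \<open>card A\<close> of localized functions,
    so the values at the cells enter with equal weights, as they do in the integral.\<close>
  have sums: "(\<Sum>k<n. if k < p then g (fst (ps ! k)) else t) = real (card A) * (\<Sum>w\<in>words N. g w) + real (card R) * t"
    for g :: "nat list \<Rightarrow> real" and t :: real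
  proof -
    have "(\<Sum>k<n. if k < p then g (fst (ps ! k)) else t) = (\<Sum>k<p. g (fst (ps ! k))) + (\<Sum>k\<in>{p..<n}. t)"
    proof -
      have U: "{..<n} = {..<p} \<union> {p..<n}" using n by auto
      have "(\<Sum>k<n. if k < p then g (fst (ps ! k)) else t) =
        (\<Sum>k<p. if k < p then g (fst (ps ! k)) else t) + (\<Sum>k\<in>{p..<n}. if k < p then g (fst (ps ! k)) else t)"
        by (subst U, rule sum.union_disjoint) auto
      also have "(\<Sum>k<p. if k < p then g (fst (ps ! k)) else t) = (\<Sum>k<p. g (fst (ps ! k)))" by (rule sum.cong) auto
      also have "(\<Sum>k\<in>{p..<n}. if k < p then g (fst (ps ! k)) else t) = (\<Sum>k\<in>{p..<n}. t)" by (rule sum.cong) auto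
      finally show ?thesis .
    qed
    also have "(\<Sum>k<p. g (fst (ps ! k))) = (\<Sum>z\<in>set ps. g (fst z))"
    proof -
      have "inj_on ((!) ps) {..<p}" using ps(2) by (auto simp: inj_on_def nth_eq_iff_index_eq p_def)
      moreover have "set ps = (!) ps ` {..<p}" by (auto simp: set_conv_nth p_def)
      ultimately show ?thesis by (simp add: sum.reindex)
    qed
    also have "(\<Sum>z\<in>set ps. g (fst z)) = (\<Sum>w\<in>words N. \<Sum>a\<in>A. g w)"
      unfolding ps(1) sum.cartesian_product by (simp only: case_prod_unfold)
    finally show ?thesis using n by (simp add: sum_distrib_left mult.commute)
  qed
  define K where "K = real (card A) * 3 ^ N"
  define r where "r = real (card R)"
  define S where "S = (\<Sum>w\<in>words N. a w)"
  have K0: "K \<ge> 0" "r \<ge> 0" by (simp_all add: K_def r_def)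
  have dK: "real d = K + r" unfolding dn n p K_def r_def by simp
  have Xpos: "X > 0" by (rule less_le_trans[OF prod_pos ratio(1)]) (rule lo0)
  have lnprod: "ln (\<Prod>k<n. exp (g k)) = (\<Sum>k<n. g k)" for g :: "nat \<Rightarrow> real"
    by (simp flip: exp_sum)
  have hi_eq: "hi = (\<lambda>k. exp (if k < p then a (fst (ps ! k)) + \<omega> else \<Lambda>))" by (auto simp: hi_def)
  have lo_eq: "lo = (\<lambda>k. exp (if k < p then a (fst (ps ! k)) - \<omega> else - \<Lambda>))" by (auto simp: lo_def)
  have "ln X \<le> ln (\<Prod>k<n. hi k)" by (rule ln_mono[OF ratio(2) Xpos])
  also have "\<dots> = real (card A) * (\<Sum>w\<in>words N. a w + \<omega>) + r * \<Lambda>"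
    unfolding hi_eq lnprod r_def by (rule sums[of "\<lambda>w. a w + \<omega>"])
  also have "\<dots> = real (card A) * S + K * \<omega> + r * \<Lambda>"
    by (simp add: sum.distrib S_def K_def card_words algebra_simps)
  finally have up: "ln X \<le> real (card A) * S + K * \<omega> + r * \<Lambda>" .
  have "real (card A) * S - K * \<omega> - r * \<Lambda> = real (card A) * (\<Sum>w\<in>words N. a w - \<omega>) + r * (- \<Lambda>)"
    by (simp add: sum_subtractf S_def K_def card_words algebra_simps)
  also have "\<dots> = ln (\<Prod>k<n. lo k)"
    unfolding lo_eq lnprod r_def by (rule sums[of "\<lambda>w. a w - \<omega>", symmetric])
  also have "\<dots> \<le> ln X" by (rule ln_mono[OF ratio(1) prod_pos]) (rule lo0)
  finally have low: "real (card A) * S - K * \<omega> - r * \<Lambda> \<le> ln X" .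
  define J where "J = (LINT x|sg_measure. ln (f x))"
  have lnc: "continuous_on SG (\<lambda>x. ln (f x))" using f by (intro continuous_on_ln) (auto simp: less_imp_neq[symmetric])
  have JS: "\<bar>J - S / 3 ^ N\<bar> \<le> \<omega>" unfolding J_def S_def by (rule integral_cells_approx[OF lnc aw])
  \<comment> \<open>The cell approximation on level 0, with the constant 0.\<close>
  have JL: "\<bar>J\<bar> \<le> \<Lambda>"
    using integral_cells_approx[OF lnc, of 0 "\<lambda>_. 0" \<Lambda>] bd unfolding J_def by simp
  \<comment> \<open>Passing from the cell values to the integral costs another
    \<open>K * \<omega>\<close>, and supplying the missing \<open>r * J\<close> another
    \<open>r * \<Lambda>\<close>. This explains the factors 2 and \<open>12 = 2 * 6\<close>.\<close>
  have "\<bar>K * (J - S / 3 ^ N)\<bar> \<le> K * \<omega>" unfolding abs_mult using JS K0 by (simp add: mult_left_mono)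
  moreover have "K * (J - S / 3 ^ N) = K * J - real (card A) * S" by (simp add: K_def field_simps)
  moreover have "\<bar>r * J\<bar> \<le> r * \<Lambda>" unfolding abs_mult using JL K0 by (simp add: mult_left_mono)
  ultimately have "\<bar>ln X - (K + r) * J\<bar> \<le> 2 * (K * \<omega>) + 2 * (r * \<Lambda>)"
    using up low unfolding distrib_right by linarith
  also have "\<dots> \<le> 2 * (real d * \<omega>) + 2 * (6 * 3 ^ N * \<Lambda>)"
  proof -
    have "\<omega> \<ge> 0" using JS by linarith
    moreover have "\<Lambda> \<ge> 0" using JL by linarith
    moreover have "r \<le> 6 * 3 ^ N"
      using of_nat_mono[OF R(5), where ?'a = real] unfolding r_def by simp
    ultimately have "K * \<omega> \<le> real d * \<omega>" "r * \<Lambda> \<le> 6 * 3 ^ N * \<Lambda>"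
      using dK K0 by (intro mult_right_mono; simp)+
    then show ?thesis by linarith
  qed
  finally have "\<bar>ln X - real d * J\<bar> \<le> real d * (2 * \<omega> + 12 * \<Lambda> * 3 ^ N / real d)"
    using d(2) unfolding dK[symmetric] by (simp add: algebra_simps)
  moreover have "ln X - real d * J = real d * (1 / real d * ln X - J)" using d(2) by (simp add: algebra_simps)
  ultimately have "real d * \<bar>1 / real d * ln X - J\<bar> \<le> real d * (2 * \<omega> + 12 * \<Lambda> * 3 ^ N / real d)"
    by (simp add: abs_mult)
  then have "\<bar>1 / real d * ln X - J\<bar> \<le> 2 * \<omega> + 12 * \<Lambda> * 3 ^ N / real d"
    by (rule mult_left_le_imp_le) (use d(2) in simp)
  then show ?thesis unfolding X_def J_def .
qed

text \<open>A nonzero localized eigenfunction can be placed in each of the \<open>3 ^ N\<close>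
  cells, and the copies are independent.\<close>

lemma dim_lower_bound:
  assumes v: "v \<in> loc_space (l / 5 ^ N)" "v \<noteq> 0"
  shows "3 ^ N \<le> fun_space.dim (eigenspace l)"
proof -
  obtain A R where A: "finite A" "fun_space.independent A" "fun_space.span A = loc_space (l / 5 ^ N)"
    and R: "finite R" "loc_basis N A \<inter> R = {}" "fun_space.independent (loc_basis N A \<union> R)"
    "fun_space.span (loc_basis N A \<union> R) = eigenspace l" "card R \<le> 6 * 3 ^ N"
    by (rule eigenspace_basis)
  have "A \<noteq> {}" using v A(3) by auto
  then have cA: "card A \<ge> 1" using A(1) by (simp add: Suc_le_eq card_gt_0_iff)
  have AL: "A \<subseteq> loc_space (l / 5 ^ N)" using fun_space.span_superset[of A] A(3) by simp
  have fL: "finite (loc_basis N A)" unfolding loc_basis_def using finite_words A(1) by blast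
  have "card (loc_basis N A) = 3 ^ N * card A"
    unfolding loc_basis_def card_image[OF inj_loc[OF A(2,1) AL]] by (simp add: card_cartesian_product card_words)
  then have "3 ^ N \<le> card (loc_basis N A)" using cA by simp
  also have "\<dots> \<le> card (loc_basis N A \<union> R)" using fL R(1) by (intro card_mono) auto
  also have "\<dots> = fun_space.dim (eigenspace l)"
    using fun_space.dim_span_eq_card_independent[OF R(3)] R(4) by simp
  finally show ?thesis .
qed

section \<open>Asymptotics\<close>

lemma ln_diff_le:
  fixes x y :: real
  assumes "0 < c" "c \<le> x" "c \<le> y"
  shows "\<bar>ln x - ln y\<bar> \<le> \<bar>x - y\<bar> / c"
proof -
  have *: "ln u - ln v \<le> \<bar>u - v\<bar> / c" if "c \<le> u" "c \<le> v" for u v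
  proof -
    have p: "0 < u" "0 < v" using assms(1) that by auto
    have "ln u - ln v = ln (u / v)" using p by (simp add: ln_div)
    also have "\<dots> \<le> u / v - 1" using p by (intro ln_le_minus_one) simp
    also have "\<dots> = (u - v) / v" using p by (simp add: field_simps)
    also have "\<dots> \<le> \<bar>u - v\<bar> / v" using p by (intro divide_right_mono) auto
    also have "\<dots> \<le> \<bar>u - v\<bar> / c" using assms(1) that p by (intro divide_left_mono) auto
    finally show ?thesis .
  qed
  show ?thesis using *[OF assms(2,3)] *[OF assms(3,2)] by (simp add: abs_le_iff abs_minus_commute)
qed

lemma cell_modulus:
  assumes g: "continuous_on SG (g :: point \<Rightarrow> real)" and e: "e > 0"
  shows "\<exists>N. \<forall>w\<in>words N. \<forall>x\<in>cell w. \<forall>y\<in>cell w. \<bar>g x - g y\<bar> \<le> e"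
proof -
  obtain \<delta> where d: "\<delta> > 0" "\<forall>x\<in>SG. \<forall>x'\<in>SG. dist x' x < \<delta> \<longrightarrow> dist (g x') (g x) < e"
    using compact_uniformly_continuous[OF g compact_SG] e unfolding uniformly_continuous_on_def by blast
  obtain D where D: "\<And>w x y. x \<in> cell w \<Longrightarrow> y \<in> cell w \<Longrightarrow> dist x y \<le> D / 2 ^ length w"
    using cell_diam by blast
  have "(\<lambda>m. D * (1/2) ^ m) \<longlonglongrightarrow> D * 0" by (intro tendsto_intros) auto
  then have "\<forall>\<^sub>F m in sequentially. D * (1/2) ^ m < \<delta>" using d(1) by (intro order_tendstoD(2)) auto
  then obtain N where N: "D * (1/2) ^ N < \<delta>" unfolding eventually_sequentially by blast
  have "\<bar>g x - g y\<bar> \<le> e" if w: "w \<in> words N" and x: "x \<in> cell w" and y: "y \<in> cell w" for w x y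
  proof -
    have "dist x y \<le> D / 2 ^ N" using D[OF x y] words_length[OF w] by simp
    then have "dist x y < \<delta>" using N by (simp add: power_one_over)
    moreover have "x \<in> SG" "y \<in> SG" using cell_subset_SG[OF w] x y by blast+
    ultimately have "dist (g x) (g y) < e" using d(2) by blast
    then show ?thesis unfolding dist_real_def by simp
  qed
  then show ?thesis by blast
qed

text \<open>Balancing the oscillation \<open>(3/5)^(\<alpha> N)\<close> against \<open>3^N / d\<close> by taking \<open>3^N\<close> close to
  \<open>d^(1 - \<beta>)\<close>.\<close>

lemma balance_scale:
  fixes \<alpha> \<beta> d :: real
  assumes a: "\<alpha> > 0" and d: "d \<ge> 1" and b: "\<beta> = \<alpha> * ln (5/3) / (ln 3 + \<alpha> * ln (5/3))"
  obtains N where "3 ^ N / d \<le> d powr (-\<beta>)" "((3/5) ^ N) powr \<alpha> \<le> exp (\<alpha> * ln (5/3)) * d powr (-\<beta>)"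
proof -
  define s where "s = \<alpha> * ln (5/3)"
  have s: "s > 0" unfolding s_def using a by (intro mult_pos_pos) auto
  have l3: "ln (3::real) > 0" by simp
  have b': "\<beta> = s / (ln 3 + s)" using b by (simp add: s_def)
  have sum0: "ln 3 + s > 0" using s l3 by linarith
  \<comment> \<open>The real solution of \<open>3 powr t = d powr (1 - \<beta>)\<close>; it also
    satisfies \<open>(3/5) powr (\<alpha> * t) = d powr (- \<beta>)\<close>, so both error terms
    have the same size.\<close>
  define t where "t = ln d / (ln 3 + s)"
  have t: "t \<ge> 0" unfolding t_def using d sum0 by simp
  have e1: "- \<beta> * ln d = - (s * t)" unfolding b' t_def by simp
  have e2: "ln d - s * t = t * ln 3"
  proof -
    have "ln d = t * (ln 3 + s)" unfolding t_def using sum0 by simp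
    then show ?thesis by (simp add: algebra_simps)
  qed
  \<comment> \<open>Rounding down keeps the bound for \<open>3 ^ N\<close> and costs at most one
    level in the oscillation, that is the factor \<open>exp s = (5/3) powr \<alpha>\<close>.\<close>
  define N where "N = nat \<lfloor>t\<rfloor>"
  have N: "real N \<le> t" "t \<le> real N + 1" unfolding N_def using t by linarith+
  have dp: "d powr (-\<beta>) = exp (- (s * t))" using d e1 by (simp add: powr_def)
  show thesis
  proof (rule that[of N])
    have "(3::real) ^ N = exp (real N * ln 3)" by (simp add: exp_of_nat_mult)
    also have "\<dots> \<le> exp (t * ln 3)" using N(1) l3 by (simp add: mult_right_mono)
    also have "\<dots> = exp (ln d) * exp (- (s * t))" unfolding e2[symmetric] by (simp flip: exp_add)
    also have "\<dots> = d * d powr (-\<beta>)" unfolding dp using d by simp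
    finally show "3 ^ N / d \<le> d powr (-\<beta>)" using d by (simp add: divide_le_eq mult.commute)
    have "((3/5::real) ^ N) powr \<alpha> = exp (\<alpha> * (real N * ln (3/5)))" by (simp add: powr_def ln_realpow)
    also have "ln (3/5::real) = - ln (5/3)" by (simp add: ln_div)
    also have "\<alpha> * (real N * - ln (5/3)) = - (s * real N)" by (simp add: s_def)
    also have "exp (- (s * real N)) \<le> exp (s - s * t)"
    proof -
      have "s * t \<le> s * (real N + 1)" using N(2) s by (intro mult_left_mono) auto
      then show ?thesis by (simp add: algebra_simps)
    qed
    also have "\<dots> = exp s * d powr (-\<beta>)" unfolding dp by (simp flip: exp_add)
    finally show "((3/5) ^ N) powr \<alpha> \<le> exp (\<alpha> * ln (5/3)) * d powr (-\<beta>)" by (simp only: s_def)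
  qed
qed

theorem theorem1:
  fixes l :: "nat \<Rightarrow> real" and f :: "point \<Rightarrow> real"
    and E :: "nat \<Rightarrow> (point \<Rightarrow> real) set"
    and d :: "nat \<Rightarrow> nat"
    and P :: "nat \<Rightarrow> (point \<Rightarrow> real) \<Rightarrow> point \<Rightarrow> real"
  assumes "\<And>j. j \<ge> 1 \<Longrightarrow> five_series j (l j) \<or> six_series j (l j)"
    and "\<And>j. E j = eigenspace (l j)"
    and "\<And>j. d j = fun_space.dim (E j)"
    and "\<And>j. P j = ortho_proj (E j)"
    and "continuous_on SG f"
    and "\<And>x. x \<in> SG \<Longrightarrow> f x > 0"
  shows "((\<lambda>j. 1 / real (d j) * ln (operator_det (E j) (P j \<circ> mult_op f \<circ> P j)))
            \<longlonglongrightarrow> (LINT x|sg_measure. ln (f x)))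
    \<and> (\<forall>\<alpha> \<beta>. \<alpha> > 0 \<longrightarrow> holder_resistance \<alpha> f
          \<longrightarrow> \<beta> = \<alpha> * ln (5/3) / (ln 3 + \<alpha> * ln (5/3))
          \<longrightarrow> \<beta> = 1 - ln 3 / (\<alpha> * ln (5/3) + ln 3)
            \<and> (\<lambda>j. 1 / real (d j) * ln (operator_det (E j) (P j \<circ> mult_op f \<circ> P j))
                   - (LINT x|sg_measure. ln (f x)))
               \<in> O(\<lambda>j. real (d j) powr (- \<beta>)))"
proof -
  note f = assms(5,6)
  define X where "X j = 1 / real (d j) * ln (operator_det (E j) (P j \<circ> mult_op f \<circ> P j))" for j
  define J where "J = (LINT x|sg_measure. ln (f x))"
  have lnc: "continuous_on SG (\<lambda>x. ln (f x))" using f by (intro continuous_on_ln) (auto simp: less_imp_neq[symmetric])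
  obtain p where p: "\<And>y. y \<in> SG \<Longrightarrow> \<bar>ln (f y)\<bar> \<le> \<bar>ln (f p)\<bar>" using bounded_on_SG[OF lnc] by blast
  define \<Lambda> where "\<Lambda> = \<bar>ln (f p)\<bar>"
  have L: "\<And>x. x \<in> SG \<Longrightarrow> \<bar>ln (f x)\<bar> \<le> \<Lambda>" unfolding \<Lambda>_def by (rule p)
  have d_ge: "3 ^ (j - 2) \<le> d j" if j: "j \<ge> 2" for j
  proof -
    have "five_series j (l j) \<or> six_series j (l j)" using assms(1)[of j] j by simp
    from loc_space_series[OF j this] obtain v where "v \<in> loc_space (l j / 5 ^ (j - 2))" "v \<noteq> 0" by blast
    from dim_lower_bound[OF this] show ?thesis unfolding assms(2,3) .
  qed
  have d1: "d j \<ge> 1" if "j \<ge> 2" for j using d_ge[OF that] one_le_power[of "3::nat" "j - 2"] by linarith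
  have main: "\<bar>X j - J\<bar> \<le> 2 * \<omega> + 12 * \<Lambda> * 3 ^ N / real (d j)"
    if j: "j \<ge> 2" and osc: "\<And>w x y. w \<in> words N \<Longrightarrow> x \<in> cell w \<Longrightarrow> y \<in> cell w \<Longrightarrow> \<bar>ln (f x) - ln (f y)\<bar> \<le> \<omega>"
    for j N \<omega>
    unfolding X_def J_def assms(4)
    by (rule log_det_estimate[OF f osc L assms(2,3)]) (use d1[OF j] in simp_all)
  have "X \<longlonglongrightarrow> J"
  proof (rule LIMSEQ_I)
    fix e :: real assume e: "e > 0"
    \<comment> \<open>The level \<open>N\<close> is fixed before \<open>j\<close> grows. The two
      errors are then \<open>2 * (e / 8)\<close> and less than \<open>e / 4\<close>.\<close>
    obtain N where N: "\<And>w x y. w \<in> words N \<Longrightarrow> x \<in> cell w \<Longrightarrow> y \<in> cell w \<Longrightarrow> \<bar>ln (f x) - ln (f y)\<bar> \<le> e / 8"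
      using cell_modulus[OF lnc, of "e / 8"] e by auto
    have "(\<lambda>j. 12 * \<Lambda> * 3 ^ N * (1/3) ^ j) \<longlonglongrightarrow> 12 * \<Lambda> * 3 ^ N * 0" by (intro tendsto_intros) auto
    then have "\<forall>\<^sub>F j in sequentially. 12 * \<Lambda> * 3 ^ N * (1/3) ^ j < e / 4" using e by (intro order_tendstoD(2)) auto
    then obtain M where M: "\<And>j. j \<ge> M \<Longrightarrow> 12 * \<Lambda> * 3 ^ N * (1/3) ^ j < e / 4"
      unfolding eventually_sequentially by blast
    have "\<bar>X j - J\<bar> < e" if j: "j \<ge> M + 2" for j
    proof -
      have j2: "j \<ge> 2" "j - 2 \<ge> M" using j by auto
      have "(3 :: real) ^ (j - 2) \<le> real (d j)" using d_ge[OF j2(1)] by (simp flip: of_nat_le_iff)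
      then have "12 * \<Lambda> * 3 ^ N / real (d j) \<le> 12 * \<Lambda> * 3 ^ N / 3 ^ (j - 2)"
        by (intro divide_left_mono) (auto simp: \<Lambda>_def intro!: mult_pos_pos intro: less_le_trans[of 0 "3 ^ (j - 2)"])
      also have "\<dots> < e / 4" using M[OF j2(2)] by (simp add: power_one_over)
      finally have "12 * \<Lambda> * 3 ^ N / real (d j) < e / 4" .
      moreover have "\<bar>X j - J\<bar> \<le> 2 * (e / 8) + 12 * \<Lambda> * 3 ^ N / real (d j)"
        by (rule main[OF j2(1) N])
      ultimately have "\<bar>X j - J\<bar> < 2 * (e / 8) + e / 4" by linarith
      then show ?thesis using e by linarith
    qed
    then show "\<exists>no. \<forall>j\<ge>no. norm (X j - J) < e" by auto
  qed
  moreover have "\<beta> = 1 - ln 3 / (\<alpha> * ln (5/3) + ln 3) \<and> (\<lambda>j. X j - J) \<in> O(\<lambda>j. real (d j) powr (- \<beta>))"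
    if a: "\<alpha> > 0" and H: "holder_resistance \<alpha> f" and b: "\<beta> = \<alpha> * ln (5/3) / (ln 3 + \<alpha> * ln (5/3))" for \<alpha> \<beta>
  proof
    have "\<alpha> * ln (5/3) > 0" using a by (intro mult_pos_pos) auto
    then have "ln 3 + \<alpha> * ln (5/3) > 0" by (simp add: add_pos_pos)
    then show "\<beta> = 1 - ln 3 / (\<alpha> * ln (5/3) + ln 3)" unfolding b by (simp add: field_simps)
    obtain C where C: "\<And>x y. x \<in> SG \<Longrightarrow> y \<in> SG \<Longrightarrow> \<bar>f x - f y\<bar> \<le> C * resistance x y powr \<alpha>"
      using H unfolding holder_resistance_def by blast
    \<comment> \<open>A positive lower bound for \<open>f\<close> on SG, which turns the Hoelder
      estimate for \<open>f\<close> into one for \<open>ln f\<close>.\<close>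
    define c where "c = exp (- \<Lambda>)"
    have c: "c > 0" "\<And>x. x \<in> SG \<Longrightarrow> c \<le> f x"
    proof -
      show "c > 0" by (simp add: c_def)
      fix x assume x: "x \<in> SG"
      have "- \<Lambda> \<le> ln (f x)" using L[OF x] by linarith
      then have "exp (- \<Lambda>) \<le> exp (ln (f x))" by simp
      then show "c \<le> f x" using f(2)[OF x] by (simp add: c_def)
    qed
    define B where "B = \<bar>C\<bar> * 100 powr \<alpha> / c"
    have B0: "B \<ge> 0" using c(1) by (simp add: B_def)
    have osc: "\<bar>ln (f x) - ln (f y)\<bar> \<le> B * ((3/5) ^ N) powr \<alpha>"
      if w: "w \<in> words N" and x: "x \<in> cell w" and y: "y \<in> cell w" for N w x y
    proof -
      have s: "x \<in> SG" "y \<in> SG" using cell_subset_SG[OF w] x y by blast+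
      have "resistance x y powr \<alpha> \<le> (100 * (3/5) ^ N) powr \<alpha>"
        using resistance_le[OF w x y] a by (intro powr_mono2) auto
      also have "\<dots> = 100 powr \<alpha> * ((3/5) ^ N) powr \<alpha>" by (rule powr_mult)
      finally have R: "resistance x y powr \<alpha> \<le> 100 powr \<alpha> * ((3/5) ^ N) powr \<alpha>" .
      have "\<bar>ln (f x) - ln (f y)\<bar> \<le> \<bar>f x - f y\<bar> / c" by (rule ln_diff_le[OF c(1) c(2)[OF s(1)] c(2)[OF s(2)]])
      also have "\<dots> \<le> (C * resistance x y powr \<alpha>) / c" using C[OF s] c(1) by (intro divide_right_mono) auto
      also have "\<dots> \<le> (\<bar>C\<bar> * (100 powr \<alpha> * ((3/5) ^ N) powr \<alpha>)) / c"
        using R c(1) by (intro divide_right_mono mult_mono) auto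
      also have "\<dots> = B * ((3/5) ^ N) powr \<alpha>" by (simp add: B_def)
      finally show ?thesis .
    qed
    define K where "K = 2 * B * exp (\<alpha> * ln (5/3)) + 12 * \<Lambda>"
    have bound: "\<bar>X j - J\<bar> \<le> K * real (d j) powr (-\<beta>)" if j: "j \<ge> 2" for j
    proof -
      have dj: "real (d j) \<ge> 1" using d1[OF j] by simp
      \<comment> \<open>In contrast to the first claim, the level of the cells now varies with
        \<open>j\<close>.\<close>
      obtain N where N: "3 ^ N / real (d j) \<le> real (d j) powr (-\<beta>)"
        "((3/5) ^ N) powr \<alpha> \<le> exp (\<alpha> * ln (5/3)) * real (d j) powr (-\<beta>)"
        by (rule balance_scale[OF a dj b])
      have "\<bar>X j - J\<bar> \<le> 2 * (B * ((3/5) ^ N) powr \<alpha>) + 12 * \<Lambda> * 3 ^ N / real (d j)"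
        by (rule main[OF j osc])
      moreover have "B * ((3/5) ^ N) powr \<alpha> \<le> B * (exp (\<alpha> * ln (5/3)) * real (d j) powr (-\<beta>))"
        by (rule mult_left_mono[OF N(2) B0])
      moreover have "12 * \<Lambda> * (3 ^ N / real (d j)) \<le> 12 * \<Lambda> * real (d j) powr (-\<beta>)"
        by (rule mult_left_mono[OF N(1)]) (simp add: \<Lambda>_def)
      ultimately show ?thesis unfolding K_def by (simp add: algebra_simps)
    qed
    show "(\<lambda>j. X j - J) \<in> O(\<lambda>j. real (d j) powr (- \<beta>))"
    proof (rule bigoI)
      show "\<forall>\<^sub>F j in sequentially. norm (X j - J) \<le> K * norm (real (d j) powr (- \<beta>))"
        by (rule eventually_sequentiallyI[of 2]) (use bound in simp)
    qed
  qed
  ultimately show ?thesis unfolding X_def J_def by blast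
qed

end
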